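(* For the Gaussian state-dependent multiaccess channel described in the context, for $\rho\in[-1,0]$ let $\tilde Q(\rho)=(\sqrt Q+\rho\sqrt{P_2})^2$. The capacity region $\mathcal C_G$ contains the union, over all $\theta\in[0,1]$ (with $\bar\theta=1-\theta$), $\xi\in[0,1]$, $\rho\in[-\sqrt{1-\xi},0]$, and $\alpha\in\mathbb R$ such that all logarithm terms below are non-negative real numbers, of the set of rate pairs $(R_c,R_1)$ satisfying $$R_1<\tfrac12\log\Big(1+\frac{\theta P_1}{N+\frac{P_2\xi\tilde Q(\rho)(1-\alpha)^2}{P_2\xi+\alpha^2\tilde Q(\rho)}}\Big),$$ $$R_1<\tfrac12\log\Big(\frac{P_2\xi\,(P_2\xi+\tilde Q(\rho)+N+\theta P_1)}{P_2\xi\tilde Q(\rho)(1-\alpha)^2+N(P_2\xi+\alpha^2\tilde Q(\rho))}\Big),$$ $$R_c+R_1<\tfrac12\log\Big(1+\frac{(\sqrt{\bar\theta P_1}+\sqrt{1-\xi-\rho^2}\sqrt{P_2})^2+\theta P_1}{P_2\xi+\tilde Q(\rho)+N}\Big)+\tfrac12\log\Big(\frac{P_2\xi\,(P_2\xi+\tilde Q(\rho)+N)}{P_2\xi\tilde Q(\rho)(1-\alpha)^2+N(P_2\xi+\alpha^2\tilde Q(\rho))}\Big).$$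
   Context: Gaussian model: at each time $i$, $Y_i=X_{1,i}+X_{2,i}+S_i+Z_i$, where $S_i\sim\mathcal N(0,Q)$ (state) and $Z_i\sim\mathcal N(0,N)$ (noise), all $S_i,Z_i$ mutually independent across time and of each other, and independent of the messages; $Q,N>0$. Two independent uniformly distributed messages: a common message $W_c$ of rate $R_c$ and an individual message $W_1$ of rate $R_1$. The uninformed encoder maps $(W_c,W_1)$ to $X_1^n$; the informed encoder knows the entire state sequence $S^n$ non-causally and maps $(S^n,W_c)$ to $X_2^n$; the decoder, which does not know the state, maps $Y^n$ to an estimate of $(W_c,W_1)$. Power constraints: $\sum_{i=1}^n X_{1,i}^2\le nP_1$ and $\sum_{i=1}^n X_{2,i}^2\le nP_2$. A rate pair is achievable if there are codes satisfying these constraints whose probability of decoding error $\Pr[\psi^n(Y^n)\neq (W_c,W_1)]$ tends to $0$ as $n\to\infty$; $\mathcal C_G$ is the closure of the set of achievable pairs. *)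

theory Defs
  imports "HOL-Probability.Probability"
begin

definition state_noise_measure :: "nat \<Rightarrow> real \<Rightarrow> real \<Rightarrow> ((nat \<Rightarrow> real) \<times> (nat \<Rightarrow> real)) measure" where
  "state_noise_measure n Q N =
     (PiM {..<n} (\<lambda>_. density lborel (normal_density 0 (sqrt Q))))
     \<Otimes>\<^sub>M (PiM {..<n} (\<lambda>_. density lborel (normal_density 0 (sqrt N))))"

definition chan_out :: "nat \<Rightarrow> (nat \<Rightarrow> nat \<Rightarrow> nat \<Rightarrow> real) \<Rightarrow> ((nat \<Rightarrow> real) \<Rightarrow> nat \<Rightarrow> nat \<Rightarrow> real)
     \<Rightarrow> nat \<Rightarrow> nat \<Rightarrow> (nat \<Rightarrow> real) \<Rightarrow> (nat \<Rightarrow> real) \<Rightarrow> (nat \<Rightarrow> real)" where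
  "chan_out n f1 f2 wc w1 s z = restrict (\<lambda>i. f1 wc w1 i + f2 s wc i + s i + z i) {..<n}"

definition err_event where
  "err_event n Q N f1 f2 g wc w1 =
     {(s, z) \<in> space (state_noise_measure n Q N). g (chan_out n f1 f2 wc w1 s z) \<noteq> (wc, w1)}"

text \<open>A code of block length n with message sets {..<Mc} and {..<M1}:
  uninformed encoder f1 (wc,w1) \<mapsto> X1^n, informed encoder f2 (S^n, wc) \<mapsto> X2^n,
  decoder g Y^n \<mapsto> (wc,w1).  Power constraints hold for every message and every state sequence.
  Error events are required to be measurable (so their probabilities are meaningful).\<close>
definition valid_code :: "nat \<Rightarrow> nat \<Rightarrow> nat \<Rightarrow> real \<Rightarrow> real \<Rightarrow> real \<Rightarrow> real
     \<Rightarrow> (nat \<Rightarrow> nat \<Rightarrow> nat \<Rightarrow> real) \<Rightarrow> ((nat \<Rightarrow> real) \<Rightarrow> nat \<Rightarrow> nat \<Rightarrow> real)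
     \<Rightarrow> ((nat \<Rightarrow> real) \<Rightarrow> nat \<times> nat) \<Rightarrow> bool" where
  "valid_code n Mc M1 P1 P2 Q N f1 f2 g \<longleftrightarrow>
     (\<forall>wc<Mc. \<forall>w1<M1. (\<Sum>i<n. (f1 wc w1 i)\<^sup>2) \<le> real n * P1) \<and>
     (\<forall>s. \<forall>wc<Mc. (\<Sum>i<n. (f2 s wc i)\<^sup>2) \<le> real n * P2) \<and>
     (\<forall>wc<Mc. \<forall>w1<M1. err_event n Q N f1 f2 g wc w1 \<in> sets (state_noise_measure n Q N))"

definition err_prob where
  "err_prob n Mc M1 Q N f1 f2 g =
     (\<Sum>wc<Mc. \<Sum>w1<M1. measure (state_noise_measure n Q N) (err_event n Q N f1 f2 g wc w1))
       / (real Mc * real M1)"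

definition msg_num :: "nat \<Rightarrow> real \<Rightarrow> nat" where
  "msg_num n R = nat \<lceil>2 powr (real n * R)\<rceil>"

definition achievable :: "real \<Rightarrow> real \<Rightarrow> real \<Rightarrow> real \<Rightarrow> real \<times> real \<Rightarrow> bool" where
  "achievable P1 P2 Q N RR \<longleftrightarrow> (case RR of (Rc, R1) \<Rightarrow>
     (\<exists>f1 f2 g. (\<forall>n. valid_code n (msg_num n Rc) (msg_num n R1) P1 P2 Q N (f1 n) (f2 n) (g n)) \<and>
        (\<lambda>n. err_prob n (msg_num n Rc) (msg_num n R1) Q N (f1 n) (f2 n) (g n)) \<longlonglongrightarrow> 0))"

definition capacity_region_G :: "real \<Rightarrow> real \<Rightarrow> real \<Rightarrow> real \<Rightarrow> (real \<times> real) set" where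
  "capacity_region_G P1 P2 Q N = closure {RR. achievable P1 P2 Q N RR}"

definition Qt :: "real \<Rightarrow> real \<Rightarrow> real \<Rightarrow> real" where
  "Qt Q P2 \<rho> = (sqrt Q + \<rho> * sqrt P2)\<^sup>2"

end

theory Submission
  imports Defs "HOL-Real_Asymp.Real_Asymp"
begin

text \<open>
  Random coding with binning against the state. The common message chooses a codeword \<open>v\<close> sent coherently by both
  encoders; both messages choose a codeword \<open>x\<close>; and for each common message there is a list of auxiliary codewords
  \<open>u\<close>. The informed encoder cancels a fraction of the state, leaving \<open>S' = (1 + \<kappa>) S\<close>, looks for the first \<open>u\<close>
  that is good for the state, and sends \<open>u - \<alpha> S'\<close> on top. The decoder looks for the unique message pair for which
  some \<open>u\<close> makes three likelihood ratios large.

  Wrong candidates are handled for each fixed channel output: a likelihood ratio has mean one under the independent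
  law of the codewords, so Markov's inequality applies whatever the true output law is. A wrong \<open>u\<close> in the right list
  is not independent of the output, but it becomes so once the encoder's choice is replaced by the first good index
  among the \<^emph>\<open>other\<close> ones, which is the same index whenever that \<open>u\<close> was not chosen. Goodness of \<open>(s, u)\<close> is defined
  as a small conditional probability of failure, so that conditional typicality reduces to Markov's inequality and
  a Chebyshev bound for the ideal joint law. All powers are scaled by \<open>t\<^sup>2 < 1\<close> so that the power constraints hold with
  high probability; continuity in \<open>t\<close> preserves the strict rate inequalities.
\<close>

section \<open>Products of probability spaces\<close>

text \<open>The informed encoder does not know the individual message, so its list of
  \<open>u\<close> can depend only on the common message. Slightly more than exp (n *
  \<open>I0\<close>) entries are needed for the list to contain a good one. A wrong individual
  message may come with the right \<open>u\<close> or with another entry of the same list, and a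
  wrong common message comes with a fresh list; in nats these three events give R1 <
  \<open>I1\<close>, R1 + \<open>I0\<close> < \<open>I2\<close> and Rc + R1 + \<open>I0\<close> <
  \<open>I3\<close>. Subtracting \<open>I0 = ln (Du / p) / 2\<close> produces the factor P2 * \<xi>
  in the numerators of the stated ratios. With \<kappa> = \<rho> * sqrt P2 / sqrt Q the remaining
  state has variance \<open>Qt Q P2 \<rho>\<close>. The power P2 splits into \<rho>^2 * P2 for
  cancellation, \<xi> * P2 for \<open>u - \<alpha> S'\<close> and the rest for \<open>v\<close>; P1
  splits into \<theta> * P1 for \<open>x\<close> and the rest for \<open>v\<close>.\<close>

lemma borel_measurable_of_bool_ennreal [measurable (raw)]:
  "Measurable.pred M P \<Longrightarrow> (\<lambda>x. of_bool (P x) :: ennreal) \<in> borel_measurable M"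
  unfolding of_bool_def by measurable

lemma emeasure_eq_nn_integral_of_bool:
  assumes "{x \<in> space M. P x} \<in> sets M"
  shows "emeasure M {x \<in> space M. P x} = (\<integral>\<^sup>+x. of_bool (P x) \<partial>M)"
  by (subst nn_integral_indicator[OF assms, symmetric], rule nn_integral_cong) (auto simp: indicator_def)

text \<open>The inner integral does not depend on the coordinate it overwrites, so integrating that
  coordinate out changes nothing. Independence of a codeword from the others is used below in this
  form: redraw it and keep everything else fixed.\<close>

lemma nn_integral_PiM_resample:
  assumes fin: "finite I" and i: "i \<in> I" and ps: "\<And>i. prob_space (M i)"
    and f [measurable]: "f \<in> borel_measurable (PiM I M)"
  shows "(\<integral>\<^sup>+w. f w \<partial>PiM I M) = (\<integral>\<^sup>+w. (\<integral>\<^sup>+x. f (w(i := x)) \<partial>M i) \<partial>PiM I M)"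
proof -
  interpret product_prob_space M by (rule product_prob_spaceI) (rule ps)
  define J where "J = I - {i}"
  have J: "finite J" "i \<notin> J" and I: "I = insert i J"
    using fin i by (auto simp: J_def)
  have upd [measurable]: "(\<lambda>(w, x). w(i := x)) \<in> measurable (PiM I M \<Otimes>\<^sub>M M i) (PiM I M)"
    using measurable_add_dim[of i I M] i by (simp add: insert_absorb)
  have "(\<lambda>(w, x). f (w(i := x))) \<in> borel_measurable (PiM I M \<Otimes>\<^sub>M M i)"
    using measurable_comp[OF upd f] by (simp add: comp_def split_beta')
  then have g: "(\<lambda>w. \<integral>\<^sup>+x. f (w(i := x)) \<partial>M i) \<in> borel_measurable (PiM I M)"
    by measurable
  have "(\<integral>\<^sup>+w. (\<integral>\<^sup>+x. f (w(i := x)) \<partial>M i) \<partial>PiM I M)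
      = (\<integral>\<^sup>+w. (\<integral>\<^sup>+x'. (\<integral>\<^sup>+x. f (w(i := x)) \<partial>M i) \<partial>M i) \<partial>PiM J M)"
    using g unfolding I by (subst product_nn_integral_insert[OF J]) simp_all
  also have "\<dots> = (\<integral>\<^sup>+w. (\<integral>\<^sup>+x. f (w(i := x)) \<partial>M i) \<partial>PiM J M)"
    by (simp add: prob_space.emeasure_space_1[OF ps])
  also have "\<dots> = (\<integral>\<^sup>+w. f w \<partial>PiM I M)"
    using f unfolding I by (subst product_nn_integral_insert[OF J]) simp_all
  finally show ?thesis ..
qed

lemma measurable_PiM_update [measurable (raw)]:
  assumes "i \<in> I" "f \<in> measurable N (PiM I M)" "g \<in> measurable N (M i)"
  shows "(\<lambda>y. (f y)(i := g y)) \<in> measurable N (PiM I M)"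
proof -
  have "(\<lambda>(w, x). w(i := x)) \<in> measurable (PiM I M \<Otimes>\<^sub>M M i) (PiM I M)"
    using measurable_add_dim[of i I M] assms(1) by (simp add: insert_absorb)
  from measurable_compose[OF measurable_Pair[OF assms(2,3)] this] show ?thesis by simp
qed

lemma nn_integral_PiM_resample2:
  assumes fin: "finite I" and i: "i \<in> I" "j \<in> I" and ps: "\<And>i. prob_space (M i)"
    and f [measurable]: "f \<in> borel_measurable (PiM I M)"
  shows "(\<integral>\<^sup>+w. f w \<partial>PiM I M) = (\<integral>\<^sup>+w. \<integral>\<^sup>+x. \<integral>\<^sup>+y. f (w(i := x, j := y)) \<partial>M j \<partial>M i \<partial>PiM I M)"
proof -
  interpret j: prob_space "M j" by (rule ps)
  have "(\<lambda>w. \<integral>\<^sup>+y. f (w(j := y)) \<partial>M j) \<in> borel_measurable (PiM I M)"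
    using i by measurable
  from nn_integral_PiM_resample[OF fin i(1) ps this] show ?thesis
    by (subst nn_integral_PiM_resample[OF fin i(2) ps f]) simp
qed

lemma nn_integral_PiM_resample3:
  assumes fin: "finite I" and i: "i \<in> I" "j \<in> I" "k \<in> I" and ps: "\<And>i. prob_space (M i)"
    and f [measurable]: "f \<in> borel_measurable (PiM I M)"
  shows "(\<integral>\<^sup>+w. f w \<partial>PiM I M) = (\<integral>\<^sup>+w. \<integral>\<^sup>+x. \<integral>\<^sup>+y. \<integral>\<^sup>+z. f (w(i := x, j := y, k := z)) \<partial>M k \<partial>M j \<partial>M i \<partial>PiM I M)"
proof -
  interpret k: prob_space "M k" by (rule ps)
  have "(\<lambda>w. \<integral>\<^sup>+y. f (w(k := y)) \<partial>M k) \<in> borel_measurable (PiM I M)"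
    using i by measurable
  from nn_integral_PiM_resample2[OF fin i(1,2) ps this] show ?thesis
    by (subst nn_integral_PiM_resample[OF fin i(3) ps f]) simp
qed

text \<open>The default 0 keeps the index below any positive \<open>M\<close> even when nothing
  qualifies, so a codeword is always sent; the absence of a good index is counted as an error of its
  own.\<close>

definition first_below :: "nat \<Rightarrow> (nat \<Rightarrow> bool) \<Rightarrow> nat" where
  "first_below M P = (if \<exists>j<M. P j then LEAST j. P j else 0)"

lemma first_below_less: "M > 0 \<Longrightarrow> first_below M P < M"
  unfolding first_below_def by (auto intro: le_less_trans[OF Least_le])

lemma first_below_sat: "\<exists>j<M. P j \<Longrightarrow> P (first_below M P)"
  unfolding first_below_def by (auto intro: LeastI)

lemma first_below_cong: "(\<And>j. P j = Q j) \<Longrightarrow> first_below M P = first_below M Q"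
  by presburger

text \<open>A least element stays least in any subset that contains it. This permits replacing the
  encoder's choice by one that never looks at a particular other index.\<close>

lemma first_below_restrict:
  assumes "\<exists>j<M. P j" "K (first_below M P)"
  shows "first_below M (\<lambda>j. K j \<and> P j) = first_below M P"
proof -
  define J where "J = first_below M P"
  have J: "J = (LEAST j. P j)" using assms(1) by (simp add: J_def first_below_def)
  have PJ: "P J" "J < M" using first_below_sat[OF assms(1)] assms(1) first_below_less[of M P] by (auto simp: J_def)
  have "(LEAST j. K j \<and> P j) = J"
    using PJ assms(2) by (intro Least_equality) (auto simp: J J_def[symmetric] intro: Least_le)
  moreover have "\<exists>j<M. K j \<and> P j" using PJ assms(2) J_def by blast
  ultimately show ?thesis by (simp add: first_below_def[of M "\<lambda>j. K j \<and> P j"] J_def)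
qed

lemma measurable_first_below:
  assumes M: "M > 0" and [measurable]: "\<And>j. j < M \<Longrightarrow> Measurable.pred N (\<lambda>x. P x j)"
  shows "(\<lambda>x. first_below M (P x)) \<in> measurable N (count_space {..<M})"
proof -
  \<comment> \<open>Measurability is known only for \<open>j < M\<close>, while \<open>LEAST\<close>
    ranges over all naturals; cutting the predicate off at \<open>M\<close> does not change the
    value.\<close>
  have eq: "first_below M (P x) = first_below M (\<lambda>j. j < M \<and> P x j)" for x
  proof (cases "\<exists>j<M. P x j")
    case True
    then show ?thesis using first_below_restrict[OF True, of "\<lambda>j. j < M"] first_below_less[OF M] by simp
  qed (auto simp: first_below_def)
  have [measurable]: "Measurable.pred N (\<lambda>x. j < M \<and> P x j)" for j
    by (cases "j < M") simp_all
  have "(\<lambda>x. first_below M (\<lambda>j. j < M \<and> P x j)) \<in> measurable N (count_space UNIV)"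
    unfolding first_below_def by measurable
  then have "(\<lambda>x. first_below M (P x)) \<in> measurable N (count_space UNIV)"
    by (simp add: eq[symmetric])
  then show ?thesis
    using first_below_less[OF M] by (auto simp: measurable_count_space_eq2_countable)
qed

section \<open>A one-shot random coding bound\<close>

abbreviation any_index :: "nat \<Rightarrow> bool" where
  "any_index \<equiv> \<lambda>_. True"

text \<open>One index type for all three families turns the whole codebook into a single product
  measure. \<open>IU\<close> carries a common message and a list position but no individual message,
  which the informed encoder does not know.\<close>

datatype codeword_index = IV nat | IX nat nat | IU nat nat

text \<open>Codewords, state and output are whole blocks, so nothing about letters or Gaussians
  enters. \<open>G\<close> is the encoder's test of a list entry against the state and
  \<open>D\<close> the decoder's test of a candidate triple. \<open>Y\<close> is only a measurable
  space: wrong candidates are bounded for every output, whatever its law.\<close>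

locale random_code =
  S: prob_space S + Z: prob_space Z + V: prob_space PV + X: prob_space PX + U: prob_space PU
  for S :: "'s measure" and Z :: "'z measure" and PV PX PU :: "'c measure" +
  fixes Y :: "'y measure"
    and chan :: "'c \<Rightarrow> 'c \<Rightarrow> 'c \<Rightarrow> 's \<Rightarrow> 'z \<Rightarrow> 'y"
    and D :: "'c \<Rightarrow> 'c \<Rightarrow> 'c \<Rightarrow> 'y \<Rightarrow> bool"
    and G :: "'s \<Rightarrow> 'c \<Rightarrow> bool"
    and Mc M1 MJ :: nat
  assumes MJ: "MJ > 0"
    and chan_measurable: "(\<lambda>(v, x, u, s, z). chan v x u s z) \<in> measurable (PV \<Otimes>\<^sub>M PX \<Otimes>\<^sub>M PU \<Otimes>\<^sub>M S \<Otimes>\<^sub>M Z) Y"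
    and D_measurable: "(\<lambda>(v, x, u, y). D v x u y) \<in> measurable (PV \<Otimes>\<^sub>M PX \<Otimes>\<^sub>M PU \<Otimes>\<^sub>M Y) (count_space UNIV)"
    and G_measurable: "(\<lambda>(s, u). G s u) \<in> measurable (S \<Otimes>\<^sub>M PU) (count_space UNIV)"
begin

lemma chan_measurable_raw [measurable (raw)]:
  assumes "v \<in> measurable N PV" "x \<in> measurable N PX" "u \<in> measurable N PU" "s \<in> measurable N S" "z \<in> measurable N Z"
  shows "(\<lambda>w. chan (v w) (x w) (u w) (s w) (z w)) \<in> measurable N Y"
proof -
  have "(\<lambda>w. (v w, x w, u w, s w, z w)) \<in> measurable N (PV \<Otimes>\<^sub>M PX \<Otimes>\<^sub>M PU \<Otimes>\<^sub>M S \<Otimes>\<^sub>M Z)"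
    using assms by measurable
  from measurable_compose[OF this chan_measurable] show ?thesis by simp
qed

lemma D_measurable_raw [measurable (raw)]:
  assumes "v \<in> measurable N PV" "x \<in> measurable N PX" "u \<in> measurable N PU" "y \<in> measurable N Y"
  shows "Measurable.pred N (\<lambda>w. D (v w) (x w) (u w) (y w))"
proof -
  have "(\<lambda>w. (v w, x w, u w, y w)) \<in> measurable N (PV \<Otimes>\<^sub>M PX \<Otimes>\<^sub>M PU \<Otimes>\<^sub>M Y)"
    using assms by measurable
  from measurable_compose[OF this D_measurable] show ?thesis by simp
qed

lemma G_measurable_raw [measurable (raw)]:
  assumes "s \<in> measurable N S" "u \<in> measurable N PU"
  shows "Measurable.pred N (\<lambda>w. G (s w) (u w))"
proof -
  have "(\<lambda>w. (s w, u w)) \<in> measurable N (S \<Otimes>\<^sub>M PU)"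
    using assms by measurable
  from measurable_compose[OF this G_measurable] show ?thesis by simp
qed

section \<open>The random codebook as a product measure\<close>

definition idx :: "codeword_index set" where
  "idx = IV ` {..<Mc} \<union> (\<lambda>(i, j). IX i j) ` ({..<Mc} \<times> {..<M1}) \<union> (\<lambda>(i, j). IU i j) ` ({..<Mc} \<times> {..<MJ})"

definition codeword_law :: "codeword_index \<Rightarrow> 'c measure" where
  "codeword_law i = (case i of IV _ \<Rightarrow> PV | IX _ _ \<Rightarrow> PX | IU _ _ \<Rightarrow> PU)"

definition CB :: "(codeword_index \<Rightarrow> 'c) measure" where
  "CB = PiM idx codeword_law"

lemma finite_idx: "finite idx"
  by (simp add: idx_def)

lemma codeword_law_simps [simp]:
  "codeword_law (IV a) = PV" "codeword_law (IX a b) = PX" "codeword_law (IU a b) = PU"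
  by (simp_all add: codeword_law_def)

lemma prob_space_codeword_law: "prob_space (codeword_law i)"
  by (cases i) (simp_all add: V.prob_space_axioms X.prob_space_axioms U.prob_space_axioms)

lemma mem_idx [simp]:
  "IV a \<in> idx \<longleftrightarrow> a < Mc" "IX a b \<in> idx \<longleftrightarrow> a < Mc \<and> b < M1" "IU a b \<in> idx \<longleftrightarrow> a < Mc \<and> b < MJ"
  by (auto simp: idx_def)

lemma IV_measurable [measurable]: "a < Mc \<Longrightarrow> (\<lambda>w. w (IV a)) \<in> measurable CB PV"
  using measurable_component_singleton[of "IV a" idx codeword_law] by (simp add: CB_def)

lemma IX_measurable [measurable]: "a < Mc \<Longrightarrow> b < M1 \<Longrightarrow> (\<lambda>w. w (IX a b)) \<in> measurable CB PX"
  using measurable_component_singleton[of "IX a b" idx codeword_law] by (simp add: CB_def)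

lemma IU_measurable [measurable]: "a < Mc \<Longrightarrow> b < MJ \<Longrightarrow> (\<lambda>w. w (IU a b)) \<in> measurable CB PU"
  using measurable_component_singleton[of "IU a b" idx codeword_law] by (simp add: CB_def)

sublocale CB: prob_space CB
  unfolding CB_def by (rule prob_space_PiM) (rule prob_space_codeword_law)

lemma resample:
  assumes "i \<in> idx" "f \<in> borel_measurable CB"
  shows "(\<integral>\<^sup>+w. f w \<partial>CB) = (\<integral>\<^sup>+w. (\<integral>\<^sup>+x. f (w(i := x)) \<partial>codeword_law i) \<partial>CB)"
  using nn_integral_PiM_resample[OF finite_idx assms(1) prob_space_codeword_law] assms(2) by (simp add: CB_def)

lemma resample2:
  assumes "i \<in> idx" "j \<in> idx" "f \<in> borel_measurable CB"
  shows "(\<integral>\<^sup>+w. f w \<partial>CB) = (\<integral>\<^sup>+w. \<integral>\<^sup>+x. \<integral>\<^sup>+y. f (w(i := x, j := y)) \<partial>codeword_law j \<partial>codeword_law i \<partial>CB)"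
  using nn_integral_PiM_resample2[OF finite_idx assms(1,2) prob_space_codeword_law] assms(3) by (simp add: CB_def)

lemma resample3:
  assumes "i \<in> idx" "j \<in> idx" "k \<in> idx" "f \<in> borel_measurable CB"
  shows "(\<integral>\<^sup>+w. f w \<partial>CB) = (\<integral>\<^sup>+w. \<integral>\<^sup>+x. \<integral>\<^sup>+y. \<integral>\<^sup>+z. f (w(i := x, j := y, k := z)) \<partial>codeword_law k \<partial>codeword_law j \<partial>codeword_law i \<partial>CB)"
  using nn_integral_PiM_resample3[OF finite_idx assms(1,2,3) prob_space_codeword_law] assms(4) by (simp add: CB_def)

text \<open>
  The encoder and the true channel use \<open>K = any_index\<close>; the choice \<open>K = (\<lambda>j. j \<noteq> j')\<close> occurs only in the error analysis.
  If no admissible index is good, \<open>sel\<close> is \<open>0\<close>.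
\<close>

definition sel :: "(nat \<Rightarrow> bool) \<Rightarrow> (codeword_index \<Rightarrow> 'c) \<Rightarrow> nat \<Rightarrow> 's \<Rightarrow> nat" where
  "sel K w a s = first_below MJ (\<lambda>j. K j \<and> G s (w (IU a j)))"

definition out :: "(nat \<Rightarrow> bool) \<Rightarrow> (codeword_index \<Rightarrow> 'c) \<Rightarrow> nat \<Rightarrow> nat \<Rightarrow> 's \<Rightarrow> 'z \<Rightarrow> 'y" where
  "out K w a b s z = chan (w (IV a)) (w (IX a b)) (w (IU a (sel K w a s))) s z"

definition pass :: "(codeword_index \<Rightarrow> 'c) \<Rightarrow> nat \<Rightarrow> nat \<Rightarrow> 'y \<Rightarrow> bool" where
  "pass w a b y \<longleftrightarrow> (\<exists>j<MJ. D (w (IV a)) (w (IX a b)) (w (IU a j)) y)"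

definition decoded :: "(codeword_index \<Rightarrow> 'c) \<Rightarrow> nat \<Rightarrow> nat \<Rightarrow> 'y \<Rightarrow> bool" where
  "decoded w a b y \<longleftrightarrow> pass w a b y \<and> (\<forall>a'<Mc. \<forall>b'<M1. (a', b') \<noteq> (a, b) \<longrightarrow> \<not> pass w a' b' y)"

section \<open>Measurability of selection, output and decoding\<close>

lemma selected_measurable [measurable]:
  assumes a: "a < Mc" and w [measurable]: "w \<in> measurable N CB" and s [measurable]: "s \<in> measurable N S"
  shows "(\<lambda>y. w y (IU a (sel K (w y) a (s y)))) \<in> measurable N PU"
proof (rule measurable_compose_countable'[where I = "{..<MJ}" and f = "\<lambda>j y. w y (IU a j)"])
  show "(\<lambda>y. w y (IU a j)) \<in> measurable N PU" if "j \<in> {..<MJ}" for j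
    using measurable_compose[OF w IU_measurable] a that by simp
  note [measurable] = this
  show "(\<lambda>y. sel K (w y) a (s y)) \<in> measurable N (count_space {..<MJ})"
    unfolding sel_def by (rule measurable_first_below[OF MJ]) measurable
qed simp

lemma out_measurable [measurable (raw)]:
  assumes a: "a < Mc" and b: "b < M1" and w [measurable]: "w \<in> measurable N CB"
    and s [measurable]: "s \<in> measurable N S" and z [measurable]: "z \<in> measurable N Z"
  shows "(\<lambda>y. out K (w y) a b (s y) (z y)) \<in> measurable N Y"
proof -
  note [measurable] = measurable_compose[OF w IV_measurable[OF a]] measurable_compose[OF w IX_measurable[OF a b]]
    selected_measurable[OF a w s]
  show ?thesis unfolding out_def by measurable
qed

lemma pass_measurable [measurable (raw)]:
  assumes a: "a < Mc" and b: "b < M1" and w [measurable]: "w \<in> measurable N CB"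
    and y [measurable]: "y \<in> measurable N Y"
  shows "Measurable.pred N (\<lambda>t. pass (w t) a b (y t))"
proof -
  note [measurable] = measurable_compose[OF w IV_measurable[OF a]] measurable_compose[OF w IX_measurable[OF a b]]
    measurable_compose[OF w IU_measurable[OF a]]
  show ?thesis unfolding pass_def by measurable
qed

lemma decoded_measurable [measurable (raw)]:
  assumes a: "a < Mc" and b: "b < M1" and w [measurable]: "w \<in> measurable N CB"
    and y [measurable]: "y \<in> measurable N Y"
  shows "Measurable.pred N (\<lambda>t. decoded (w t) a b (y t))"
proof -
  note [measurable] = pass_measurable[OF _ _ w y]
  show ?thesis unfolding decoded_def using a b by measurable
qed

lemma sel_less: "sel K w a s < MJ"
  unfolding sel_def by (rule first_below_less[OF MJ])

text \<open>The cases are: no good entry, the true triple rejected, a wrong individual message with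
  the chosen \<open>u\<close>, the same with another entry \<open>j'\<close>, and a wrong common
  message. In the fourth, the output is rewritten with \<open>j'\<close> barred from selection,
  which is the same output because \<open>j'\<close> was not chosen. The existence clause guarantees
  that the restricted selection is not the default 0, which might be \<open>j'\<close>.\<close>

lemma not_decoded_cases:
  assumes "\<not> decoded w a b (out any_index w a b s z)"
  obtains "\<forall>j<MJ. \<not> G s (w (IU a j))"
  | "G s (w (IU a (sel any_index w a s)))"
    "\<not> D (w (IV a)) (w (IX a b)) (w (IU a (sel any_index w a s))) (out any_index w a b s z)"
  | b' where "b' < M1" "b' \<noteq> b"
    "D (w (IV a)) (w (IX a b')) (w (IU a (sel any_index w a s))) (out any_index w a b s z)"
  | b' j' where "b' < M1" "b' \<noteq> b" "j' < MJ" "\<exists>j<MJ. j \<noteq> j' \<and> G s (w (IU a j))"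
    "D (w (IV a)) (w (IX a b')) (w (IU a j')) (out (\<lambda>j. j \<noteq> j') w a b s z)"
  | a' b' j' where "a' < Mc" "a' \<noteq> a" "b' < M1" "j' < MJ"
    "D (w (IV a')) (w (IX a' b')) (w (IU a' j')) (out any_index w a b s z)"
proof -
  define J where "J = sel any_index w a s"
  define y where "y = out any_index w a b s z"
  have JM: "J < MJ" by (simp add: J_def sel_less)
  consider "\<forall>j<MJ. \<not> G s (w (IU a j))" | "\<exists>j<MJ. G s (w (IU a j))" by blast
  then show thesis
  proof cases
    case 2
    have GJ: "G s (w (IU a J))"
      using first_below_sat[of MJ "\<lambda>j. True \<and> G s (w (IU a j))"] 2 by (simp add: J_def sel_def)
    show thesis
    proof (cases "pass w a b y")
      case False
      then show thesis using that(2) GJ JM by (auto simp: pass_def J_def y_def)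
    next
      case True
      then obtain a' b' where ab: "a' < Mc" "b' < M1" "(a', b') \<noteq> (a, b)" and p: "pass w a' b' y"
        using assms by (auto simp: decoded_def y_def)
      from p obtain j' where j': "j' < MJ" "D (w (IV a')) (w (IX a' b')) (w (IU a' j')) y"
        by (auto simp: pass_def)
      consider "a' \<noteq> a" | "a' = a" "b' \<noteq> b" "j' = J" | "a' = a" "b' \<noteq> b" "j' \<noteq> J" using ab(3) by auto
      then show thesis
      proof cases
        case 1
        then show thesis using that(5) ab j' by (auto simp: y_def)
      next
        case 2
        then show thesis using that(3) ab j' by (auto simp: y_def J_def)
      next
        case 3
        have "sel (\<lambda>j. j \<noteq> j') w a s = J"
          using first_below_restrict[of MJ "\<lambda>j. G s (w (IU a j))" "\<lambda>j. j \<noteq> j'"] 3(3) \<open>\<exists>j<MJ. G s (w (IU a j))\<close>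
          by (simp add: J_def sel_def)
        then have "out (\<lambda>j. j \<noteq> j') w a b s z = y" by (simp add: out_def y_def J_def)
        moreover have "\<exists>j<MJ. j \<noteq> j' \<and> G s (w (IU a j))" using JM GJ 3(3) by auto
        ultimately show thesis using that(4) ab j' 3 by auto
      qed
    qed
  qed (use that(1) in blast)
qed

section \<open>Averages of the error events over the codebook\<close>

lemma nn_integral_le_const_CB:
  assumes "\<And>w. w \<in> space CB \<Longrightarrow> f w \<le> c"
  shows "(\<integral>\<^sup>+w. f w \<partial>CB) \<le> c"
proof -
  have "(\<integral>\<^sup>+w. f w \<partial>CB) \<le> (\<integral>\<^sup>+w. c \<partial>CB)" by (intro nn_integral_mono assms)
  then show ?thesis by (simp add: CB.emeasure_space_1)
qed

lemma CB_space_component: "w \<in> space CB \<Longrightarrow> i \<in> idx \<Longrightarrow> w i \<in> space (codeword_law i)"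
  by (auto simp: CB_def space_PiM)

lemma no_good_index_bound:
  assumes a: "a < Mc" and s: "s \<in> space S"
  shows "(\<integral>\<^sup>+w. of_bool (\<forall>j<MJ. \<not> G s (w (IU a j))) \<partial>CB) = (\<integral>\<^sup>+u. of_bool (\<not> G s u) \<partial>PU) ^ MJ"
proof -
  interpret product_prob_space codeword_law by (rule product_prob_spaceI) (rule prob_space_codeword_law)
  \<comment> \<open>The factor 1 off the list extends the product to all of \<open>idx\<close>,
    which is the form that the product rule for \<open>PiM\<close> takes.\<close>
  define f where "f = (\<lambda>i u. if i \<in> IU a ` {..<MJ} then of_bool (\<not> G s u) else 1 :: ennreal)"
  have sub: "IU a ` {..<MJ} \<subseteq> idx" using a by auto
  have "(\<integral>\<^sup>+w. of_bool (\<forall>j<MJ. \<not> G s (w (IU a j))) \<partial>CB) = (\<integral>\<^sup>+w. (\<Prod>i\<in>idx. f i (w i)) \<partial>CB)"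
  proof (rule nn_integral_cong)
    fix w
    have "(\<Prod>i\<in>idx. f i (w i)) = (\<Prod>i\<in>IU a ` {..<MJ}. f i (w i))"
      by (rule prod.mono_neutral_right[OF finite_idx sub]) (auto simp: f_def)
    also have "\<dots> = (\<Prod>j<MJ. of_bool (\<not> G s (w (IU a j))))"
      by (subst prod.reindex) (auto simp: f_def inj_on_def)
    also have "\<dots> = of_bool (\<forall>j<MJ. \<not> G s (w (IU a j)))"
      by (auto simp: of_bool_def)
    finally show "of_bool (\<forall>j<MJ. \<not> G s (w (IU a j))) = (\<Prod>i\<in>idx. f i (w i))" by simp
  qed
  also have "\<dots> = (\<Prod>i\<in>idx. integral\<^sup>N (codeword_law i) (f i))"
    unfolding CB_def
  proof (rule product_nn_integral_prod[OF finite_idx])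
    show "f i \<in> borel_measurable (codeword_law i)" if "i \<in> idx" for i
    proof (cases "i \<in> IU a ` {..<MJ}")
      case True
      then have [simp]: "codeword_law i = PU" by auto
      have "f i = (\<lambda>u. of_bool (\<not> G s u))" by (simp add: f_def True fun_eq_iff)
      then show ?thesis using s by simp
    qed (simp add: f_def)
  qed
  also have "\<dots> = (\<Prod>i\<in>IU a ` {..<MJ}. integral\<^sup>N (codeword_law i) (f i))"
    by (rule prod.mono_neutral_right[OF finite_idx sub])
      (auto simp: f_def prob_space.emeasure_space_1[OF prob_space_codeword_law])
  also have "\<dots> = (\<Prod>j<MJ. (\<integral>\<^sup>+u. of_bool (\<not> G s u) \<partial>PU))"
    by (subst prod.reindex) (auto simp: f_def inj_on_def)
  finally show ?thesis by simp
qed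

text \<open>The selected entry depends only on \<open>s\<close> and the list, so \<open>v\<close>
  and \<open>x\<close> can be redrawn while \<open>u\<close> stays fixed. What remains is the
  conditional failure probability of a good pair \<open>(s, u)\<close>.\<close>

lemma bad_channel_bound:
  assumes a: "a < Mc" and b: "b < M1" and s [measurable]: "s \<in> space S"
    and bad: "\<And>u. u \<in> space PU \<Longrightarrow> G s u \<Longrightarrow> (\<integral>\<^sup>+v. \<integral>\<^sup>+x. \<integral>\<^sup>+z. of_bool (\<not> D v x u (chan v x u s z)) \<partial>Z \<partial>PX \<partial>PV) \<le> eta"
  shows "(\<integral>\<^sup>+z. \<integral>\<^sup>+w. of_bool (G s (w (IU a (sel any_index w a s))) \<and>
    \<not> D (w (IV a)) (w (IX a b)) (w (IU a (sel any_index w a s))) (out any_index w a b s z)) \<partial>CB \<partial>Z) \<le> eta"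
    (is "(\<integral>\<^sup>+z. \<integral>\<^sup>+w. ?f w z \<partial>CB \<partial>Z) \<le> _")
proof -
  interpret pair_sigma_finite CB Z by standard
  have [measurable]: "(\<lambda>(w, z). ?f w z) \<in> borel_measurable (CB \<Otimes>\<^sub>M Z)"
    using a b s by measurable
  have "(\<integral>\<^sup>+z. \<integral>\<^sup>+w. ?f w z \<partial>CB \<partial>Z) = (\<integral>\<^sup>+w. \<integral>\<^sup>+z. ?f w z \<partial>Z \<partial>CB)"
    by (rule Fubini') measurable
  also have "\<dots> = (\<integral>\<^sup>+w. \<integral>\<^sup>+v. \<integral>\<^sup>+x. \<integral>\<^sup>+z. ?f (w(IV a := v, IX a b := x)) z \<partial>Z \<partial>PX \<partial>PV \<partial>CB)"
    using a b by (subst resample2[of "IV a" "IX a b"]) auto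
  also have "\<dots> \<le> eta"
  proof (rule nn_integral_le_const_CB)
    fix w assume w: "w \<in> space CB"
    define u where "u = w (IU a (sel any_index w a s))"
    have u: "u \<in> space PU"
      using CB_space_component[OF w, of "IU a (sel any_index w a s)"] a by (simp add: u_def sel_less)
    have eq: "?f (w(IV a := v, IX a b := x)) z = of_bool (G s u \<and> \<not> D v x u (chan v x u s z))" for v x z
      by (simp add: out_def sel_def u_def)
    show "(\<integral>\<^sup>+v. \<integral>\<^sup>+x. \<integral>\<^sup>+z. ?f (w(IV a := v, IX a b := x)) z \<partial>Z \<partial>PX \<partial>PV) \<le> eta"
      unfolding eq using bad[OF u] by (cases "G s u") simp_all
  qed
  finally show ?thesis .
qed

text \<open>The output does not involve the codeword \<open>IX a b'\<close>, so redrawing it leaves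
  the output fixed and \<open>D1\<close> applies.\<close>

lemma wrong_individual_bound:
  assumes a: "a < Mc" and b: "b < M1" "b' < M1" "b' \<noteq> b" and s: "s \<in> space S" and z: "z \<in> space Z"
    and D1: "\<And>v u y. v \<in> space PV \<Longrightarrow> u \<in> space PU \<Longrightarrow> y \<in> space Y \<Longrightarrow> (\<integral>\<^sup>+x. of_bool (D v x u y) \<partial>PX) \<le> d"
  shows "(\<integral>\<^sup>+w. of_bool (D (w (IV a)) (w (IX a b')) (w (IU a (sel any_index w a s))) (out any_index w a b s z)) \<partial>CB) \<le> d"
    (is "(\<integral>\<^sup>+w. ?f w \<partial>CB) \<le> _")
proof -
  have f [measurable]: "?f \<in> borel_measurable CB"
    using a b s z by measurable
  have "(\<integral>\<^sup>+w. ?f w \<partial>CB) = (\<integral>\<^sup>+w. \<integral>\<^sup>+x. ?f (w(IX a b' := x)) \<partial>PX \<partial>CB)"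
    using a b by (subst resample[of "IX a b'"]) auto
  also have "\<dots> \<le> d"
  proof (rule nn_integral_le_const_CB)
    fix w assume w: "w \<in> space CB"
    have eq: "?f (w(IX a b' := x)) = of_bool (D (w (IV a)) x (w (IU a (sel any_index w a s))) (out any_index w a b s z))" for x
      using b by (simp add: out_def sel_def)
    have out: "out any_index w a b s z \<in> space Y"
      using measurable_space[OF out_measurable[OF a b(1) measurable_ident measurable_const[OF s] measurable_const[OF z]] w] by simp
    show "(\<integral>\<^sup>+x. ?f (w(IX a b' := x)) \<partial>PX) \<le> d"
      unfolding eq using CB_space_component[OF w, of "IV a"] CB_space_component[OF w, of "IU a (sel any_index w a s)"] a
      by (intro D1 out) (simp_all add: sel_less)
  qed
  finally show ?thesis .
qed

text \<open>Selection with \<open>j'\<close> barred does not see \<open>IU a j'\<close>, so both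
  codewords can be redrawn against a fixed output. Under the true selection the output could change
  along with the redrawn entry.\<close>

lemma wrong_individual_and_index_bound:
  assumes a: "a < Mc" and b: "b < M1" "b' < M1" "b' \<noteq> b" and j': "j' < MJ" and s: "s \<in> space S" and z: "z \<in> space Z"
    and D2: "\<And>v y. v \<in> space PV \<Longrightarrow> y \<in> space Y \<Longrightarrow> (\<integral>\<^sup>+x. \<integral>\<^sup>+u. of_bool (D v x u y) \<partial>PU \<partial>PX) \<le> d"
  shows "(\<integral>\<^sup>+w. of_bool ((\<exists>j<MJ. j \<noteq> j' \<and> G s (w (IU a j))) \<and>
      D (w (IV a)) (w (IX a b')) (w (IU a j')) (out (\<lambda>j. j \<noteq> j') w a b s z)) \<partial>CB) \<le> d"
    (is "(\<integral>\<^sup>+w. ?f w \<partial>CB) \<le> _")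
proof -
  have f [measurable]: "?f \<in> borel_measurable CB"
    using a b s z j' by measurable
  have "(\<integral>\<^sup>+w. ?f w \<partial>CB) = (\<integral>\<^sup>+w. \<integral>\<^sup>+x. \<integral>\<^sup>+u. ?f (w(IX a b' := x, IU a j' := u)) \<partial>PU \<partial>PX \<partial>CB)"
    by (subst resample2[OF _ _ f, of "IX a b'" "IU a j'"]) (simp_all only: codeword_law_simps mem_idx a b j' simp_thms)
  also have "\<dots> \<le> d"
  proof (rule nn_integral_le_const_CB)
    fix w assume w: "w \<in> space CB"
    define y where "y = out (\<lambda>j. j \<noteq> j') w a b s z"
    have y: "y \<in> space Y"
      using measurable_space[OF out_measurable[OF a b(1) measurable_ident measurable_const[OF s] measurable_const[OF z]] w]
      by (simp add: y_def)
    have le: "?f (w(IX a b' := x, IU a j' := u)) \<le> of_bool (D (w (IV a)) x u y)" for x u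
    proof (cases "\<exists>j<MJ. j \<noteq> j' \<and> G s (w (IU a j))")
      case True
      let ?w = "w(IX a b' := x, IU a j' := u)"
      have s_eq: "sel (\<lambda>j. j \<noteq> j') ?w a s = sel (\<lambda>j. j \<noteq> j') w a s"
        unfolding sel_def by (rule first_below_cong) auto
      \<comment> \<open>Here the existence clause matters: without it the default 0 could coincide
        with \<open>j'\<close>.\<close>
      have "sel (\<lambda>j. j \<noteq> j') w a s \<noteq> j'"
        using first_below_sat[OF True] by (simp add: sel_def)
      then have "out (\<lambda>j. j \<noteq> j') ?w a b s z = y"
        using b by (simp add: out_def y_def s_eq)
      then show ?thesis by simp
    qed auto
    have "(\<integral>\<^sup>+x. \<integral>\<^sup>+u. ?f (w(IX a b' := x, IU a j' := u)) \<partial>PU \<partial>PX) \<le> (\<integral>\<^sup>+x. \<integral>\<^sup>+u. of_bool (D (w (IV a)) x u y) \<partial>PU \<partial>PX)"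
      by (intro nn_integral_mono le)
    also have "\<dots> \<le> d"
      using D2 y CB_space_component[OF w, of "IV a"] a by simp
    finally show "(\<integral>\<^sup>+x. \<integral>\<^sup>+u. ?f (w(IX a b' := x, IU a j' := u)) \<partial>PU \<partial>PX) \<le> d" .
  qed
  finally show ?thesis .
qed

lemma wrong_common_bound:
  assumes a: "a < Mc" "a' < Mc" "a' \<noteq> a" and b: "b < M1" "b' < M1" and j': "j' < MJ" and s: "s \<in> space S" and z: "z \<in> space Z"
    and D3: "\<And>y. y \<in> space Y \<Longrightarrow> (\<integral>\<^sup>+v. \<integral>\<^sup>+x. \<integral>\<^sup>+u. of_bool (D v x u y) \<partial>PU \<partial>PX \<partial>PV) \<le> d"
  shows "(\<integral>\<^sup>+w. of_bool (D (w (IV a')) (w (IX a' b')) (w (IU a' j')) (out any_index w a b s z)) \<partial>CB) \<le> d"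
    (is "(\<integral>\<^sup>+w. ?f w \<partial>CB) \<le> _")
proof -
  have f [measurable]: "?f \<in> borel_measurable CB"
    using a b s z j' by measurable
  have "(\<integral>\<^sup>+w. ?f w \<partial>CB) = (\<integral>\<^sup>+w. \<integral>\<^sup>+v. \<integral>\<^sup>+x. \<integral>\<^sup>+u. ?f (w(IV a' := v, IX a' b' := x, IU a' j' := u)) \<partial>PU \<partial>PX \<partial>PV \<partial>CB)"
    by (subst resample3[OF _ _ _ f, of "IV a'" "IX a' b'" "IU a' j'"]) (simp_all only: codeword_law_simps mem_idx a b j' simp_thms)
  also have "\<dots> \<le> d"
  proof (rule nn_integral_le_const_CB)
    fix w assume w: "w \<in> space CB"
    have eq: "?f (w(IV a' := v, IX a' b' := x, IU a' j' := u)) = of_bool (D v x u (out any_index w a b s z))" for v x u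
      using a by (simp add: out_def sel_def)
    have out: "out any_index w a b s z \<in> space Y"
      using measurable_space[OF out_measurable[OF a(1) b(1) measurable_ident measurable_const[OF s] measurable_const[OF z]] w] by simp
    show "(\<integral>\<^sup>+v. \<integral>\<^sup>+x. \<integral>\<^sup>+u. ?f (w(IV a' := v, IX a' b' := x, IU a' j' := u)) \<partial>PU \<partial>PX \<partial>PV) \<le> d"
      unfolding eq by (rule D3[OF out])
  qed
  finally show ?thesis .
qed

lemma not_decoded_le:
  assumes "a < Mc" "b < M1"
  shows "(of_bool (\<not> decoded w a b (out any_index w a b s z)) :: ennreal) \<le>
    of_bool (\<forall>j<MJ. \<not> G s (w (IU a j))) +
    of_bool (G s (w (IU a (sel any_index w a s))) \<and>
      \<not> D (w (IV a)) (w (IX a b)) (w (IU a (sel any_index w a s))) (out any_index w a b s z)) +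
    (\<Sum>b'\<in>{..<M1}-{b}. of_bool (D (w (IV a)) (w (IX a b')) (w (IU a (sel any_index w a s))) (out any_index w a b s z))) +
    (\<Sum>(b', j')\<in>({..<M1}-{b}) \<times> {..<MJ}. of_bool ((\<exists>j<MJ. j \<noteq> j' \<and> G s (w (IU a j))) \<and>
      D (w (IV a)) (w (IX a b')) (w (IU a j')) (out (\<lambda>j. j \<noteq> j') w a b s z))) +
    (\<Sum>(a', b', j')\<in>({..<Mc}-{a}) \<times> {..<M1} \<times> {..<MJ}.
      of_bool (D (w (IV a')) (w (IX a' b')) (w (IU a' j')) (out any_index w a b s z)))"
    (is "_ \<le> ?n + ?c + sum ?p ?P + sum ?q ?Q + sum ?r ?R")
proof (cases "decoded w a b (out any_index w a b s z)")
  case False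
  have mem: "1 \<le> sum f A" if "finite A" "x \<in> A" "f x = (1::ennreal)" for f :: "'i \<Rightarrow> ennreal" and A x
    using sum_nonneg_leq_bound[of A f] member_le_sum[of x A f] that by auto
  from False have "1 \<le> ?n \<or> 1 \<le> ?c \<or> 1 \<le> sum ?p ?P \<or> 1 \<le> sum ?q ?Q \<or> 1 \<le> sum ?r ?R"
  proof (cases rule: not_decoded_cases)
    case 1
    then have "?n = 1" by simp
    then show ?thesis by simp
  next
    case 2
    then have "?c = 1" by simp
    then show ?thesis by simp
  next
    case (3 b')
    then have "1 \<le> sum ?p ?P" by (intro mem[of _ b']) auto
    then show ?thesis by blast
  next
    case (4 b' j')
    then have "1 \<le> sum ?q ?Q" by (intro mem[of _ "(b', j')"]) auto
    then show ?thesis by blast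
  next
    case (5 a' b' j')
    then have "1 \<le> sum ?r ?R" by (intro mem[of _ "(a', b', j')"]) auto
    then show ?thesis by blast
  qed
  moreover have "1 \<le> n + c + p + q + r" if "1 \<le> n \<or> 1 \<le> c \<or> 1 \<le> p \<or> 1 \<le> q \<or> 1 \<le> r" for n c p q r :: ennreal
  proof -
    have "n \<le> n + c + p + q + r" "c \<le> c + (n + p + q + r)" "p \<le> p + (n + c + q + r)" "q \<le> q + (n + c + p + r)" "r \<le> r + (n + c + p + q)"
      by (simp_all add: add_increasing2)
    with that show ?thesis by (auto simp: ac_simps intro: order_trans)
  qed
  ultimately show ?thesis using False by simp
qed simp

lemma message_error_bound:
  assumes a: "a < Mc" and b: "b < M1" and s: "s \<in> space S"
    and bad: "\<And>u. u \<in> space PU \<Longrightarrow> G s u \<Longrightarrow> (\<integral>\<^sup>+v. \<integral>\<^sup>+x. \<integral>\<^sup>+z. of_bool (\<not> D v x u (chan v x u s z)) \<partial>Z \<partial>PX \<partial>PV) \<le> eta"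
    and D1: "\<And>v u y. v \<in> space PV \<Longrightarrow> u \<in> space PU \<Longrightarrow> y \<in> space Y \<Longrightarrow> (\<integral>\<^sup>+x. of_bool (D v x u y) \<partial>PX) \<le> d1"
    and D2: "\<And>v y. v \<in> space PV \<Longrightarrow> y \<in> space Y \<Longrightarrow> (\<integral>\<^sup>+x. \<integral>\<^sup>+u. of_bool (D v x u y) \<partial>PU \<partial>PX) \<le> d2"
    and D3: "\<And>y. y \<in> space Y \<Longrightarrow> (\<integral>\<^sup>+v. \<integral>\<^sup>+x. \<integral>\<^sup>+u. of_bool (D v x u y) \<partial>PU \<partial>PX \<partial>PV) \<le> d3"
  shows "(\<integral>\<^sup>+z. \<integral>\<^sup>+w. of_bool (\<not> decoded w a b (out any_index w a b s z)) \<partial>CB \<partial>Z) \<le>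
    (\<integral>\<^sup>+u. of_bool (\<not> G s u) \<partial>PU) ^ MJ + eta + (of_nat M1 * d1 + of_nat (M1 * MJ) * d2 + of_nat (Mc * M1 * MJ) * d3)"
proof -
  define n where "n = (\<lambda>w (z::'z). of_bool (\<forall>j<MJ. \<not> G s (w (IU a j))) :: ennreal)"
  define c where "c = (\<lambda>w z. of_bool (G s (w (IU a (sel any_index w a s))) \<and>
      \<not> D (w (IV a)) (w (IX a b)) (w (IU a (sel any_index w a s))) (out any_index w a b s z)) :: ennreal)"
  define p where "p = (\<lambda>b' w z. of_bool (D (w (IV a)) (w (IX a b')) (w (IU a (sel any_index w a s))) (out any_index w a b s z)) :: ennreal)"
  define q where "q = (\<lambda>(b', j') w z. of_bool ((\<exists>j<MJ. j \<noteq> j' \<and> G s (w (IU a j))) \<and>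
      D (w (IV a)) (w (IX a b')) (w (IU a j')) (out (\<lambda>j. j \<noteq> j') w a b s z)) :: ennreal)"
  define r where "r = (\<lambda>(a', b', j') w z. of_bool (D (w (IV a')) (w (IX a' b')) (w (IU a' j')) (out any_index w a b s z)) :: ennreal)"
  define P where "P = {..<M1} - {b}"
  define Q where "Q = ({..<M1} - {b}) \<times> {..<MJ}"
  define R where "R = ({..<Mc} - {a}) \<times> {..<M1} \<times> {..<MJ}"
  note sets = P_def Q_def R_def
  have mn [measurable]: "(\<lambda>(w, z). n w z) \<in> borel_measurable (CB \<Otimes>\<^sub>M Z)"
    unfolding n_def using a s by measurable
  have mc [measurable]: "(\<lambda>(w, z). c w z) \<in> borel_measurable (CB \<Otimes>\<^sub>M Z)"
    unfolding c_def using a b s by measurable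
  have mp [measurable]: "(\<lambda>(w, z). p b' w z) \<in> borel_measurable (CB \<Otimes>\<^sub>M Z)" if "b' \<in> P" for b'
    unfolding p_def using a b s that by (simp add: sets)
  have mq [measurable]: "(\<lambda>(w, z). q t w z) \<in> borel_measurable (CB \<Otimes>\<^sub>M Z)" if "t \<in> Q" for t
    unfolding q_def using a b s that by (cases t) (simp add: sets)
  have mr [measurable]: "(\<lambda>(w, z). r t w z) \<in> borel_measurable (CB \<Otimes>\<^sub>M Z)" if "t \<in> R" for t
    unfolding r_def using a b s that by (cases t) (simp add: sets)
  have fixz: "(\<lambda>w. f w z) \<in> borel_measurable CB"
    if "z \<in> space Z" "(\<lambda>(w, z). f w z) \<in> borel_measurable (CB \<Otimes>\<^sub>M Z)" for f :: "_ \<Rightarrow> _ \<Rightarrow> ennreal" and z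
    using measurable_compose[OF measurable_Pair[OF measurable_ident measurable_const[OF that(1)]] that(2)] by simp
  define B where "B = of_nat M1 * d1 + of_nat (M1 * MJ) * d2 + of_nat (Mc * M1 * MJ) * d3"
  have card: "card P \<le> M1" "card Q \<le> M1 * MJ" "card R \<le> Mc * M1 * MJ"
    unfolding sets by (auto simp: card_cartesian_product card_Diff_singleton_if mult.assoc intro!: mult_right_mono)
  have fin: "finite P" "finite Q" "finite R" by (auto simp: sets)
  \<comment> \<open>At fixed \<open>z\<close> the term \<open>c\<close> stays an integral: its bound
    holds only after averaging over \<open>z\<close>, while the other four hold for each
    \<open>z\<close>.\<close>
  have one: "(\<integral>\<^sup>+w. of_bool (\<not> decoded w a b (out any_index w a b s z)) \<partial>CB) \<le>
      (\<integral>\<^sup>+u. of_bool (\<not> G s u) \<partial>PU) ^ MJ + B + (\<integral>\<^sup>+w. c w z \<partial>CB)" if z: "z \<in> space Z" for z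
  proof -
    note [measurable] = fixz[OF z mn] fixz[OF z mc] fixz[OF z mp] fixz[OF z mq] fixz[OF z mr]
    have "(\<integral>\<^sup>+w. of_bool (\<not> decoded w a b (out any_index w a b s z)) \<partial>CB) \<le>
        (\<integral>\<^sup>+w. n w z + c w z + (\<Sum>t\<in>P. p t w z) + (\<Sum>t\<in>Q. q t w z) + (\<Sum>t\<in>R. r t w z) \<partial>CB)"
      using not_decoded_le[OF a b, of _ s z] unfolding n_def c_def p_def q_def r_def sets
      by (intro nn_integral_mono) (simp add: case_prod_unfold)
    also have "\<dots> = (\<integral>\<^sup>+w. n w z \<partial>CB) + (\<integral>\<^sup>+w. c w z \<partial>CB) + (\<Sum>t\<in>P. \<integral>\<^sup>+w. p t w z \<partial>CB)
        + (\<Sum>t\<in>Q. \<integral>\<^sup>+w. q t w z \<partial>CB) + (\<Sum>t\<in>R. \<integral>\<^sup>+w. r t w z \<partial>CB)"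
      by (simp add: nn_integral_add nn_integral_sum)
    also have "(\<integral>\<^sup>+w. n w z \<partial>CB) = (\<integral>\<^sup>+u. of_bool (\<not> G s u) \<partial>PU) ^ MJ"
      unfolding n_def by (rule no_good_index_bound[OF a s])
    also have "(\<Sum>t\<in>P. \<integral>\<^sup>+w. p t w z \<partial>CB) \<le> (\<Sum>t\<in>P. d1)"
      unfolding p_def by (intro sum_mono wrong_individual_bound a b s z D1) (auto simp: sets)
    also have "(\<Sum>t\<in>Q. \<integral>\<^sup>+w. q t w z \<partial>CB) \<le> (\<Sum>t\<in>Q. d2)"
    proof (intro sum_mono)
      fix t assume "t \<in> Q"
      then obtain b' j' where "t = (b', j')" "b' < M1" "b' \<noteq> b" "j' < MJ" by (auto simp: sets)
      then show "(\<integral>\<^sup>+w. q t w z \<partial>CB) \<le> d2"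
        unfolding q_def using wrong_individual_and_index_bound[OF a b _ _ _ s z D2] by simp
    qed
    also have "(\<Sum>t\<in>R. \<integral>\<^sup>+w. r t w z \<partial>CB) \<le> (\<Sum>t\<in>R. d3)"
    proof (intro sum_mono)
      fix t assume "t \<in> R"
      then obtain a' b' j' where "t = (a', b', j')" "a' < Mc" "a' \<noteq> a" "b' < M1" "j' < MJ" by (auto simp: sets)
      then show "(\<integral>\<^sup>+w. r t w z \<partial>CB) \<le> d3"
        unfolding r_def using wrong_common_bound[OF a _ _ b _ _ s z D3] by simp
    qed
    also have "(\<integral>\<^sup>+u. of_bool (\<not> G s u) \<partial>PU) ^ MJ + (\<integral>\<^sup>+w. c w z \<partial>CB) + (\<Sum>t\<in>P. d1) + (\<Sum>t\<in>Q. d2) + (\<Sum>t\<in>R. d3)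
        \<le> (\<integral>\<^sup>+u. of_bool (\<not> G s u) \<partial>PU) ^ MJ + (\<integral>\<^sup>+w. c w z \<partial>CB) + of_nat M1 * d1 + of_nat (M1 * MJ) * d2 + of_nat (Mc * M1 * MJ) * d3"
      unfolding sum_constant by (intro add_mono mult_right_mono of_nat_mono card order_refl) auto
    finally show ?thesis unfolding B_def by (simp add: ac_simps)
  qed
  have "(\<integral>\<^sup>+z. \<integral>\<^sup>+w. of_bool (\<not> decoded w a b (out any_index w a b s z)) \<partial>CB \<partial>Z) \<le>
     (\<integral>\<^sup>+z. (\<integral>\<^sup>+u. of_bool (\<not> G s u) \<partial>PU) ^ MJ + B + (\<integral>\<^sup>+w. c w z \<partial>CB) \<partial>Z)"
    by (intro nn_integral_mono one)
  also have "\<dots> = (\<integral>\<^sup>+u. of_bool (\<not> G s u) \<partial>PU) ^ MJ + B + (\<integral>\<^sup>+z. \<integral>\<^sup>+w. c w z \<partial>CB \<partial>Z)"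
  proof -
    have "(\<lambda>z. \<integral>\<^sup>+w. c w z \<partial>CB) \<in> borel_measurable Z"
      using measurable_pair_swap[OF mc] by (intro CB.borel_measurable_nn_integral) (simp add: case_prod_unfold)
    then show ?thesis by (simp add: nn_integral_add Z.emeasure_space_1)
  qed
  also have "(\<integral>\<^sup>+z. \<integral>\<^sup>+w. c w z \<partial>CB \<partial>Z) \<le> eta"
    unfolding c_def by (rule bad_channel_bound[OF a b s bad])
  finally show ?thesis
    by (simp add: B_def ac_simps)
qed

text \<open>Some codebook does at most as badly as the average. The errors of all message pairs are
  summed before it is chosen, so one codebook serves them together; of the terms in the bound only
  covering depends on the state.\<close>

theorem exists_codebook:
  assumes bad: "\<And>s u. s \<in> space S \<Longrightarrow> u \<in> space PU \<Longrightarrow> G s u \<Longrightarrow>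
      (\<integral>\<^sup>+v. \<integral>\<^sup>+x. \<integral>\<^sup>+z. of_bool (\<not> D v x u (chan v x u s z)) \<partial>Z \<partial>PX \<partial>PV) \<le> eta"
    and cover: "(\<integral>\<^sup>+s. (\<integral>\<^sup>+u. of_bool (\<not> G s u) \<partial>PU) ^ MJ \<partial>S) \<le> zeta"
    and D1: "\<And>v u y. v \<in> space PV \<Longrightarrow> u \<in> space PU \<Longrightarrow> y \<in> space Y \<Longrightarrow> (\<integral>\<^sup>+x. of_bool (D v x u y) \<partial>PX) \<le> d1"
    and D2: "\<And>v y. v \<in> space PV \<Longrightarrow> y \<in> space Y \<Longrightarrow> (\<integral>\<^sup>+x. \<integral>\<^sup>+u. of_bool (D v x u y) \<partial>PU \<partial>PX) \<le> d2"
    and D3: "\<And>y. y \<in> space Y \<Longrightarrow> (\<integral>\<^sup>+v. \<integral>\<^sup>+x. \<integral>\<^sup>+u. of_bool (D v x u y) \<partial>PU \<partial>PX \<partial>PV) \<le> d3"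
  obtains w where "w \<in> space CB"
    "(\<Sum>a<Mc. \<Sum>b<M1. emeasure (S \<Otimes>\<^sub>M Z) {t \<in> space (S \<Otimes>\<^sub>M Z). \<not> decoded w a b (out any_index w a b (fst t) (snd t))})
     \<le> of_nat (Mc * M1) * (zeta + eta + (of_nat M1 * d1 + of_nat (M1 * MJ) * d2 + of_nat (Mc * M1 * MJ) * d3))"
proof -
  interpret SZ: pair_sigma_finite S Z by standard
  interpret SZ: pair_prob_space S Z by standard
  interpret CSZ: pair_sigma_finite CB "S \<Otimes>\<^sub>M Z" by standard
  interpret CSZ2: pair_sigma_finite CB Z by standard
  interpret CSZ3: pair_sigma_finite CB S by standard
  define e where "e = (\<lambda>a b w t. of_bool (\<not> decoded w a b (out any_index w a b (fst t) (snd t))) :: ennreal)"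
  define B where "B = zeta + eta + (of_nat M1 * d1 + of_nat (M1 * MJ) * d2 + of_nat (Mc * M1 * MJ) * d3)"
  define f where "f = (\<lambda>w. \<Sum>a<Mc. \<Sum>b<M1. (\<integral>\<^sup>+t. e a b w t \<partial>(S \<Otimes>\<^sub>M Z)))"
  have me [measurable]: "(\<lambda>(w, t). e a b w t) \<in> borel_measurable (CB \<Otimes>\<^sub>M (S \<Otimes>\<^sub>M Z))" if "a < Mc" "b < M1" for a b
    unfolding e_def using that by measurable
  have me2 [measurable]: "(\<lambda>w. \<integral>\<^sup>+t. e a b w t \<partial>(S \<Otimes>\<^sub>M Z)) \<in> borel_measurable CB" if "a < Mc" "b < M1" for a b
    using me[OF that] by measurable
  have single: "(\<integral>\<^sup>+w. \<integral>\<^sup>+t. e a b w t \<partial>(S \<Otimes>\<^sub>M Z) \<partial>CB) \<le> B" if ab: "a < Mc" "b < M1" for a b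
  proof -
    have sw: "(\<lambda>(t, w). e a b w t) \<in> borel_measurable ((S \<Otimes>\<^sub>M Z) \<Otimes>\<^sub>M CB)"
      using measurable_pair_swap[OF me[OF ab]] by (simp add: case_prod_unfold)
    have mt: "(\<lambda>t. \<integral>\<^sup>+w. e a b w t \<partial>CB) \<in> borel_measurable (S \<Otimes>\<^sub>M Z)"
      using sw by measurable
    have "(\<integral>\<^sup>+w. \<integral>\<^sup>+t. e a b w t \<partial>(S \<Otimes>\<^sub>M Z) \<partial>CB) = (\<integral>\<^sup>+t. \<integral>\<^sup>+w. e a b w t \<partial>CB \<partial>(S \<Otimes>\<^sub>M Z))"
      using CSZ.Fubini'[OF me[OF ab]] by simp
    also have "\<dots> = (\<integral>\<^sup>+s. \<integral>\<^sup>+z. \<integral>\<^sup>+w. e a b w (s, z) \<partial>CB \<partial>Z \<partial>S)"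
      by (rule Z.nn_integral_fst[OF mt, symmetric])
    also have "\<dots> \<le> (\<integral>\<^sup>+s. (\<integral>\<^sup>+u. of_bool (\<not> G s u) \<partial>PU) ^ MJ +
        (eta + (of_nat M1 * d1 + of_nat (M1 * MJ) * d2 + of_nat (Mc * M1 * MJ) * d3)) \<partial>S)"
    proof (rule nn_integral_mono)
      fix s assume s: "s \<in> space S"
      from message_error_bound[OF ab s bad[OF s] D1 D2 D3]
      show "(\<integral>\<^sup>+z. \<integral>\<^sup>+w. e a b w (s, z) \<partial>CB \<partial>Z) \<le> (\<integral>\<^sup>+u. of_bool (\<not> G s u) \<partial>PU) ^ MJ +
        (eta + (of_nat M1 * d1 + of_nat (M1 * MJ) * d2 + of_nat (Mc * M1 * MJ) * d3))"
        unfolding e_def fst_conv snd_conv add.assoc[symmetric] by blast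
    qed
    also have "\<dots> = (\<integral>\<^sup>+s. (\<integral>\<^sup>+u. of_bool (\<not> G s u) \<partial>PU) ^ MJ \<partial>S) +
        (eta + (of_nat M1 * d1 + of_nat (M1 * MJ) * d2 + of_nat (Mc * M1 * MJ) * d3))"
      by (subst nn_integral_add) (simp_all add: S.emeasure_space_1)
    also have "\<dots> \<le> B"
      unfolding B_def add.assoc by (intro add_mono cover order_refl)
    finally show ?thesis .
  qed
  have mf [measurable]: "f \<in> borel_measurable CB"
    unfolding f_def by measurable
  have "(\<integral>\<^sup>+w. f w \<partial>CB) = (\<Sum>a<Mc. \<Sum>b<M1. \<integral>\<^sup>+w. \<integral>\<^sup>+t. e a b w t \<partial>(S \<Otimes>\<^sub>M Z) \<partial>CB)"
    unfolding f_def using me2 by (subst nn_integral_sum, force intro: borel_measurable_sum)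
      (intro sum.cong refl nn_integral_sum, auto)
  also have "\<dots> \<le> (\<Sum>a<Mc. \<Sum>b<M1. B)"
    by (intro sum_mono single) auto
  also have "\<dots> = of_nat (Mc * M1) * B" by (simp add: mult.assoc)
  finally have total: "(\<integral>\<^sup>+w. f w \<partial>CB) \<le> of_nat (Mc * M1) * B" .
  have "\<exists>w\<in>space CB. f w \<le> of_nat (Mc * M1) * B"
  proof (rule ccontr)
    assume "\<not> ?thesis"
    then have gt: "of_nat (Mc * M1) * B < f w" if "w \<in> space CB" for w using that by (auto simp: not_le)
    have fin: "of_nat (Mc * M1) * B \<noteq> \<infinity>" using gt CB.not_empty by (metis ex_in_conv infinity_ennreal_def not_top_less top.not_eq_extremum less_top)
    have "(\<integral>\<^sup>+w. of_nat (Mc * M1) * B \<partial>CB) < (\<integral>\<^sup>+w. f w \<partial>CB)"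
    proof (rule nn_integral_less)
      show "AE w in CB. of_nat (Mc * M1) * B \<le> f w" using gt by (intro AE_I2) (simp add: less_imp_le)
      show "\<not> (AE w in CB. f w \<le> of_nat (Mc * M1) * B)"
      proof
        assume "AE w in CB. f w \<le> of_nat (Mc * M1) * B"
        then have "AE w in CB. False" by (rule AE_mp) (use gt in \<open>auto intro!: AE_I2 simp: not_le[symmetric]\<close>)
        then show False by simp
      qed
      show "(\<integral>\<^sup>+w. of_nat (Mc * M1) * B \<partial>CB) \<noteq> \<infinity>" using fin by (simp add: CB.emeasure_space_1)
    qed simp_all
    then show False using total by (simp add: CB.emeasure_space_1 not_less[symmetric])
  qed
  then obtain w where w: "w \<in> space CB" "f w \<le> of_nat (Mc * M1) * B" by blast
  have "emeasure (S \<Otimes>\<^sub>M Z) {t \<in> space (S \<Otimes>\<^sub>M Z). \<not> decoded w a b (out any_index w a b (fst t) (snd t))}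
      = (\<integral>\<^sup>+t. e a b w t \<partial>(S \<Otimes>\<^sub>M Z))" if "a < Mc" "b < M1" for a b
    unfolding e_def
    by (rule emeasure_eq_nn_integral_of_bool, unfold pred_def[symmetric]) (use that w(1) in measurable)
  then have "(\<Sum>a<Mc. \<Sum>b<M1. emeasure (S \<Otimes>\<^sub>M Z) {t \<in> space (S \<Otimes>\<^sub>M Z). \<not> decoded w a b (out any_index w a b (fst t) (snd t))}) = f w"
    unfolding f_def by (intro sum.cong refl) simp
  with w that show thesis by (simp add: B_def)
qed

end

section \<open>Covering\<close>

text \<open>The right side dominates the chord of \<open>exp (- (k * c))\<close>, convex in
  \<open>k\<close>, between \<open>k = 0\<close> and \<open>k = 1\<close>. For a success probability
  \<open>k\<close> it separates the loss \<open>1 - k\<close> from a term in \<open>c\<close>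
  alone.\<close>

lemma exp_chord_bound:
  fixes c k :: real
  assumes "0 \<le> k" "k \<le> 1"
  shows "exp (- (k * c)) \<le> 1 - k + exp (- c)"
proof -
  have "exp ((1 - k) *\<^sub>R 0 + k *\<^sub>R (- c)) \<le> (1 - k) * exp 0 + k * exp (- c)"
    by (rule convex_onD[OF convex_on_exp[of 1, simplified]]) (use assms in auto)
  also have "k * exp (- c) \<le> 1 * exp (- c)" using assms by (intro mult_right_mono) auto
  finally show ?thesis by simp
qed

text \<open>\<open>r s\<close> is the density of the intended conditional law of \<open>u\<close>
  given \<open>s\<close>. If that law gives \<open>G s\<close> mass \<open>k\<close>, a blind draw
  hits with probability at least \<open>k / \<gamma>\<close>, so \<open>M\<close> draws all miss
  with probability at most exp (- k * M / \<gamma>). The chord bound then separates the mass missed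
  by the intended law from the effect of the list size.\<close>

lemma covering_bound:
  fixes r :: "'s \<Rightarrow> 'u \<Rightarrow> real"
  assumes "prob_space S" "prob_space U"
    and r [measurable]: "(\<lambda>(s, u). r s u) \<in> borel_measurable (S \<Otimes>\<^sub>M U)"
    and G [measurable]: "Measurable.pred (S \<Otimes>\<^sub>M U) (\<lambda>(s, u). G s u)"
    and r_nonneg: "\<And>s u. 0 \<le> r s u"
    and norm: "\<And>s. s \<in> space S \<Longrightarrow> (\<integral>\<^sup>+u. r s u \<partial>U) = 1"
    and \<gamma>: "\<gamma> > 0" "\<And>s u. G s u \<Longrightarrow> r s u \<le> \<gamma>"
    and miss: "(\<integral>\<^sup>+s. \<integral>\<^sup>+u. ennreal (r s u) * of_bool (\<not> G s u) \<partial>U \<partial>S) \<le> e"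
  shows "(\<integral>\<^sup>+s. (\<integral>\<^sup>+u. of_bool (\<not> G s u) \<partial>U) ^ M \<partial>S) \<le> e + ennreal (exp (- (real M / \<gamma>)))"
proof -
  interpret S: prob_space S by fact
  interpret U: prob_space U by fact
  have pt: "(\<integral>\<^sup>+u. of_bool (\<not> G s u) \<partial>U) ^ M \<le> (\<integral>\<^sup>+u. ennreal (r s u) * of_bool (\<not> G s u) \<partial>U) + ennreal (exp (- (real M / \<gamma>)))"
    if s: "s \<in> space S" for s
  proof -
    have [measurable]: "Measurable.pred U (G s)"
      using measurable_compose[OF measurable_Pair[OF measurable_const[OF s] measurable_ident] G] by simp
    have [measurable]: "r s \<in> borel_measurable U"
      using measurable_compose[OF measurable_Pair[OF measurable_const[OF s] measurable_ident] r] by simp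
    \<comment> \<open>\<open>P\<close> and \<open>P'\<close> are the hit and miss probabilities of a
      blind draw, \<open>K\<close> and \<open>L\<close> those under the intended law.\<close>
    define P where "P = (\<integral>\<^sup>+u. of_bool (G s u) \<partial>U)"
    define P' where "P' = (\<integral>\<^sup>+u. of_bool (\<not> G s u) \<partial>U)"
    define K where "K = (\<integral>\<^sup>+u. ennreal (r s u) * of_bool (G s u) \<partial>U)"
    define L where "L = (\<integral>\<^sup>+u. ennreal (r s u) * of_bool (\<not> G s u) \<partial>U)"
    have "P + P' = (\<integral>\<^sup>+u. of_bool (G s u) + of_bool (\<not> G s u) \<partial>U)"
      unfolding P_def P'_def by (rule nn_integral_add[symmetric]) measurable
    also have "\<dots> = (\<integral>\<^sup>+u. 1 \<partial>U)" by (intro nn_integral_cong) auto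
    finally have PP: "P + P' = 1" by (simp add: U.emeasure_space_1)
    have "K + L = (\<integral>\<^sup>+u. ennreal (r s u) * of_bool (G s u) + ennreal (r s u) * of_bool (\<not> G s u) \<partial>U)"
      unfolding K_def L_def by (rule nn_integral_add[symmetric]) measurable
    also have "\<dots> = (\<integral>\<^sup>+u. ennreal (r s u) \<partial>U)" by (intro nn_integral_cong) auto
    finally have KL: "K + L = 1" using norm[OF s] by simp
    have "K \<le> (\<integral>\<^sup>+u. ennreal \<gamma> * of_bool (G s u) \<partial>U)"
      unfolding K_def using \<gamma>(2) by (intro nn_integral_mono) (auto simp: ennreal_leI)
    also have "\<dots> = ennreal \<gamma> * P" unfolding P_def by (rule nn_integral_cmult) measurable
    finally have KP: "K \<le> ennreal \<gamma> * P" .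
    have "P \<le> 1" "P' \<le> 1" "K \<le> 1" "L \<le> 1"
      using PP KL by (metis le_iff_add add.commute)+
    then obtain p p' k l where eq: "P = ennreal p" "P' = ennreal p'" "K = ennreal k" "L = ennreal l"
      and nn: "0 \<le> p" "0 \<le> p'" "0 \<le> k" "0 \<le> l"
      by (metis ennreal_cases ennreal_one_less_top leD top.not_eq_extremum)
    have s1: "p + p' = 1" "k + l = 1" using PP KL nn by (simp_all add: eq flip: ennreal_plus)
    have kp: "k \<le> \<gamma> * p" using KP nn \<gamma>(1) by (simp add: eq ennreal_le_iff flip: ennreal_mult)
    have "p' ^ M \<le> exp (- p) ^ M"
      using nn s1 exp_ge_add_one_self[of "-p"] by (intro power_mono) auto
    also have "\<dots> = exp (- (p * real M))" by (simp flip: exp_of_nat_mult add: mult.commute)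
    also have "\<dots> \<le> exp (- (k * (real M / \<gamma>)))"
      using mult_right_mono[OF kp, of "real M"] \<gamma>(1) by (simp add: field_simps)
    also have "\<dots> \<le> 1 - k + exp (- (real M / \<gamma>))"
      using s1 nn by (intro exp_chord_bound) auto
    finally have "p' ^ M \<le> l + exp (- (real M / \<gamma>))" using s1 by simp
    then have "P' ^ M \<le> L + ennreal (exp (- (real M / \<gamma>)))"
      unfolding eq using nn by (simp add: ennreal_power ennreal_leI flip: ennreal_plus)
    then show ?thesis by (simp add: P'_def L_def)
  qed
  have "(\<integral>\<^sup>+s. (\<integral>\<^sup>+u. of_bool (\<not> G s u) \<partial>U) ^ M \<partial>S)
      \<le> (\<integral>\<^sup>+s. (\<integral>\<^sup>+u. ennreal (r s u) * of_bool (\<not> G s u) \<partial>U) + ennreal (exp (- (real M / \<gamma>))) \<partial>S)"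
    by (intro nn_integral_mono pt)
  also have "\<dots> = (\<integral>\<^sup>+s. \<integral>\<^sup>+u. ennreal (r s u) * of_bool (\<not> G s u) \<partial>U \<partial>S) + ennreal (exp (- (real M / \<gamma>)))"
    by (subst nn_integral_add) (simp_all add: S.emeasure_space_1)
  finally show ?thesis using miss by (meson add_right_mono order_trans)
qed

section \<open>Gaussian vectors\<close>

definition gauss :: "real \<Rightarrow> real measure" where
  "gauss v = density lborel (normal_density 0 (sqrt v))"

abbreviation phi :: "real \<Rightarrow> real \<Rightarrow> real" where
  "phi v t \<equiv> normal_density 0 (sqrt v) t"

lemma sets_gauss [simp, measurable_cong]: "sets (gauss v) = sets borel"
  by (simp add: gauss_def)

lemma space_gauss [simp]: "space (gauss v) = UNIV"
  by (simp add: gauss_def)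

lemma prob_space_gauss: "v > 0 \<Longrightarrow> prob_space (gauss v)"
  unfolding gauss_def by (rule prob_space_normal_density) simp

lemma normal_density_sqrt:
  "v > 0 \<Longrightarrow> normal_density m (sqrt v) t = exp (- ((t - m)\<^sup>2 / (2 * v))) / sqrt (2 * pi * v)"
  by (simp add: normal_density_def)

text \<open>Bayes' rule for Gaussians: the joint density of \<open>u\<close> and
  \<open>t = c * u + noise\<close> becomes the marginal of \<open>t\<close> times the posterior of
  \<open>u\<close>, whose mean and variance come from completing the square.\<close>

lemma phi_complete_square:
  assumes "S > 0" "D > 0"
  shows "phi D u * phi S (t - c * u) =
    phi (c\<^sup>2 * D + S) t * normal_density (c * D * t / (c\<^sup>2 * D + S)) (sqrt (D * S / (c\<^sup>2 * D + S))) u"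
proof -
  define T where "T = c\<^sup>2 * D + S"
  have T: "T > 0" using assms by (simp add: T_def add_nonneg_pos)
  have a: "u\<^sup>2 / (2 * D) + (t - c * u)\<^sup>2 / (2 * S) = t\<^sup>2 / (2 * T) + (u - c * D * t / T)\<^sup>2 / (2 * (D * S / T))"
  proof -
    have "2 * D * S * T * (u\<^sup>2 / (2 * D) + (t - c * u)\<^sup>2 / (2 * S)) = T * (S * u\<^sup>2 + D * (t - c * u)\<^sup>2)"
      using assms by (simp add: field_simps)
    moreover have "(u - c * D * t / T) = (T * u - c * D * t) / T" using T by (simp add: field_simps)
    then have "2 * D * S * T * (t\<^sup>2 / (2 * T) + (u - c * D * t / T)\<^sup>2 / (2 * (D * S / T))) = D * S * t\<^sup>2 + (T * u - c * D * t)\<^sup>2"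
      using T assms by (simp add: field_simps power2_eq_square)
    moreover have "T * (S * u\<^sup>2 + D * (t - c * u)\<^sup>2) = D * S * t\<^sup>2 + (T * u - c * D * t)\<^sup>2"
      unfolding T_def by algebra
    moreover have "2 * D * S * T \<noteq> 0" using assms T by simp
    ultimately show ?thesis by (metis mult_cancel_left)
  qed
  have b: "sqrt (2 * pi * D) * sqrt (2 * pi * S) = sqrt (2 * pi * T) * sqrt (2 * pi * (D * S / T))"
    using T by (simp add: real_sqrt_mult[symmetric] field_simps)
  have pos: "0 < D * S / T" using assms T by simp
  have mult: "exp (- x) / y * (exp (- x') / y') = exp (- (x + x')) / (y * y')" for x x' y y' :: real
    by (simp add: mult_exp_exp)
  have "phi D u * phi S (t - c * u) = exp (- (u\<^sup>2 / (2 * D) + (t - c * u)\<^sup>2 / (2 * S))) / (sqrt (2 * pi * D) * sqrt (2 * pi * S))"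
    using assms by (simp only: normal_density_sqrt mult diff_zero)
  also have "\<dots> = phi T t * normal_density (c * D * t / T) (sqrt (D * S / T)) u"
    using T pos by (simp only: a b normal_density_sqrt mult diff_zero)
  finally show ?thesis by (simp add: T_def)
qed

lemma nn_integral_gauss:
  assumes [measurable]: "f \<in> borel_measurable borel"
  shows "(\<integral>\<^sup>+x. f x \<partial>gauss v) = (\<integral>\<^sup>+x. ennreal (phi v x) * f x \<partial>lborel)"
  unfolding gauss_def by (rule nn_integral_density) simp_all

lemma nn_integral_gauss_phi:
  assumes "S > 0" "D > 0"
  shows "(\<integral>\<^sup>+u. phi S (t - c * u) \<partial>gauss D) = phi (c\<^sup>2 * D + S) t"
proof -
  define m s where "m = c * D * t / (c\<^sup>2 * D + S)" and "s = sqrt (D * S / (c\<^sup>2 * D + S))"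
  have s: "s > 0" using assms by (simp add: s_def add_nonneg_pos)
  have "(\<integral>\<^sup>+u. phi S (t - c * u) \<partial>gauss D) = (\<integral>\<^sup>+u. ennreal (phi (c\<^sup>2 * D + S) t * normal_density m s u) \<partial>lborel)"
    unfolding m_def s_def
    by (subst nn_integral_gauss) (simp_all add: phi_complete_square[OF assms] flip: ennreal_mult)
  also have "\<dots> = ennreal (phi (c\<^sup>2 * D + S) t) * (\<integral>\<^sup>+u. ennreal (normal_density m s u) \<partial>lborel)"
    by (simp add: ennreal_mult nn_integral_cmult)
  also have "(\<integral>\<^sup>+u. ennreal (normal_density m s u) \<partial>lborel) = 1"
    using s by (simp add: nn_integral_eq_integral)
  finally show ?thesis by simp
qed

lemma gauss_moments:
  assumes "v > 0"
  shows "integrable (gauss v) (\<lambda>x. x)" "(\<integral>x. x \<partial>gauss v) = 0"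
    "integrable (gauss v) (\<lambda>x. x\<^sup>2)" "(\<integral>x. x\<^sup>2 \<partial>gauss v) = v"
    "integrable (gauss v) (\<lambda>x. x ^ 4)" "(\<integral>x. x ^ 4 \<partial>gauss v) = 3 * v\<^sup>2"
proof -
  have s: "sqrt v > 0" using assms by simp
  have sv: "(sqrt v)\<^sup>2 = v" using assms by simp
  have i: "integrable (gauss v) (\<lambda>x. x ^ k)" for k
    unfolding gauss_def using integrable_normal_moment[OF s, of 0 k]
    by (subst integrable_density) simp_all
  have e: "(\<integral>x. x ^ k \<partial>gauss v) = (\<integral>x. phi v x * x ^ k \<partial>lborel)" for k
    unfolding gauss_def by (subst integral_density) simp_all
  show "integrable (gauss v) (\<lambda>x. x)" "integrable (gauss v) (\<lambda>x. x\<^sup>2)" "integrable (gauss v) (\<lambda>x. x ^ 4)"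
    using i[of 1] i[of 2] i[of 4] by simp_all
  show "(\<integral>x. x \<partial>gauss v) = 0"
    using e[of 1] integral_normal_moment_odd[OF s, of 0 0] by simp
  show "(\<integral>x. x\<^sup>2 \<partial>gauss v) = v"
    using e[of 2] integral_normal_moment_even[OF s, of 0 1] sv by (simp add: fact_numeral)
  have "(\<integral>x. x ^ 4 \<partial>gauss v) = fact 4 / ((2 / v)\<^sup>2 * fact 2)"
    using e[of 4] integral_normal_moment_even[OF s, of 0 2] sv by simp
  then show "(\<integral>x. x ^ 4 \<partial>gauss v) = 3 * v\<^sup>2"
    using assms by (simp add: fact_numeral power2_eq_square field_simps)
qed

text \<open>The mean is zero, so cross terms vanish and second moments add. The weights allow one
  Gaussian vector to be frozen as coefficients of another, which covers inner products.\<close>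

lemma nn_integral_PiM_weighted_sum_square:
  fixes f :: "'a \<Rightarrow> real" and c :: "'i \<Rightarrow> real"
  assumes M: "prob_space M" and f: "integrable M f" "(\<integral>x. f x \<partial>M) = 0"
    "integrable M (\<lambda>x. (f x)\<^sup>2)" "(\<integral>x. (f x)\<^sup>2 \<partial>M) = \<sigma>" and I: "finite I"
  shows "(\<integral>\<^sup>+w. (\<Sum>i\<in>I. c i * f (w i))\<^sup>2 \<partial>PiM I (\<lambda>_. M)) = ennreal (\<sigma> * (\<Sum>i\<in>I. (c i)\<^sup>2))"
  using I
proof (induction I)
  case empty
  then show ?case by simp
next
  case (insert i I)
  interpret M: prob_space M by fact
  interpret product_prob_space "\<lambda>_. M" by (rule product_prob_spaceI) (rule M)
  have [measurable]: "f \<in> borel_measurable M" using f(1) by simp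
  have \<sigma>: "\<sigma> \<ge> 0" using f(4) by (metis integral_nonneg_AE zero_le_power2 AE_I2)
  interpret PI: prob_space "PiM I (\<lambda>_. M)" by (rule prob_space_PiM) (rule M)
  have step: "(\<integral>\<^sup>+y. ennreal ((A + c i * f y)\<^sup>2) \<partial>M) = ennreal (A\<^sup>2) + ennreal (\<sigma> * (c i)\<^sup>2)" for A
  proof -
    have eq: "(A + c i * f y)\<^sup>2 = A\<^sup>2 + 2 * A * c i * f y + (c i)\<^sup>2 * (f y)\<^sup>2" for y
      by (simp add: power2_eq_square algebra_simps)
    have int: "integrable M (\<lambda>y. (A + c i * f y)\<^sup>2)" unfolding eq using f by simp
    have "(\<integral>y. (A + c i * f y)\<^sup>2 \<partial>M) = A\<^sup>2 + \<sigma> * (c i)\<^sup>2"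
      unfolding eq using f by (simp add: M.prob_space mult.commute)
    then show ?thesis using int \<sigma> by (simp add: nn_integral_eq_integral)
  qed
  have sums: "(\<Sum>j\<in>insert i I. c j * f ((w(i := y)) j)) = (\<Sum>j\<in>I. c j * f (w j)) + c i * f y" for w y
  proof -
    have "(\<Sum>j\<in>I. c j * f ((w(i := y)) j)) = (\<Sum>j\<in>I. c j * f (w j))"
      using insert.hyps by (intro sum.cong) auto
    then show ?thesis using insert.hyps by simp
  qed
  have "(\<integral>\<^sup>+w. (\<Sum>j\<in>insert i I. c j * f (w j))\<^sup>2 \<partial>PiM (insert i I) (\<lambda>_. M))
      = (\<integral>\<^sup>+w. \<integral>\<^sup>+y. ennreal (((\<Sum>j\<in>I. c j * f (w j)) + c i * f y)\<^sup>2) \<partial>M \<partial>PiM I (\<lambda>_. M))"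
    by (subst product_nn_integral_insert[OF insert.hyps], measurable) (simp only: sums)
  also have "\<dots> = (\<integral>\<^sup>+w. ennreal ((\<Sum>j\<in>I. c j * f (w j))\<^sup>2) + ennreal (\<sigma> * (c i)\<^sup>2) \<partial>PiM I (\<lambda>_. M))"
    by (simp only: step)
  also have "\<dots> = ennreal (\<sigma> * (\<Sum>j\<in>I. (c j)\<^sup>2)) + ennreal (\<sigma> * (c i)\<^sup>2)"
    by (subst nn_integral_add) (simp_all add: insert.IH PI.emeasure_space_1)
  also have "\<dots> = ennreal (\<sigma> * (\<Sum>j\<in>insert i I. (c j)\<^sup>2))"
    using insert.hyps \<sigma> by (simp add: algebra_simps sum_nonneg flip: ennreal_plus)
  finally show ?case .
qed

definition gaussn :: "nat \<Rightarrow> real \<Rightarrow> (nat \<Rightarrow> real) measure" where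
  "gaussn n v = PiM {..<n} (\<lambda>_. gauss v)"

lemma prob_space_gaussn: "v > 0 \<Longrightarrow> prob_space (gaussn n v)"
  unfolding gaussn_def by (intro prob_space_PiM prob_space_gauss)

lemma of_bool_le_square_ratio:
  fixes t a :: real
  assumes "a > 0"
  shows "(of_bool (\<bar>t\<bar> > a) :: ennreal) \<le> ennreal (1 / a\<^sup>2) * ennreal (t\<^sup>2)"
proof (cases "\<bar>t\<bar> > a")
  case True
  then have "a\<^sup>2 \<le> t\<^sup>2" using assms by (metis abs_le_square_iff abs_of_pos less_imp_le)
  then have "1 \<le> 1 / a\<^sup>2 * t\<^sup>2" using assms by (simp add: field_simps)
  then show ?thesis using True by (simp add: ennreal_1[symmetric] ennreal_leI flip: ennreal_mult del: ennreal_1)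
qed simp

lemma gaussn_measurable_component [measurable (raw)]: "i < n \<Longrightarrow> (\<lambda>w. w i) \<in> borel_measurable (gaussn n v)"
  using measurable_component_singleton[of i "{..<n}" "\<lambda>_. gauss v"] measurable_cong_sets[OF refl sets_gauss[of v]]
  by (simp add: gaussn_def)

text \<open>Chebyshev's inequality, with 3 * v^2 - v^2 as the variance of the square of one
  letter.\<close>

lemma gaussn_square_deviation:
  assumes "v > 0" "n > 0" "h > 0"
  shows "(\<integral>\<^sup>+a. of_bool (\<bar>(\<Sum>i<n. a i * a i) - real n * v\<bar> > real n * h) \<partial>gaussn n v) \<le> ennreal (2 * v\<^sup>2 / (real n * h\<^sup>2))"
proof -
  interpret g: prob_space "gauss v" using assms(1) by (rule prob_space_gauss)
  note mom = gauss_moments[OF assms(1)]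
  have eq: "(x\<^sup>2 - v)\<^sup>2 = x ^ 4 - 2 * v * x\<^sup>2 + v\<^sup>2" for x :: real
    by (simp add: power2_eq_square algebra_simps power4_eq_xxxx)
  have "(\<integral>\<^sup>+a. ennreal ((\<Sum>i<n. 1 * ((a i)\<^sup>2 - v))\<^sup>2) \<partial>gaussn n v) = ennreal (2 * v\<^sup>2 * (\<Sum>i<n. 1\<^sup>2))"
    unfolding gaussn_def
  proof (rule nn_integral_PiM_weighted_sum_square[OF g.prob_space_axioms])
    show "(\<integral>x. x\<^sup>2 - v \<partial>gauss v) = 0" using mom by (simp add: g.prob_space[simplified])
    show "(\<integral>x. (x\<^sup>2 - v)\<^sup>2 \<partial>gauss v) = 2 * v\<^sup>2" unfolding eq using mom by (simp add: g.prob_space[simplified]) (simp add: power2_eq_square)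
  qed (use mom in \<open>simp_all add: eq\<close>)
  then have sq: "(\<integral>\<^sup>+a. ennreal (((\<Sum>i<n. a i * a i) - real n * v)\<^sup>2) \<partial>gaussn n v) = ennreal (2 * v\<^sup>2 * real n)"
    by (simp add: sum_subtractf power2_eq_square)
  have "(\<integral>\<^sup>+a. of_bool (\<bar>(\<Sum>i<n. a i * a i) - real n * v\<bar> > real n * h) \<partial>gaussn n v)
     \<le> (\<integral>\<^sup>+a. ennreal (1 / (real n * h)\<^sup>2) * ennreal (((\<Sum>i<n. a i * a i) - real n * v)\<^sup>2) \<partial>gaussn n v)"
    using assms by (intro nn_integral_mono of_bool_le_square_ratio) simp
  also have "\<dots> = ennreal (1 / (real n * h)\<^sup>2) * ennreal (2 * v\<^sup>2 * real n)"
    by (subst nn_integral_cmult) (simp_all add: sq)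
  also have "\<dots> = ennreal (2 * v\<^sup>2 / (real n * h\<^sup>2))"
    using assms by (simp add: power2_eq_square field_simps flip: ennreal_mult)
  finally show ?thesis .
qed

text \<open>Given \<open>a\<close>, the inner product has second moment \<open>v'\<close> times the
  squared length of \<open>a\<close>; averaging over \<open>a\<close> gives
  \<open>n * v * v'\<close>, and Chebyshev's inequality applies.\<close>

lemma gaussn_product_deviation:
  assumes "v > 0" "v' > 0" "n > 0" "h > 0"
  shows "(\<integral>\<^sup>+a. \<integral>\<^sup>+b. of_bool (\<bar>\<Sum>i<n. a i * b i\<bar> > real n * h) \<partial>gaussn n v' \<partial>gaussn n v) \<le> ennreal (v * v' / (real n * h\<^sup>2))"
proof -
  have one: "(\<integral>\<^sup>+b. ennreal ((\<Sum>i<n. a i * b i)\<^sup>2) \<partial>gaussn n w) = ennreal (w * (\<Sum>i<n. (a i)\<^sup>2))" if "w > 0" for w and a :: "nat \<Rightarrow> real"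
    unfolding gaussn_def
    by (rule nn_integral_PiM_weighted_sum_square[where f = "\<lambda>x. x"]) (use that gauss_moments prob_space_gauss in auto)
  have two: "(\<integral>\<^sup>+a. ennreal (\<Sum>i<n. (a i)\<^sup>2) \<partial>gaussn n v) = ennreal (real n * v)"
  proof -
    interpret product_prob_space "\<lambda>_. gauss v" by (rule product_prob_spaceI) (rule prob_space_gauss[OF assms(1)])
    have "(\<integral>\<^sup>+a. ennreal ((a i)\<^sup>2) \<partial>gaussn n v) = ennreal v" if "i < n" for i
    proof -
      have "(\<Sum>j<n. (of_bool (j = i) :: real) * b j) = b i" for b :: "nat \<Rightarrow> real"
        using that by (simp add: of_bool_def if_distrib[where f = "\<lambda>x. x * _"] sum.delta cong: if_cong)
      moreover have "(\<Sum>j<n. (of_bool (j = i) :: real)\<^sup>2) = 1"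
        using that by (simp add: of_bool_def if_distrib[where f = "\<lambda>x. x\<^sup>2"] sum.delta cong: if_cong)
      ultimately show ?thesis using one[OF assms(1), of "\<lambda>j. of_bool (j = i)"] by simp
    qed
    then have "(\<integral>\<^sup>+a. (\<Sum>i<n. ennreal ((a i)\<^sup>2)) \<partial>gaussn n v) = (\<Sum>i<n. ennreal v)"
      by (subst nn_integral_sum) auto
    then show ?thesis using assms by (simp add: sum_ennreal)
       (simp add: ennreal_mult ennreal_of_nat_eq_real_of_nat)
  qed
  have "(\<integral>\<^sup>+a. \<integral>\<^sup>+b. of_bool (\<bar>\<Sum>i<n. a i * b i\<bar> > real n * h) \<partial>gaussn n v' \<partial>gaussn n v)
     \<le> (\<integral>\<^sup>+a. \<integral>\<^sup>+b. ennreal (1 / (real n * h)\<^sup>2) * ennreal ((\<Sum>i<n. a i * b i)\<^sup>2) \<partial>gaussn n v' \<partial>gaussn n v)"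
    using assms by (intro nn_integral_mono of_bool_le_square_ratio) simp
  also have "\<dots> = (\<integral>\<^sup>+a. ennreal (1 / (real n * h)\<^sup>2 * v') * ennreal (\<Sum>i<n. (a i)\<^sup>2) \<partial>gaussn n v)"
    using assms by (subst nn_integral_cmult) (simp_all add: one sum_nonneg flip: ennreal_mult)
  also have "\<dots> = ennreal (1 / (real n * h)\<^sup>2 * v') * ennreal (real n * v)"
    by (subst nn_integral_cmult) (simp_all add: two)
  also have "\<dots> = ennreal (v * v' / (real n * h\<^sup>2))"
    using assms by (simp add: power2_eq_square field_simps flip: ennreal_mult)
  finally show ?thesis .
qed

section \<open>Change of law and likelihood ratios for Gaussian vectors\<close>

lemma gauss_shift_density:
  assumes "p > 0" "D > 0" and h [measurable]: "h \<in> borel_measurable borel"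
  shows "(\<integral>\<^sup>+u. ennreal (phi p (u - m) / phi D u) * h u \<partial>gauss D) = (\<integral>\<^sup>+w. h (w + m) \<partial>gauss p)"
proof -
  have "phi D u > 0" for u using assms by (simp add: normal_density_pos)
  then have "ennreal (phi D u) * (ennreal (phi p (u - m) / phi D u) * h u) = ennreal (phi p (u - m)) * h u" for u
    by (simp add: mult.assoc[symmetric] ennreal_mult[symmetric] less_imp_le less_imp_neq[symmetric])
  then have "(\<integral>\<^sup>+u. ennreal (phi p (u - m) / phi D u) * h u \<partial>gauss D) = (\<integral>\<^sup>+u. ennreal (phi p (u - m)) * h u \<partial>lborel)"
    by (subst nn_integral_gauss) simp_all
  also have "\<dots> = (\<integral>\<^sup>+w. ennreal (phi p w) * h (w + m) \<partial>lborel)"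
    by (subst nn_integral_real_affine[where c = 1 and t = m]) (simp_all add: add.commute)
  also have "\<dots> = (\<integral>\<^sup>+w. h (w + m) \<partial>gauss p)"
    by (subst nn_integral_gauss) simp_all
  finally show ?thesis .
qed

abbreviation BN :: "nat \<Rightarrow> (nat \<Rightarrow> real) measure" where
  "BN n \<equiv> PiM {..<n} (\<lambda>_. borel)"

lemma sets_gaussn [measurable_cong]: "sets (gaussn n v) = sets (BN n)"
  unfolding gaussn_def by (rule sets_PiM_cong) simp_all

lemma space_gaussn: "space (gaussn n v) = space (BN n)"
  by (rule sets_eq_imp_space_eq) (rule sets_gaussn)

text \<open>The product is the density, relative to the reference law of variance \<open>D\<close>,
  of a vector with mean \<open>m\<close> and variance \<open>p\<close>; integrating against it
  amounts to substituting \<open>w + m\<close>. This turns a codeword drawn blindly into one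
  generated from the state. The restriction on the right keeps the shifted vector in the product
  space, whose functions are \<open>undefined\<close> off \<open>I\<close>.\<close>

lemma PiM_gauss_shift_density:
  assumes p: "p > 0" and D: "D > 0" and I: "finite I"
    and h: "h \<in> borel_measurable (PiM I (\<lambda>_. borel :: real measure))"
  shows "(\<integral>\<^sup>+u. ennreal (\<Prod>i\<in>I. phi p (u i - m i) / phi D (u i)) * h u \<partial>PiM I (\<lambda>_. gauss D))
    = (\<integral>\<^sup>+w. h (\<lambda>i\<in>I. w i + m i) \<partial>PiM I (\<lambda>_. gauss p))"
  using I h
proof (induction I arbitrary: h)
  case empty
  then show ?case by (simp add: PiM_empty nn_integral_count_space_finite)
next
  case (insert i I)
  interpret P: product_prob_space "\<lambda>_. gauss p" by (rule product_prob_spaceI) (rule prob_space_gauss[OF p])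
  interpret D: product_prob_space "\<lambda>_. gauss D" by (rule product_prob_spaceI) (rule prob_space_gauss[OF D])
  note h [measurable] = insert.prems
  have eqs [measurable_cong]: "sets (PiM J (\<lambda>_. gauss v)) = sets (PiM J (\<lambda>_. borel))" for v and J :: "'a set"
    by (rule sets_PiM_cong) simp_all
  have upd: "(\<lambda>(w, x). h (w(i := x))) \<in> borel_measurable (PiM I (\<lambda>_. borel) \<Otimes>\<^sub>M borel)"
    using measurable_compose[OF measurable_add_dim h] by (simp add: case_prod_unfold)
  have upd1: "(\<lambda>x. h (w(i := x))) \<in> borel_measurable borel" if "w \<in> space (PiM I (\<lambda>_. borel))" for w
    using measurable_compose[OF measurable_Pair1'[OF that] upd] by simp
  have prods: "(\<Prod>j\<in>insert i I. phi p ((u(i := y)) j - m j) / phi D ((u(i := y)) j))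
      = (\<Prod>j\<in>I. phi p (u j - m j) / phi D (u j)) * (phi p (y - m i) / phi D y)" for u y
  proof -
    have "(\<Prod>j\<in>I. phi p ((u(i := y)) j - m j) / phi D ((u(i := y)) j)) = (\<Prod>j\<in>I. phi p (u j - m j) / phi D (u j))"
      using insert.hyps by (intro prod.cong) auto
    then show ?thesis using insert.hyps by simp
  qed
  \<comment> \<open>Shifting coordinate \<open>i\<close> first leaves a function of the other
    coordinates, to which the induction hypothesis for arbitrary \<open>h\<close> applies.\<close>
  define h' where "h' = (\<lambda>u. \<integral>\<^sup>+y. h (u(i := y + m i)) \<partial>gauss p)"
  have mh': "h' \<in> borel_measurable (PiM I (\<lambda>_. borel))"
  proof -
    have "(\<lambda>t. (fst t, snd t + m i)) \<in> measurable (PiM I (\<lambda>_. borel) \<Otimes>\<^sub>M gauss p) (PiM I (\<lambda>_. borel) \<Otimes>\<^sub>M borel)"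
      by measurable
    from measurable_compose[OF this upd] show ?thesis
      unfolding h'_def by (intro sigma_finite_measure.borel_measurable_nn_integral[OF prob_space_imp_sigma_finite[OF prob_space_gauss[OF p]]]) (simp add: case_prod_unfold)
  qed
  have "(\<integral>\<^sup>+u. ennreal (\<Prod>j\<in>insert i I. phi p (u j - m j) / phi D (u j)) * h u \<partial>PiM (insert i I) (\<lambda>_. gauss D))
     = (\<integral>\<^sup>+u. \<integral>\<^sup>+y. ennreal ((\<Prod>j\<in>I. phi p (u j - m j) / phi D (u j)) * (phi p (y - m i) / phi D y)) * h (u(i := y)) \<partial>gauss D \<partial>PiM I (\<lambda>_. gauss D))"
    by (subst D.product_nn_integral_insert[OF insert.hyps], measurable) (simp only: prods)
  also have "\<dots> = (\<integral>\<^sup>+u. ennreal (\<Prod>j\<in>I. phi p (u j - m j) / phi D (u j)) * h' u \<partial>PiM I (\<lambda>_. gauss D))"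
  proof (rule nn_integral_cong)
    fix u assume "u \<in> space (PiM I (\<lambda>_. gauss D))"
    then have [measurable]: "(\<lambda>x. h (u(i := x))) \<in> borel_measurable borel"
      by (intro upd1) (simp add: space_PiM)
    have "(\<integral>\<^sup>+y. ennreal ((\<Prod>j\<in>I. phi p (u j - m j) / phi D (u j)) * (phi p (y - m i) / phi D y)) * h (u(i := y)) \<partial>gauss D)
       = (\<integral>\<^sup>+y. ennreal (\<Prod>j\<in>I. phi p (u j - m j) / phi D (u j)) * (ennreal (phi p (y - m i) / phi D y) * h (u(i := y))) \<partial>gauss D)"
    proof (rule nn_integral_cong)
      fix y
      have "0 \<le> (\<Prod>j\<in>I. phi p (u j - m j) / phi D (u j))" "0 \<le> phi p (y - m i) / phi D y"
        by (simp_all add: prod_nonneg)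
      then show "ennreal ((\<Prod>j\<in>I. phi p (u j - m j) / phi D (u j)) * (phi p (y - m i) / phi D y)) * h (u(i := y))
         = ennreal (\<Prod>j\<in>I. phi p (u j - m j) / phi D (u j)) * (ennreal (phi p (y - m i) / phi D y) * h (u(i := y)))"
        by (simp only: ennreal_mult mult.assoc)
    qed
    also have "\<dots> = ennreal (\<Prod>j\<in>I. phi p (u j - m j) / phi D (u j)) * h' u"
      unfolding h'_def by (subst nn_integral_cmult) (simp_all add: gauss_shift_density[OF p D])
    finally show "(\<integral>\<^sup>+y. ennreal ((\<Prod>j\<in>I. phi p (u j - m j) / phi D (u j)) * (phi p (y - m i) / phi D y)) * h (u(i := y)) \<partial>gauss D)
       = ennreal (\<Prod>j\<in>I. phi p (u j - m j) / phi D (u j)) * h' u" .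
  qed
  also have "\<dots> = (\<integral>\<^sup>+w. h' (\<lambda>j\<in>I. w j + m j) \<partial>PiM I (\<lambda>_. gauss p))"
    by (rule insert.IH[OF mh'])
  also have "\<dots> = (\<integral>\<^sup>+w. \<integral>\<^sup>+y. h (\<lambda>j\<in>insert i I. (w(i := y)) j + m j) \<partial>gauss p \<partial>PiM I (\<lambda>_. gauss p))"
    unfolding h'_def
  proof (intro nn_integral_cong arg_cong[where f = h])
    show "(\<lambda>j\<in>I. w j + m j)(i := y + m i) = (\<lambda>j\<in>insert i I. (w(i := y)) j + m j)" for w y
      using insert.hyps by (auto simp: fun_eq_iff restrict_def)
  qed
  also have "\<dots> = (\<integral>\<^sup>+w. h (\<lambda>j\<in>insert i I. w j + m j) \<partial>PiM (insert i I) (\<lambda>_. gauss p))"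
    by (subst P.product_nn_integral_insert[OF insert.hyps]) measurable
  finally show ?case .
qed

lemma gaussn_shift_density:
  assumes "p > 0" "D > 0" "h \<in> borel_measurable (BN n)"
  shows "(\<integral>\<^sup>+u. ennreal (\<Prod>i<n. phi p (u i - m i) / phi D (u i)) * h u \<partial>gaussn n D)
    = (\<integral>\<^sup>+w. h (\<lambda>i\<in>{..<n}. w i + m i) \<partial>gaussn n p)"
  unfolding gaussn_def using PiM_gauss_shift_density[OF assms(1,2) _ assms(3)] by simp

text \<open>The denominators \<open>w\<close> do not involve the integration variable and are
  carried along, so integrations over \<open>u\<close>, \<open>x\<close> and \<open>v\<close> can be
  chained before the denominator cancels.\<close>

lemma nn_integral_gaussn_phi_prod:
  assumes a: "a > 0" and S: "S > 0" and w: "\<And>i. i < n \<Longrightarrow> 0 < w i"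
  shows "(\<integral>\<^sup>+x. ennreal (\<Prod>i<n. phi S (t i - b * x i) / w i) \<partial>gaussn n a) = ennreal (\<Prod>i<n. phi (b\<^sup>2 * a + S) (t i) / w i)"
proof -
  interpret product_prob_space "\<lambda>_. gauss a" by (rule product_prob_spaceI) (rule prob_space_gauss[OF a])
  have one: "(\<integral>\<^sup>+x. ennreal (phi S (t i - b * x) / w i) \<partial>gauss a) = ennreal (phi (b\<^sup>2 * a + S) (t i) / w i)" if "i < n" for i
  proof -
    have "(\<integral>\<^sup>+x. ennreal (phi S (t i - b * x) / w i) \<partial>gauss a) = (\<integral>\<^sup>+x. ennreal (1 / w i) * ennreal (phi S (t i - b * x)) \<partial>gauss a)"
      using w[OF that] by (intro nn_integral_cong) (simp add: less_imp_le flip: ennreal_mult)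
    also have "\<dots> = ennreal (1 / w i) * ennreal (phi (b\<^sup>2 * a + S) (t i))"
      by (subst nn_integral_cmult, measurable) (simp add: nn_integral_gauss_phi[OF S a])
    finally show ?thesis using w[OF that] by (simp add: less_imp_le flip: ennreal_mult)
  qed
  have "(\<integral>\<^sup>+x. ennreal (\<Prod>i<n. phi S (t i - b * x i) / w i) \<partial>gaussn n a) = (\<integral>\<^sup>+x. (\<Prod>i<n. ennreal (phi S (t i - b * x i) / w i)) \<partial>gaussn n a)"
    using w by (intro nn_integral_cong prod_ennreal[symmetric]) (simp add: less_imp_le)
  also have "\<dots> = (\<Prod>i<n. \<integral>\<^sup>+x. ennreal (phi S (t i - b * x) / w i) \<partial>gauss a)"
    unfolding gaussn_def by (rule product_nn_integral_prod) simp_all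
  also have "\<dots> = (\<Prod>i<n. ennreal (phi (b\<^sup>2 * a + S) (t i) / w i))"
    by (intro prod.cong) (simp_all add: one)
  also have "\<dots> = ennreal (\<Prod>i<n. phi (b\<^sup>2 * a + S) (t i) / w i)"
    using w by (intro prod_ennreal) (simp add: less_imp_le)
  finally show ?thesis .
qed

lemma of_bool_greater_le:
  fixes t g :: real
  assumes "g > 0" "t \<ge> 0"
  shows "(of_bool (t > g) :: ennreal) \<le> ennreal (1 / g) * ennreal t"
proof (cases "t > g")
  case True
  then have "1 \<le> 1 / g * t" using assms by (simp add: field_simps)
  then show ?thesis using True assms by (simp add: ennreal_1[symmetric] ennreal_leI flip: ennreal_mult del: ennreal_1)
qed simp

text \<open>The log-likelihood ratio sees the data only through two sums of squares, which is why
  typicality need control only empirical second moments.\<close>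

lemma phi_ratio_prod_exp:
  assumes "A > 0" "B > 0"
  shows "(\<Prod>i<n. phi A (f i) / phi B (g i)) =
    exp (real n * (ln (B / A) / 2) - (\<Sum>i<n. (f i)\<^sup>2) / (2 * A) + (\<Sum>i<n. (g i)\<^sup>2) / (2 * B))"
proof -
  have "phi A x / phi B y = exp (ln (B / A) / 2 - x\<^sup>2 / (2 * A) + y\<^sup>2 / (2 * B))" for x y
  proof -
    have "sqrt (2 * pi * B) / sqrt (2 * pi * A) = exp (ln (B / A) / 2)"
    proof -
      have "sqrt (2 * pi * B) / sqrt (2 * pi * A) = sqrt (B / A)"
        by (simp add: real_sqrt_mult real_sqrt_divide)
      also have "\<dots> = exp (ln (B / A) / 2)"
        using assms by (simp add: ln_sqrt[symmetric])
      finally show ?thesis .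
    qed
    moreover have "phi A x / phi B y = (sqrt (2 * pi * B) / sqrt (2 * pi * A)) * (exp (- (x\<^sup>2 / (2 * A))) * exp (y\<^sup>2 / (2 * B)))"
      using assms by (simp add: normal_density_sqrt exp_minus field_simps)
    ultimately show ?thesis by (simp add: mult_exp_exp)
  qed
  then show ?thesis
    by (simp add: exp_sum[symmetric] sum.distrib sum_subtractf sum_divide_distrib)
qed

text \<open>A relative error \<open>e\<close> in either sum of squares shifts the exponent by at
  most \<open>n * e / 2\<close>; together they cost \<open>e\<close> per letter.\<close>

lemma phi_ratio_prod_bounds:
  assumes "A > 0" "B > 0"
    and f: "\<bar>(\<Sum>i<n. (f i)\<^sup>2) - real n * A\<bar> \<le> real n * (A * e)"
    and g: "\<bar>(\<Sum>i<n. (g i)\<^sup>2) - real n * B\<bar> \<le> real n * (B * e)"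
  shows "exp (real n * (ln (B / A) / 2 - e)) \<le> (\<Prod>i<n. phi A (f i) / phi B (g i))"
    and "(\<Prod>i<n. phi A (f i) / phi B (g i)) \<le> exp (real n * (ln (B / A) / 2 + e))"
proof -
  have n: "\<bar>T / (2 * C) - real n / 2\<bar> \<le> real n * e / 2" if C: "C > 0" and T: "\<bar>T - real n * C\<bar> \<le> real n * (C * e)" for C T
  proof -
    have "T / (2 * C) - real n / 2 = (T - real n * C) / (2 * C)"
      using C by (simp add: field_simps)
    then have "\<bar>T / (2 * C) - real n / 2\<bar> = \<bar>T - real n * C\<bar> / (2 * C)"
      using C by (simp add: abs_divide)
    also have "\<dots> \<le> real n * (C * e) / (2 * C)" using C T by (intro divide_right_mono) auto
    finally show ?thesis using C by simp
  qed
  from n[OF assms(1) f] n[OF assms(2) g]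
  show "exp (real n * (ln (B / A) / 2 - e)) \<le> (\<Prod>i<n. phi A (f i) / phi B (g i))"
    and "(\<Prod>i<n. phi A (f i) / phi B (g i)) \<le> exp (real n * (ln (B / A) / 2 + e))"
    unfolding phi_ratio_prod_exp[OF assms(1,2)] exp_le_cancel_iff right_diff_distrib distrib_left abs_le_iff by linarith+
qed

section \<open>Joint typicality\<close>

text \<open>This compares the normalised Gram matrix of the vectors with the covariance matrix of
  independent ones. All sums of squares needed later are quadratic forms in that matrix.\<close>

definition typical :: "nat \<Rightarrow> nat \<Rightarrow> real \<Rightarrow> (nat \<Rightarrow> real) \<Rightarrow> (nat \<Rightarrow> nat \<Rightarrow> real) \<Rightarrow> bool" where
  "typical m n h \<tau> q \<longleftrightarrow> (\<forall>k<m. \<forall>l<m. \<bar>(\<Sum>i<n. q k i * q l i) - real n * (if k = l then \<tau> k else 0)\<bar> \<le> real n * h)"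

text \<open>Expanding the square gives a quadratic form in the Gram matrix. Its entrywise error
  \<open>h\<close> is weighted by \<open>\<bar>c k\<bar> * \<bar>c l\<bar>\<close>, and these
  weights sum to the square of the l1 norm of \<open>c\<close>.\<close>

lemma typical_linear_form:
  assumes "typical m n h \<tau> q"
  shows "\<bar>(\<Sum>i<n. (\<Sum>k<m. c k * q k i)\<^sup>2) - real n * (\<Sum>k<m. (c k)\<^sup>2 * \<tau> k)\<bar> \<le> real n * (h * (\<Sum>k<m. \<bar>c k\<bar>)\<^sup>2)"
proof -
  define E where "E k l = (\<Sum>i<n. q k i * q l i) - real n * (if k = l then \<tau> k else 0)" for k l
  have E: "\<bar>E k l\<bar> \<le> real n * h" if "k < m" "l < m" for k l
    using assms that unfolding typical_def E_def by blast
  have "(\<Sum>i<n. (\<Sum>k<m. c k * q k i)\<^sup>2) = (\<Sum>i<n. \<Sum>k<m. \<Sum>l<m. c k * c l * (q k i * q l i))"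
    by (simp add: power2_eq_square sum_product ac_simps)
  also have "\<dots> = (\<Sum>k<m. \<Sum>i<n. \<Sum>l<m. c k * c l * (q k i * q l i))"
    by (rule sum.swap)
  also have "\<dots> = (\<Sum>k<m. \<Sum>l<m. \<Sum>i<n. c k * c l * (q k i * q l i))"
    by (intro sum.cong refl sum.swap)
  also have "\<dots> = (\<Sum>k<m. \<Sum>l<m. c k * c l * (\<Sum>i<n. q k i * q l i))"
    by (simp add: sum_distrib_left)
  also have "\<dots> = (\<Sum>k<m. \<Sum>l<m. c k * c l * E k l + (if k = l then real n * ((c k)\<^sup>2 * \<tau> k) else 0))"
    by (intro sum.cong refl) (simp add: E_def algebra_simps power2_eq_square)
  also have "\<dots> = (\<Sum>k<m. \<Sum>l<m. c k * c l * E k l) + real n * (\<Sum>k<m. (c k)\<^sup>2 * \<tau> k)"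
    by (simp add: sum.distrib sum_distrib_left)
  finally have "\<bar>(\<Sum>i<n. (\<Sum>k<m. c k * q k i)\<^sup>2) - real n * (\<Sum>k<m. (c k)\<^sup>2 * \<tau> k)\<bar> = \<bar>\<Sum>k<m. \<Sum>l<m. c k * c l * E k l\<bar>"
    by simp
  also have "\<dots> \<le> (\<Sum>k<m. \<Sum>l<m. \<bar>c k\<bar> * \<bar>c l\<bar> * (real n * h))"
    by (rule order_trans[OF sum_abs], intro sum_mono order_trans[OF sum_abs] )
      (auto intro!: sum_mono mult_left_mono E simp: abs_mult)
  also have "\<dots> = real n * (h * (\<Sum>k<m. \<bar>c k\<bar>)\<^sup>2)"
    by (simp add: power2_eq_square sum_product sum_distrib_left ac_simps)
  finally show ?thesis .
qed


lemma typical_fails_bound: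
  assumes \<tau>: "\<And>k. \<tau> k > 0" and n: "n > 0" and h: "h > 0"
  shows "(\<integral>\<^sup>+q. of_bool (\<not> typical m n h \<tau> q) \<partial>PiM {..<m} (\<lambda>k. gaussn n (\<tau> k)))
    \<le> ennreal ((\<Sum>k<m. \<Sum>l<m. 2 * \<tau> k * \<tau> l / h\<^sup>2) / real n)"
proof -
  define Om where "Om = PiM {..<m} (\<lambda>k. gaussn n (\<tau> k))"
  have ps: "prob_space (gaussn n (\<tau> k))" for k by (rule prob_space_gaussn[OF \<tau>])
  interpret Om: prob_space Om unfolding Om_def by (rule prob_space_PiM) (rule ps)
  have comp [measurable]: "(\<lambda>q. q k) \<in> measurable Om (gaussn n (\<tau> k))" if "k < m" for k
    unfolding Om_def using that by (intro measurable_component_singleton) simp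
  have comp' [measurable]: "(\<lambda>q. q k i) \<in> borel_measurable Om" if "k < m" "i < n" for k i
    using measurable_compose[OF comp gaussn_measurable_component] that by simp
  define e where "e k l q = (of_bool (\<bar>(\<Sum>i<n. q k i * q l i) - real n * (if k = l then \<tau> k else 0)\<bar> > real n * h) :: ennreal)" for k l and q :: "nat \<Rightarrow> nat \<Rightarrow> real"
  have me [measurable]: "e k l \<in> borel_measurable Om" if "k < m" "l < m" for k l
    unfolding e_def using that by measurable
  have le: "of_bool (\<not> typical m n h \<tau> q) \<le> (\<Sum>k<m. \<Sum>l<m. e k l q)" for q
  proof (cases "typical m n h \<tau> q")
    case False
    then obtain k l where kl: "k < m" "l < m" "e k l q = 1"
      by (auto simp: typical_def e_def not_le)
    have "e k l q \<le> (\<Sum>l<m. e k l q)" using kl by (intro member_le_sum) auto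
    also have "\<dots> \<le> (\<Sum>k<m. \<Sum>l<m. e k l q)" using kl by (intro member_le_sum[of k _ "\<lambda>k. \<Sum>l<m. e k l q"]) auto
    finally show ?thesis using False kl by simp
  qed simp
  have pair: "(\<integral>\<^sup>+q. e k l q \<partial>Om) \<le> ennreal (2 * \<tau> k * \<tau> l / h\<^sup>2 / real n)" if kl: "k < m" "l < m" for k l
  proof (cases "k = l")
    case True
    have "(\<integral>\<^sup>+q. e k l q \<partial>Om) = (\<integral>\<^sup>+q. \<integral>\<^sup>+a. e k l (q(k := a)) \<partial>gaussn n (\<tau> k) \<partial>Om)"
      unfolding Om_def by (rule nn_integral_PiM_resample[OF _ _ ps]) (use kl me Om_def in auto)
    also have "\<dots> = (\<integral>\<^sup>+a. of_bool (\<bar>(\<Sum>i<n. a i * a i) - real n * \<tau> k\<bar> > real n * h) \<partial>gaussn n (\<tau> k))"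
      using True by (simp add: e_def Om.emeasure_space_1)
    also have "\<dots> \<le> ennreal (2 * (\<tau> k)\<^sup>2 / (real n * h\<^sup>2))"
      by (rule gaussn_square_deviation[OF \<tau> n h])
    finally show ?thesis using True by (simp add: power2_eq_square field_simps)
  next
    case False
    have "(\<integral>\<^sup>+q. e k l q \<partial>Om) = (\<integral>\<^sup>+q. \<integral>\<^sup>+a. \<integral>\<^sup>+b. e k l (q(k := a, l := b)) \<partial>gaussn n (\<tau> l) \<partial>gaussn n (\<tau> k) \<partial>Om)"
      unfolding Om_def by (rule nn_integral_PiM_resample2[OF _ _ _ ps]) (use kl me Om_def in auto)
    also have "\<dots> = (\<integral>\<^sup>+a. \<integral>\<^sup>+b. of_bool (\<bar>\<Sum>i<n. a i * b i\<bar> > real n * h) \<partial>gaussn n (\<tau> l) \<partial>gaussn n (\<tau> k))"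
      using False by (simp add: e_def Om.emeasure_space_1)
    also have "\<dots> \<le> ennreal (\<tau> k * \<tau> l / (real n * h\<^sup>2))"
      by (rule gaussn_product_deviation[OF \<tau> \<tau> n h])
    \<comment> \<open>The factor 2, which the variance of squares puts on the diagonal, is granted
      here too so that all pairs share one bound.\<close>
    also have "\<dots> \<le> ennreal (2 * \<tau> k * \<tau> l / h\<^sup>2 / real n)"
      using n h \<tau>[of k] \<tau>[of l] by (intro ennreal_leI) (simp add: field_simps)
    finally show ?thesis .
  qed
  have "(\<integral>\<^sup>+q. of_bool (\<not> typical m n h \<tau> q) \<partial>Om) \<le> (\<integral>\<^sup>+q. (\<Sum>k<m. \<Sum>l<m. e k l q) \<partial>Om)"
    by (intro nn_integral_mono le)
  also have "\<dots> = (\<Sum>k<m. \<Sum>l<m. \<integral>\<^sup>+q. e k l q \<partial>Om)"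
    using me by (subst nn_integral_sum, force intro: borel_measurable_sum)
      (intro sum.cong refl nn_integral_sum, auto)
  also have "\<dots> \<le> (\<Sum>k<m. \<Sum>l<m. ennreal (2 * \<tau> k * \<tau> l / h\<^sup>2 / real n))"
    by (intro sum_mono pair) auto
  also have "\<dots> = ennreal ((\<Sum>k<m. \<Sum>l<m. 2 * \<tau> k * \<tau> l / h\<^sup>2) / real n)"
    using \<tau> by (simp add: sum_ennreal sum_nonneg less_imp_le sum_divide_distrib)
  finally show ?thesis unfolding Om_def .
qed

lemma typical_cong:
  "(\<And>k. k < m \<Longrightarrow> q k = q' k) \<Longrightarrow> typical m n h \<tau> q = typical m n h \<tau> q'"
  by (simp add: typical_def)

text \<open>The order is state, \<open>W = U - \<alpha> S'\<close>, \<open>V\<close>,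
  \<open>X\<close>, noise. The default at other positions repeats the first argument, so that five
  positive variances give a function positive at every index, as \<open>typical_fails_bound\<close>
  asks.\<close>

abbreviation five :: "'a \<Rightarrow> 'a \<Rightarrow> 'a \<Rightarrow> 'a \<Rightarrow> 'a \<Rightarrow> nat \<Rightarrow> 'a" where
  "five s w v x z \<equiv> (\<lambda>_. s)(0 := s, 1 := w, 2 := v, 3 := x, 4 := z)"

lemma typical_five_fails_bound:
  assumes "Q > 0" "p > 0" "r > 0" "a > 0" "N > 0" "h > 0"
  obtains K where "K \<ge> 0" "\<And>n. n > 0 \<Longrightarrow>
    (\<integral>\<^sup>+s. \<integral>\<^sup>+w. \<integral>\<^sup>+v. \<integral>\<^sup>+x. \<integral>\<^sup>+z. of_bool (\<not> typical 5 n h (five Q p r a N) (five s w v x z))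
      \<partial>gaussn n N \<partial>gaussn n a \<partial>gaussn n r \<partial>gaussn n p \<partial>gaussn n Q) \<le> ennreal (K / real n)"
proof
  define \<tau> where "\<tau> = five Q p r a N"
  have \<tau>: "\<tau> k > 0" for k using assms by (simp add: \<tau>_def)
  show "0 \<le> (\<Sum>k<5. \<Sum>l<5. 2 * \<tau> k * \<tau> l / h\<^sup>2)"
    using \<tau> by (intro sum_nonneg) (simp add: less_imp_le)
  fix n :: nat assume n: "n > 0"
  define M where "M k = gaussn n (\<tau> k)" for k
  have ps: "prob_space (M k)" for k unfolding M_def by (rule prob_space_gaussn[OF \<tau>])
  interpret Om: prob_space "PiM {..<5} M" by (rule prob_space_PiM) (rule ps)
  interpret M: prob_space "M k" for k by (rule ps)
  define f where "f q = (of_bool (\<not> typical 5 n h \<tau> q) :: ennreal)" for q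
  have comp' [measurable]: "(\<lambda>q. q k i) \<in> borel_measurable (PiM {..<5} M)" if "k < 5" "i < n" for k i
    using measurable_compose[OF measurable_component_singleton[of k "{..<5}" M]
        gaussn_measurable_component[of i n "\<tau> k", folded M_def]] that by simp
  have f [measurable]: "f \<in> borel_measurable (PiM {..<5} M)"
    unfolding f_def typical_def by measurable
  have g: "(\<lambda>q. \<integral>\<^sup>+v. \<integral>\<^sup>+x. \<integral>\<^sup>+z. f (q(2 := v, 3 := x, 4 := z)) \<partial>M 4 \<partial>M 3 \<partial>M 2) \<in> borel_measurable (PiM {..<5} M)"
    by measurable
  \<comment> \<open>Redrawing all five coordinates turns the product measure into iterated
    integrals; the integrand then forgets \<open>q\<close>.\<close>
  have "(\<integral>\<^sup>+q. f q \<partial>PiM {..<5} M) = (\<integral>\<^sup>+q. \<integral>\<^sup>+v. \<integral>\<^sup>+x. \<integral>\<^sup>+z. f (q(2 := v, 3 := x, 4 := z)) \<partial>M 4 \<partial>M 3 \<partial>M 2 \<partial>PiM {..<5} M)"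
    by (rule nn_integral_PiM_resample3[OF _ _ _ _ ps f]) simp_all
  also have "\<dots> = (\<integral>\<^sup>+q. \<integral>\<^sup>+s. \<integral>\<^sup>+w. \<integral>\<^sup>+v. \<integral>\<^sup>+x. \<integral>\<^sup>+z. f (q(0 := s, 1 := w, 2 := v, 3 := x, 4 := z)) \<partial>M 4 \<partial>M 3 \<partial>M 2 \<partial>M 1 \<partial>M 0 \<partial>PiM {..<5} M)"
    by (rule nn_integral_PiM_resample2[OF _ _ _ ps g]) simp_all
  also have "\<dots> = (\<integral>\<^sup>+q. \<integral>\<^sup>+s. \<integral>\<^sup>+w. \<integral>\<^sup>+v. \<integral>\<^sup>+x. \<integral>\<^sup>+z. f (five s w v x z) \<partial>M 4 \<partial>M 3 \<partial>M 2 \<partial>M 1 \<partial>M 0 \<partial>PiM {..<5} M)"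
  proof (intro nn_integral_cong)
    fix q s w v x z
    have "typical 5 n h \<tau> (q(0 := s, 1 := w, 2 := v, 3 := x, 4 := z)) = typical 5 n h \<tau> (five s w v x z)"
      by (rule typical_cong) auto
    then show "f (q(0 := s, 1 := w, 2 := v, 3 := x, 4 := z)) = f (five s w v x z)"
      by (simp only: f_def)
  qed
  also have "\<dots> = (\<integral>\<^sup>+s. \<integral>\<^sup>+w. \<integral>\<^sup>+v. \<integral>\<^sup>+x. \<integral>\<^sup>+z. f (five s w v x z) \<partial>M 4 \<partial>M 3 \<partial>M 2 \<partial>M 1 \<partial>M 0)"
    by (simp only: nn_integral_const Om.emeasure_space_1 mult_1_right)
  finally have "(\<integral>\<^sup>+q. f q \<partial>PiM {..<5} M) = (\<integral>\<^sup>+s. \<integral>\<^sup>+w. \<integral>\<^sup>+v. \<integral>\<^sup>+x. \<integral>\<^sup>+z. f (five s w v x z) \<partial>M 4 \<partial>M 3 \<partial>M 2 \<partial>M 1 \<partial>M 0)" .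
  moreover have "(\<integral>\<^sup>+q. f q \<partial>PiM {..<5} M) \<le> ennreal ((\<Sum>k<5. \<Sum>l<5. 2 * \<tau> k * \<tau> l / h\<^sup>2) / real n)"
    unfolding f_def M_def[abs_def] by (rule typical_fails_bound[OF \<tau> n assms(6)])
  moreover have "M 0 = gaussn n Q" "M 1 = gaussn n p" "M 2 = gaussn n r" "M 3 = gaussn n a" "M 4 = gaussn n N"
    by (simp_all add: M_def \<tau>_def)
  ultimately show "(\<integral>\<^sup>+s. \<integral>\<^sup>+w. \<integral>\<^sup>+v. \<integral>\<^sup>+x. \<integral>\<^sup>+z. of_bool (\<not> typical 5 n h (five Q p r a N) (five s w v x z))
      \<partial>gaussn n N \<partial>gaussn n a \<partial>gaussn n r \<partial>gaussn n p \<partial>gaussn n Q) \<le> ennreal ((\<Sum>k<5. \<Sum>l<5. 2 * \<tau> k * \<tau> l / h\<^sup>2) / real n)"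
    by (simp only: f_def \<tau>_def)
qed

section \<open>The Gaussian scheme\<close>

lemma sum_lessThan_5: "(\<Sum>k<(5::nat). f k) = f 0 + f 1 + f 2 + f 3 + (f 4 :: 'a :: comm_monoid_add)"
  by (simp add: eval_nat_numeral add.assoc)

lemma BN_component_measurable:
  "f \<in> measurable M (BN n) \<Longrightarrow> i < n \<Longrightarrow> (\<lambda>t. f t i) \<in> borel_measurable M"
  by (rule measurable_compose[OF _ measurable_component_singleton[of i "{..<n}" "\<lambda>_. borel"]]) simp_all

lemma typical_five_measurable:
  assumes "s \<in> measurable M (BN n)" "w \<in> measurable M (BN n)" "v \<in> measurable M (BN n)"
    "x \<in> measurable M (BN n)" "z \<in> measurable M (BN n)"
  shows "Measurable.pred M (\<lambda>t. typical 5 n h \<tau> (five (s t) (w t) (v t) (x t) (z t)))"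
proof -
  have [measurable (raw)]: "(\<lambda>t. five (s t) (w t) (v t) (x t) (z t) k i) \<in> borel_measurable M" if "i < n" for k i
    using assms[THEN BN_component_measurable, OF that]
    by (cases "k = 1"; cases "k = 2"; cases "k = 3"; cases "k = 4"; simp; cases "k = 0"; simp)
  show ?thesis unfolding typical_def by measurable
qed

text \<open>\<open>a\<close> and \<open>p\<close> are the variances of \<open>X\<close> and of
  \<open>W = U - \<alpha> S'\<close>; \<open>V\<close> has unit variance, with amplitude
  \<open>b1\<close> at the uninformed and \<open>b2\<close> at the informed encoder.
  \<open>\<kappa>\<close> multiplies the state in the informed input, \<open>d\<close> is the slack
  per letter in nats and \<open>h\<close> the typicality tolerance.\<close>

locale gaussian_scheme =
  fixes P1 P2 Q N a p b1 b2 \<kappa> \<alpha> d h :: real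
  assumes pos: "Q > 0" "N > 0" "a > 0" "p > 0" "d > 0" "h > 0"
begin

text \<open>
  With \<open>S' = k S\<close>, \<open>W\<close> of variance \<open>p\<close> and \<open>U = W + \<alpha> S'\<close>: \<open>Du\<close> is the variance of \<open>U\<close>, \<open>\<beta> U\<close> is the linear
  estimate of \<open>W + S'\<close> from \<open>U\<close>, and \<open>sg\<close> is the variance of \<open>W + S' + Z\<close> given \<open>U\<close>. The output
  \<open>c V + X + W + S' + Z\<close> has variance \<open>T1\<close> given \<open>(V, U)\<close>, \<open>T2\<close> given \<open>V\<close>, and \<open>T3\<close> unconditionally.
\<close>

definition k :: real where "k = 1 + \<kappa>"
definition Du :: real where "Du = p + \<alpha>\<^sup>2 * (k\<^sup>2 * Q)"
definition \<beta> :: real where "\<beta> = (p + \<alpha> * (k\<^sup>2 * Q)) / Du"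
definition sg :: real where "sg = N + p * (k\<^sup>2 * Q) * (1 - \<alpha>)\<^sup>2 / Du"
definition c :: real where "c = b1 + b2"
definition T1 :: real where "T1 = a + sg"
definition T2 :: real where "T2 = a + (p + k\<^sup>2 * Q + N)"
definition T3 :: real where "T3 = c\<^sup>2 + T2"

lemma Du_pos: "Du > 0" using pos by (simp add: Du_def add_pos_nonneg)
lemma sg_pos: "sg > 0" using pos Du_pos by (simp add: sg_def add_pos_nonneg)
lemma T_pos: "T1 > 0" "T2 > 0" "T3 > 0"
  using pos sg_pos by (simp_all add: T1_def T2_def T3_def add_nonneg_pos add_pos_nonneg)

text \<open>The variance of \<open>W + S' + Z\<close> splits orthogonally into that of the estimate
  \<open>\<beta> U\<close> and that of the residual. Hence averaging the decoding density over
  \<open>u\<close> restores the variance without knowledge of \<open>U\<close>.\<close>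

lemma backward_variance: "\<beta>\<^sup>2 * Du + sg = p + k\<^sup>2 * Q + N"
proof -
  define q where "q = k\<^sup>2 * Q"
  have "\<beta>\<^sup>2 * Du = (p + \<alpha> * q)\<^sup>2 / Du"
    using Du_pos by (simp add: \<beta>_def q_def power_divide power2_eq_square)
  then have "\<beta>\<^sup>2 * Du + sg = N + ((p + \<alpha> * q)\<^sup>2 + p * q * (1 - \<alpha>)\<^sup>2) / Du"
    by (simp add: sg_def q_def add_divide_distrib)
  also have "(p + \<alpha> * q)\<^sup>2 + p * q * (1 - \<alpha>)\<^sup>2 = (p + q) * Du"
    unfolding Du_def q_def[symmetric] by algebra
  finally show ?thesis using Du_pos by (simp add: q_def)
qed

text \<open>The coefficients are those of \<open>S\<close>, \<open>W\<close> and \<open>Z\<close> in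
  \<open>W + S' + Z - \<beta> U\<close>; in this form the residual is linear in independent
  sequences and typicality applies to it.\<close>

lemma residual_variance: "(k * (1 - \<beta> * \<alpha>))\<^sup>2 * Q + (1 - \<beta>)\<^sup>2 * p + N = sg"
proof -
  define q where "q = k\<^sup>2 * Q"
  have 1: "1 - \<beta> = \<alpha> * q * (\<alpha> - 1) / Du" "1 - \<beta> * \<alpha> = p * (1 - \<alpha>) / Du"
    using Du_pos by (simp_all add: \<beta>_def q_def field_simps) (simp_all add: Du_def algebra_simps power2_eq_square)
  have "(k * (1 - \<beta> * \<alpha>))\<^sup>2 * Q + (1 - \<beta>)\<^sup>2 * p = q * (1 - \<beta> * \<alpha>)\<^sup>2 + (1 - \<beta>)\<^sup>2 * p"
    by (simp add: q_def power_mult_distrib)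
  also have "\<dots> = (q * (p * (1 - \<alpha>))\<^sup>2 + (\<alpha> * q * (\<alpha> - 1))\<^sup>2 * p) / Du\<^sup>2"
    unfolding 1 by (simp add: power_divide add_divide_distrib)
  also have "q * (p * (1 - \<alpha>))\<^sup>2 + (\<alpha> * q * (\<alpha> - 1))\<^sup>2 * p = p * q * (1 - \<alpha>)\<^sup>2 * Du"
    unfolding Du_def q_def[symmetric] by algebra
  finally show ?thesis using Du_pos by (simp add: sg_def q_def power2_eq_square)
qed

text \<open>A codeword violating the power constraint is replaced by \<open>0\<close>.\<close>

definition x1 :: "nat \<Rightarrow> (nat \<Rightarrow> real) \<Rightarrow> (nat \<Rightarrow> real) \<Rightarrow> nat \<Rightarrow> real" where
  "x1 n v x i = (if (\<Sum>i<n. (b1 * v i + x i)\<^sup>2) \<le> real n * P1 then b1 * v i + x i else 0)"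

definition x2 :: "nat \<Rightarrow> (nat \<Rightarrow> real) \<Rightarrow> (nat \<Rightarrow> real) \<Rightarrow> (nat \<Rightarrow> real) \<Rightarrow> nat \<Rightarrow> real" where
  "x2 n v u s i = (if (\<Sum>i<n. (\<kappa> * s i + b2 * v i + (u i - \<alpha> * k * s i))\<^sup>2) \<le> real n * P2
     then \<kappa> * s i + b2 * v i + (u i - \<alpha> * k * s i) else 0)"

definition chan :: "nat \<Rightarrow> (nat \<Rightarrow> real) \<Rightarrow> (nat \<Rightarrow> real) \<Rightarrow> (nat \<Rightarrow> real) \<Rightarrow> (nat \<Rightarrow> real) \<Rightarrow> (nat \<Rightarrow> real) \<Rightarrow> nat \<Rightarrow> real" where
  "chan n v x u s z = (\<lambda>i\<in>{..<n}. x1 n v x i + x2 n v u s i + s i + z i)"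

text \<open>
  \<open>r0\<close> is the density of the conditional law of \<open>U\<close> given \<open>S\<close> with respect to the law of \<open>U\<close>; \<open>r1\<close>, \<open>r2\<close>, \<open>r3\<close> divide
  the law of the output given \<open>(V, X, U)\<close> by its law given \<open>(V, U)\<close>, given \<open>V\<close>, and unconditionally. The mean values of
  their logarithms per letter are \<open>I0\<close>, \<open>I1\<close>, \<open>I2\<close>, \<open>I3\<close> below, in nats.
\<close>

definition r0 :: "nat \<Rightarrow> (nat \<Rightarrow> real) \<Rightarrow> (nat \<Rightarrow> real) \<Rightarrow> real" where
  "r0 n s u = (\<Prod>i<n. phi p (u i - \<alpha> * k * s i) / phi Du (u i))"

definition r1 :: "nat \<Rightarrow> (nat \<Rightarrow> real) \<Rightarrow> (nat \<Rightarrow> real) \<Rightarrow> (nat \<Rightarrow> real) \<Rightarrow> (nat \<Rightarrow> real) \<Rightarrow> real" where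
  "r1 n v x u y = (\<Prod>i<n. phi sg (y i - c * v i - x i - \<beta> * u i) / phi T1 (y i - c * v i - \<beta> * u i))"

definition r2 :: "nat \<Rightarrow> (nat \<Rightarrow> real) \<Rightarrow> (nat \<Rightarrow> real) \<Rightarrow> (nat \<Rightarrow> real) \<Rightarrow> (nat \<Rightarrow> real) \<Rightarrow> real" where
  "r2 n v x u y = (\<Prod>i<n. phi sg (y i - c * v i - x i - \<beta> * u i) / phi T2 (y i - c * v i))"

definition r3 :: "nat \<Rightarrow> (nat \<Rightarrow> real) \<Rightarrow> (nat \<Rightarrow> real) \<Rightarrow> (nat \<Rightarrow> real) \<Rightarrow> (nat \<Rightarrow> real) \<Rightarrow> real" where
  "r3 n v x u y = (\<Prod>i<n. phi sg (y i - c * v i - x i - \<beta> * u i) / phi T3 (y i))"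

definition I0 :: real where "I0 = ln (Du / p) / 2"
definition I1 :: real where "I1 = ln (T1 / sg) / 2"
definition I2 :: real where "I2 = ln (T2 / sg) / 2"
definition I3 :: real where "I3 = ln (T3 / sg) / 2"

text \<open>Each threshold sits \<open>2 * d\<close> below the mean exponent. Typical sequences
  reach the mean less \<open>d\<close>, which leaves room for strict inequality.\<close>

definition dec :: "nat \<Rightarrow> (nat \<Rightarrow> real) \<Rightarrow> (nat \<Rightarrow> real) \<Rightarrow> (nat \<Rightarrow> real) \<Rightarrow> (nat \<Rightarrow> real) \<Rightarrow> bool" where
  "dec n v x u y \<longleftrightarrow> exp (real n * (I1 - 2 * d)) < r1 n v x u y \<and>
     exp (real n * (I2 - 2 * d)) < r2 n v x u y \<and> exp (real n * (I3 - 2 * d)) < r3 n v x u y"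

text \<open>The test on \<open>r0\<close> does not involve \<open>v\<close>, \<open>x\<close> or
  \<open>z\<close>; if it fails, the integral equals 1. A small value therefore certifies both
  decodability and the density bound that covering needs.\<close>

definition fail :: "nat \<Rightarrow> (nat \<Rightarrow> real) \<Rightarrow> (nat \<Rightarrow> real) \<Rightarrow> ennreal" where
  "fail n s u = (\<integral>\<^sup>+v. \<integral>\<^sup>+x. \<integral>\<^sup>+z. of_bool (\<not> (dec n v x u (chan n v x u s z) \<and> r0 n s u \<le> exp (real n * (I0 + d))))
     \<partial>gaussn n N \<partial>gaussn n a \<partial>gaussn n 1)"

lemma ratio_nonneg: "0 \<le> r0 n s u" "0 \<le> r1 n v x u y" "0 \<le> r2 n v x u y" "0 \<le> r3 n v x u y"
  by (simp_all add: r0_def r1_def r2_def r3_def prod_nonneg)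

section \<open>Measurability of the scheme\<close>

context
  fixes M :: "'m measure" and n :: nat and v x u s z y :: "'m \<Rightarrow> nat \<Rightarrow> real"
begin

lemma r0_measurable:
  assumes "s \<in> measurable M (BN n)" "u \<in> measurable M (BN n)"
  shows "(\<lambda>t. r0 n (s t) (u t)) \<in> borel_measurable M"
proof -
  note [measurable (raw)] = BN_component_measurable[OF assms(1)] BN_component_measurable[OF assms(2)]
  show ?thesis unfolding r0_def by measurable
qed

lemma chan_measurable:
  assumes "v \<in> measurable M (BN n)" "x \<in> measurable M (BN n)" "u \<in> measurable M (BN n)"
    "s \<in> measurable M (BN n)" "z \<in> measurable M (BN n)"
  shows "(\<lambda>t. chan n (v t) (x t) (u t) (s t) (z t)) \<in> measurable M (BN n)"
proof -
  note [measurable (raw)] = BN_component_measurable[OF assms(1)] BN_component_measurable[OF assms(2)]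
    BN_component_measurable[OF assms(3)] BN_component_measurable[OF assms(4)] BN_component_measurable[OF assms(5)]
  show ?thesis unfolding chan_def x1_def x2_def
    by (rule measurable_restrict) measurable
qed

lemma dec_measurable:
  assumes "v \<in> measurable M (BN n)" "x \<in> measurable M (BN n)" "u \<in> measurable M (BN n)" "y \<in> measurable M (BN n)"
  shows "Measurable.pred M (\<lambda>t. dec n (v t) (x t) (u t) (y t))"
proof -
  note [measurable (raw)] = BN_component_measurable[OF assms(1)] BN_component_measurable[OF assms(2)]
    BN_component_measurable[OF assms(3)] BN_component_measurable[OF assms(4)]
  show ?thesis unfolding dec_def r1_def r2_def r3_def by measurable
qed

end

lemma fail_measurable:
  "(\<lambda>t. fail n (fst t) (snd t)) \<in> borel_measurable (BN n \<Otimes>\<^sub>M BN n)"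
proof -
  note sf = prob_space_imp_sigma_finite[OF prob_space_gaussn]
  interpret Z: sigma_finite_measure "gaussn n N" by (rule sf) (rule pos)
  interpret X: sigma_finite_measure "gaussn n a" by (rule sf) (rule pos)
  interpret V: sigma_finite_measure "gaussn n 1" by (rule sf) simp
  note [measurable (raw)] = r0_measurable dec_measurable chan_measurable
  show ?thesis unfolding fail_def by measurable
qed

text \<open>Averaging over \<open>x\<close> raises the variance \<open>sg\<close> in the numerator
  of \<open>r1\<close> to \<open>T1\<close>, the one in its denominator.\<close>

lemma dec_individual_bound:
  "(\<integral>\<^sup>+x. of_bool (dec n v x u y) \<partial>gaussn n a) \<le> ennreal (1 / exp (real n * (I1 - 2 * d)))"
proof -
  let ?g = "exp (real n * (I1 - 2 * d))"
  have "(\<integral>\<^sup>+x. of_bool (dec n v x u y) \<partial>gaussn n a) \<le> (\<integral>\<^sup>+x. ennreal (1 / ?g) * ennreal (r1 n v x u y) \<partial>gaussn n a)"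
  proof (rule nn_integral_mono)
    fix x
    have "(of_bool (dec n v x u y) :: ennreal) \<le> of_bool (r1 n v x u y > ?g)" by (simp add: dec_def)
    also have "\<dots> \<le> ennreal (1 / ?g) * ennreal (r1 n v x u y)" by (rule of_bool_greater_le) (simp_all add: ratio_nonneg)
    finally show "of_bool (dec n v x u y) \<le> ennreal (1 / ?g) * ennreal (r1 n v x u y)" .
  qed
  also have "\<dots> = ennreal (1 / ?g) * (\<integral>\<^sup>+x. ennreal (r1 n v x u y) \<partial>gaussn n a)"
    unfolding r1_def by (rule nn_integral_cmult) measurable
  also have "(\<integral>\<^sup>+x. ennreal (r1 n v x u y) \<partial>gaussn n a) =
      (\<integral>\<^sup>+x. ennreal (\<Prod>i<n. phi sg ((y i - c * v i - \<beta> * u i) - 1 * x i) / phi T1 (y i - c * v i - \<beta> * u i)) \<partial>gaussn n a)"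
    unfolding r1_def by (simp add: algebra_simps)
  also have "\<dots> = ennreal (\<Prod>i<n. phi (1\<^sup>2 * a + sg) (y i - c * v i - \<beta> * u i) / phi T1 (y i - c * v i - \<beta> * u i))"
    using pos sg_pos T_pos by (intro nn_integral_gaussn_phi_prod) (simp_all add: normal_density_pos)
  also have "\<dots> = 1"
    using T_pos normal_density_pos[of "sqrt T1" 0] by (simp add: T1_def[symmetric] less_imp_neq[symmetric])
  finally show ?thesis by simp
qed

text \<open>Averaging over \<open>u\<close> raises the variance from \<open>sg\<close> to that of
  \<open>W + S' + Z\<close>, and averaging over \<open>x\<close> then to \<open>T2\<close>.
  Arbitrary denominators let one computation serve \<open>r2\<close>, where everything cancels, and
  \<open>r3\<close>, where \<open>v\<close> is still to be averaged.\<close>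

lemma integral_xu_ratio:
  assumes w: "\<And>i. i < n \<Longrightarrow> 0 < w i"
  shows "(\<integral>\<^sup>+x. \<integral>\<^sup>+u. C * ennreal (\<Prod>i<n. phi sg (y i - c * v i - x i - \<beta> * u i) / w i) \<partial>gaussn n Du \<partial>gaussn n a)
    = C * ennreal (\<Prod>i<n. phi T2 (y i - c * v i) / w i)"
proof -
  have "(\<integral>\<^sup>+u. C * ennreal (\<Prod>i<n. phi sg (y i - c * v i - x i - \<beta> * u i) / w i) \<partial>gaussn n Du)
      = C * ennreal (\<Prod>i<n. phi (p + k\<^sup>2 * Q + N) ((y i - c * v i) - 1 * x i) / w i)" for x
    using nn_integral_gaussn_phi_prod[of Du sg n w "\<lambda>i. y i - c * v i - x i" \<beta>] sg_pos Du_pos w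
    by (subst nn_integral_cmult) (simp_all add: backward_variance)
  moreover have "(\<integral>\<^sup>+x. C * ennreal (\<Prod>i<n. phi (p + k\<^sup>2 * Q + N) ((y i - c * v i) - 1 * x i) / w i) \<partial>gaussn n a)
      = C * ennreal (\<Prod>i<n. phi (1\<^sup>2 * a + (p + k\<^sup>2 * Q + N)) (y i - c * v i) / w i)"
    using pos w by (subst nn_integral_cmult, measurable, subst nn_integral_gaussn_phi_prod) (auto simp: add_pos_nonneg)
  ultimately show ?thesis by (simp add: T2_def)
qed

lemma dec_individual_index_bound:
  "(\<integral>\<^sup>+x. \<integral>\<^sup>+u. of_bool (dec n v x u y) \<partial>gaussn n Du \<partial>gaussn n a) \<le> ennreal (1 / exp (real n * (I2 - 2 * d)))"
proof -
  let ?g = "exp (real n * (I2 - 2 * d))"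
  have "(\<integral>\<^sup>+x. \<integral>\<^sup>+u. of_bool (dec n v x u y) \<partial>gaussn n Du \<partial>gaussn n a)
      \<le> (\<integral>\<^sup>+x. \<integral>\<^sup>+u. ennreal (1 / ?g) * ennreal (r2 n v x u y) \<partial>gaussn n Du \<partial>gaussn n a)"
  proof (intro nn_integral_mono)
    fix x u
    have "(of_bool (dec n v x u y) :: ennreal) \<le> of_bool (r2 n v x u y > ?g)" by (simp add: dec_def)
    also have "\<dots> \<le> ennreal (1 / ?g) * ennreal (r2 n v x u y)" by (rule of_bool_greater_le) (simp_all add: ratio_nonneg)
    finally show "of_bool (dec n v x u y) \<le> ennreal (1 / ?g) * ennreal (r2 n v x u y)" .
  qed
  also have "\<dots> = ennreal (1 / ?g) * 1"
  proof -
    have pos2: "phi T2 t > 0" for t using T_pos by (simp add: normal_density_pos)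
    then have "(\<Prod>i<n. phi T2 (y i - c * v i) / phi T2 (y i - c * v i)) = 1" by (simp add: less_imp_neq[symmetric])
    with pos2 show ?thesis
      unfolding r2_def using integral_xu_ratio[of n "\<lambda>i. phi T2 (y i - c * v i)" "ennreal (1 / ?g)" y v] by simp
  qed
  finally show ?thesis by simp
qed

lemma dec_common_bound:
  "(\<integral>\<^sup>+v. \<integral>\<^sup>+x. \<integral>\<^sup>+u. of_bool (dec n v x u y) \<partial>gaussn n Du \<partial>gaussn n a \<partial>gaussn n 1) \<le> ennreal (1 / exp (real n * (I3 - 2 * d)))"
proof -
  let ?g = "exp (real n * (I3 - 2 * d))"
  have pos3: "phi T3 t > 0" for t using T_pos by (simp add: normal_density_pos)
  have "(\<integral>\<^sup>+v. \<integral>\<^sup>+x. \<integral>\<^sup>+u. of_bool (dec n v x u y) \<partial>gaussn n Du \<partial>gaussn n a \<partial>gaussn n 1)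
      \<le> (\<integral>\<^sup>+v. \<integral>\<^sup>+x. \<integral>\<^sup>+u. ennreal (1 / ?g) * ennreal (r3 n v x u y) \<partial>gaussn n Du \<partial>gaussn n a \<partial>gaussn n 1)"
  proof (intro nn_integral_mono)
    fix v x u
    have "(of_bool (dec n v x u y) :: ennreal) \<le> of_bool (r3 n v x u y > ?g)" by (simp add: dec_def)
    also have "\<dots> \<le> ennreal (1 / ?g) * ennreal (r3 n v x u y)" by (rule of_bool_greater_le) (simp_all add: ratio_nonneg)
    finally show "of_bool (dec n v x u y) \<le> ennreal (1 / ?g) * ennreal (r3 n v x u y)" .
  qed
  also have "\<dots> = (\<integral>\<^sup>+v. ennreal (1 / ?g) * ennreal (\<Prod>i<n. phi T2 (y i - c * v i) / phi T3 (y i)) \<partial>gaussn n 1)"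
    unfolding r3_def using pos3 by (subst integral_xu_ratio) simp_all
  also have "\<dots> = ennreal (1 / ?g) * ennreal (\<Prod>i<n. phi (c\<^sup>2 * 1 + T2) (y i) / phi T3 (y i))"
    using T_pos pos3 by (subst nn_integral_cmult, measurable, subst nn_integral_gaussn_phi_prod) auto
  also have "(\<Prod>i<n. phi (c\<^sup>2 * 1 + T2) (y i) / phi T3 (y i)) = 1"
    using pos3 by (simp add: T3_def[symmetric] less_imp_neq[symmetric])
  finally show ?thesis by simp
qed

lemma typical_five_form:
  assumes "typical 5 n h (five Q p 1 a N) (five s w v x z)"
    and "h * (\<bar>c0\<bar> + \<bar>c1\<bar> + \<bar>c2\<bar> + \<bar>c3\<bar> + \<bar>c4\<bar>)\<^sup>2 \<le> B"
    and "c0\<^sup>2 * Q + c1\<^sup>2 * p + c2\<^sup>2 + c3\<^sup>2 * a + c4\<^sup>2 * N = V"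
    and "\<And>i. i < n \<Longrightarrow> f i = c0 * s i + c1 * w i + c2 * v i + c3 * x i + c4 * z i"
  shows "\<bar>(\<Sum>i<n. (f i)\<^sup>2) - real n * V\<bar> \<le> real n * B"
proof -
  have "(\<Sum>i<n. (f i)\<^sup>2) = (\<Sum>i<n. (\<Sum>k<5. five c0 c1 c2 c3 c4 k * five s w v x z k i)\<^sup>2)"
    by (intro sum.cong refl) (simp add: assms(4) sum_lessThan_5)
  moreover have "V = (\<Sum>k<5. (five c0 c1 c2 c3 c4 k)\<^sup>2 * five Q p 1 a N k)"
    using assms(3) by (simp add: sum_lessThan_5)
  moreover have "(\<Sum>k<5. \<bar>five c0 c1 c2 c3 c4 k\<bar>) = \<bar>c0\<bar> + \<bar>c1\<bar> + \<bar>c2\<bar> + \<bar>c3\<bar> + \<bar>c4\<bar>"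
    by (simp add: sum_lessThan_5)
  ultimately have "\<bar>(\<Sum>i<n. (f i)\<^sup>2) - real n * V\<bar> \<le> real n * (h * (\<bar>c0\<bar> + \<bar>c1\<bar> + \<bar>c2\<bar> + \<bar>c3\<bar> + \<bar>c4\<bar>)\<^sup>2)"
    using typical_linear_form[OF assms(1), of "five c0 c1 c2 c3 c4"] by simp
  also have "\<dots> \<le> real n * B" using assms(2) by (intro mult_left_mono) auto
  finally show ?thesis .
qed

end

locale gaussian_scheme_slack = gaussian_scheme +
  assumes power1_slack: "h * (\<bar>b1\<bar> + 1)\<^sup>2 \<le> P1 - (b1\<^sup>2 + a)"
    and power2_slack: "h * (\<bar>\<kappa>\<bar> + 1 + \<bar>b2\<bar>)\<^sup>2 \<le> P2 - (\<kappa>\<^sup>2 * Q + p + b2\<^sup>2)"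
    and w_slack: "h \<le> p * d"
    and u_slack: "h * (\<bar>\<alpha> * k\<bar> + 1)\<^sup>2 \<le> Du * d"
    and e_slack: "h * (\<bar>k * (1 - \<beta> * \<alpha>)\<bar> + \<bar>1 - \<beta>\<bar> + 1)\<^sup>2 \<le> sg * d"
    and xe_slack: "h * (\<bar>k * (1 - \<beta> * \<alpha>)\<bar> + \<bar>1 - \<beta>\<bar> + 1 + 1)\<^sup>2 \<le> T1 * d"
    and yv_slack: "h * (\<bar>k\<bar> + 1 + 1 + 1)\<^sup>2 \<le> T2 * d"
    and y_slack: "h * (\<bar>k\<bar> + 1 + \<bar>c\<bar> + 1 + 1)\<^sup>2 \<le> T3 * d"
begin

lemma typical_imp_success:
  assumes n: "n > 0" and ty: "typical 5 n h (five Q p 1 a N) (five s w v x z)"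
  defines "u \<equiv> \<lambda>i\<in>{..<n}. w i + \<alpha> * k * s i"
  shows "dec n v x u (chan n v x u s z)" "r0 n s u \<le> exp (real n * (I0 + d))"
proof -
  note form = typical_five_form[OF ty]
  have u: "u i = w i + \<alpha> * k * s i" if "i < n" for i using that by (simp add: u_def)
  have "\<bar>(\<Sum>i<n. (b1 * v i + x i)\<^sup>2) - real n * (b1\<^sup>2 + a)\<bar> \<le> real n * (P1 - (b1\<^sup>2 + a))"
    by (rule form[of 0 0 b1 1 0]) (use power1_slack in auto)
  then have pw1: "(\<Sum>i<n. (b1 * v i + x i)\<^sup>2) \<le> real n * P1"
    by (simp add: algebra_simps abs_le_iff)
  have "\<bar>(\<Sum>i<n. (\<kappa> * s i + b2 * v i + (u i - \<alpha> * k * s i))\<^sup>2) - real n * (\<kappa>\<^sup>2 * Q + p + b2\<^sup>2)\<bar> \<le> real n * (P2 - (\<kappa>\<^sup>2 * Q + p + b2\<^sup>2))"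
    by (rule form[of \<kappa> 1 b2 0 0]) (use power2_slack u in auto)
  then have pw2: "(\<Sum>i<n. (\<kappa> * s i + b2 * v i + (u i - \<alpha> * k * s i))\<^sup>2) \<le> real n * P2"
    by (simp add: algebra_simps abs_le_iff)
  define y where "y = chan n v x u s z"
  \<comment> \<open>On a typical block both power checks pass, so no codeword is replaced by 0 and
    the output is linear in the five sequences.\<close>
  have y: "y i = k * s i + w i + c * v i + x i + z i" if "i < n" for i
    using that pw1 pw2 u[OF that] by (simp add: y_def chan_def x1_def x2_def k_def c_def algebra_simps)
  have fw: "\<bar>(\<Sum>i<n. (u i - \<alpha> * k * s i)\<^sup>2) - real n * p\<bar> \<le> real n * (p * d)"
    by (rule form[of 0 1 0 0 0]) (use w_slack u in auto)
  have fu: "\<bar>(\<Sum>i<n. (u i)\<^sup>2) - real n * Du\<bar> \<le> real n * (Du * d)"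
    by (rule form[of "\<alpha> * k" 1 0 0 0]) (use u_slack u in \<open>auto simp: Du_def power_mult_distrib\<close>)
  have fe: "\<bar>(\<Sum>i<n. (y i - c * v i - x i - \<beta> * u i)\<^sup>2) - real n * sg\<bar> \<le> real n * (sg * d)"
    by (rule form[of "k * (1 - \<beta> * \<alpha>)" "1 - \<beta>" 0 0 1]) (use e_slack u y residual_variance in \<open>auto simp: algebra_simps\<close>)
  have fxe: "\<bar>(\<Sum>i<n. (y i - c * v i - \<beta> * u i)\<^sup>2) - real n * T1\<bar> \<le> real n * (T1 * d)"
    by (rule form[of "k * (1 - \<beta> * \<alpha>)" "1 - \<beta>" 0 1 1]) (use xe_slack u y residual_variance in \<open>auto simp: T1_def algebra_simps\<close>)
  have fyv: "\<bar>(\<Sum>i<n. (y i - c * v i)\<^sup>2) - real n * T2\<bar> \<le> real n * (T2 * d)"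
    by (rule form[of k 1 0 1 1]) (use yv_slack y in \<open>auto simp: T2_def\<close>)
  have fy: "\<bar>(\<Sum>i<n. (y i)\<^sup>2) - real n * T3\<bar> \<le> real n * (T3 * d)"
    by (rule form[of k 1 c 1 1]) (use y_slack y in \<open>auto simp: T2_def T3_def\<close>)
  have lt: "exp (real n * (I - 2 * d)) < exp (real n * (I - d))" for I
    using n pos by simp
  have "exp (real n * (I1 - d)) \<le> r1 n v x u y"
    unfolding I1_def r1_def by (rule phi_ratio_prod_bounds(1)[OF sg_pos T_pos(1) fe fxe])
  moreover have "exp (real n * (I2 - d)) \<le> r2 n v x u y"
    unfolding I2_def r2_def by (rule phi_ratio_prod_bounds(1)[OF sg_pos T_pos(2) fe fyv])
  moreover have "exp (real n * (I3 - d)) \<le> r3 n v x u y"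
    unfolding I3_def r3_def by (rule phi_ratio_prod_bounds(1)[OF sg_pos T_pos(3) fe fy])
  ultimately show "dec n v x u (chan n v x u s z)"
    unfolding dec_def y_def[symmetric] using lt by (blast intro: less_le_trans)
  show "r0 n s u \<le> exp (real n * (I0 + d))"
    unfolding I0_def r0_def by (rule phi_ratio_prod_bounds(2)[OF pos(4) Du_pos fw fu])
qed

text \<open>The threshold tends to 0, yet dividing the failure rate \<open>K / n\<close> by it still
  leaves a vanishing bound. Adding 2 keeps it below 1 for every \<open>n\<close>, including 0, so
  that \<open>fail = 1\<close> is never good.\<close>

definition good :: "nat \<Rightarrow> (nat \<Rightarrow> real) \<Rightarrow> (nat \<Rightarrow> real) \<Rightarrow> bool" where
  "good n s u \<longleftrightarrow> fail n s u \<le> ennreal (1 / sqrt (real n + 2))"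

lemma good_bad_bound:
  assumes "good n s u"
  shows "(\<integral>\<^sup>+v. \<integral>\<^sup>+x. \<integral>\<^sup>+z. of_bool (\<not> dec n v x u (chan n v x u s z)) \<partial>gaussn n N \<partial>gaussn n a \<partial>gaussn n 1)
    \<le> ennreal (1 / sqrt (real n + 2))"
proof -
  have "(\<integral>\<^sup>+v. \<integral>\<^sup>+x. \<integral>\<^sup>+z. of_bool (\<not> dec n v x u (chan n v x u s z)) \<partial>gaussn n N \<partial>gaussn n a \<partial>gaussn n 1) \<le> fail n s u"
    unfolding fail_def by (intro nn_integral_mono) simp
  then show ?thesis using assms by (simp add: good_def)
qed

text \<open>Otherwise the integrand of \<open>fail\<close> is constantly 1, and its integral lies
  above the threshold.\<close>

lemma good_imp_r0_le:
  assumes "good n s u"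
  shows "r0 n s u \<le> exp (real n * (I0 + d))"
proof (rule ccontr)
  assume "\<not> ?thesis"
  then have "fail n s u = 1"
    unfolding fail_def using pos by (simp add: prob_space.emeasure_space_1[OF prob_space_gaussn])
  with assms have "1 \<le> 1 / sqrt (real n + 2)"
    by (simp add: good_def ennreal_1[symmetric] ennreal_le_iff del: ennreal_1)
  moreover have "sqrt (real n + 2) > 1" by simp
  ultimately show False by (simp add: field_simps)
qed

lemma good_measurable: "Measurable.pred (gaussn n Q \<Otimes>\<^sub>M gaussn n Du) (\<lambda>(s, u). good n s u)"
proof -
  have "measurable (gaussn n Q \<Otimes>\<^sub>M gaussn n Du) borel = measurable (BN n \<Otimes>\<^sub>M BN n) (borel :: ennreal measure)"
    by (intro measurable_cong_sets sets_pair_measure_cong sets_gaussn refl)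
  then have "(\<lambda>t. fail n (fst t) (snd t)) \<in> borel_measurable (gaussn n Q \<Otimes>\<^sub>M gaussn n Du)"
    using fail_measurable by simp
  then show ?thesis unfolding good_def case_prod_unfold by measurable
qed

lemma not_good_le: "(of_bool (\<not> good n s u) :: ennreal) \<le> ennreal (sqrt (real n + 2)) * fail n s u"
proof (cases "good n s u")
  case False
  have "1 = ennreal (sqrt (real n + 2)) * ennreal (1 / sqrt (real n + 2))"
    by (subst ennreal_mult[symmetric]) simp_all
  also have "\<dots> \<le> ennreal (sqrt (real n + 2)) * fail n s u"
    using False by (intro mult_left_mono) (simp_all add: good_def)
  finally show ?thesis using False by simp
qed simp

text \<open>Weighted by \<open>r0\<close>, a blind \<open>u\<close> becomes
  \<open>w + \<alpha> k s\<close> with \<open>w\<close> independent of \<open>s\<close>, so the mass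
  outside \<open>good\<close> is controlled by the atypicality of five independent vectors; Markov's
  inequality costs the factor \<open>sqrt (n + 2)\<close>.\<close>

lemma cover_bound:
  assumes n: "n > 0"
    and K: "K \<ge> 0" "(\<integral>\<^sup>+s. \<integral>\<^sup>+w. \<integral>\<^sup>+v. \<integral>\<^sup>+x. \<integral>\<^sup>+z. of_bool (\<not> typical 5 n h (five Q p 1 a N) (five s w v x z))
      \<partial>gaussn n N \<partial>gaussn n a \<partial>gaussn n 1 \<partial>gaussn n p \<partial>gaussn n Q) \<le> ennreal (K / real n)"
  shows "(\<integral>\<^sup>+s. (\<integral>\<^sup>+u. of_bool (\<not> good n s u) \<partial>gaussn n Du) ^ M \<partial>gaussn n Q)
    \<le> ennreal (sqrt (real n + 2) * (K / real n)) + ennreal (exp (- (real M / exp (real n * (I0 + d)))))"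
proof (rule covering_bound[where r = "r0 n"])
  define C where "C = ennreal (sqrt (real n + 2))"
  define f where "f s w = (\<integral>\<^sup>+v. \<integral>\<^sup>+x. \<integral>\<^sup>+z. of_bool (\<not> typical 5 n h (five Q p 1 a N) (five s w v x z))
      \<partial>gaussn n N \<partial>gaussn n a \<partial>gaussn n 1)" for s w
  note sf = prob_space_imp_sigma_finite[OF prob_space_gaussn]
  interpret Z: sigma_finite_measure "gaussn n N" by (rule sf) (rule pos)
  interpret X: sigma_finite_measure "gaussn n a" by (rule sf) (rule pos)
  interpret V: sigma_finite_measure "gaussn n 1" by (rule sf) simp
  interpret W: sigma_finite_measure "gaussn n p" by (rule sf) (rule pos)
  have mf [measurable]: "(\<lambda>(s, w). f s w) \<in> borel_measurable (gaussn n Q \<Otimes>\<^sub>M gaussn n p)"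
  proof -
    note [measurable (raw)] = typical_five_measurable
    show ?thesis unfolding f_def by measurable
  qed
  have mf1: "f s \<in> borel_measurable (gaussn n p)" if "s \<in> space (gaussn n Q)" for s
    using measurable_compose[OF measurable_Pair1'[OF that] mf] by simp
  have shift: "(\<integral>\<^sup>+u. ennreal (r0 n s u) * (C * fail n s u) \<partial>gaussn n Du) \<le> C * (\<integral>\<^sup>+w. f s w \<partial>gaussn n p)"
    if s: "s \<in> space (gaussn n Q)" for s
  proof -
    have "(\<lambda>u. fail n s u) \<in> borel_measurable (BN n)"
      using measurable_compose[OF measurable_Pair1' fail_measurable, of s n] s by (simp add: space_gaussn)
    then have "(\<lambda>u. C * fail n s u) \<in> borel_measurable (BN n)" by measurable
    from gaussn_shift_density[OF pos(4) Du_pos this, of "\<lambda>i. \<alpha> * k * s i"]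
    have "(\<integral>\<^sup>+u. ennreal (r0 n s u) * (C * fail n s u) \<partial>gaussn n Du) =
      (\<integral>\<^sup>+w. C * fail n s (\<lambda>i\<in>{..<n}. w i + \<alpha> * k * s i) \<partial>gaussn n p)"
      unfolding r0_def .
    also have "\<dots> \<le> (\<integral>\<^sup>+w. C * f s w \<partial>gaussn n p)"
      unfolding fail_def f_def
    proof (intro nn_integral_mono mult_left_mono)
      fix w v x z
      show "(of_bool (\<not> (dec n v x (\<lambda>i\<in>{..<n}. w i + \<alpha> * k * s i) (chan n v x (\<lambda>i\<in>{..<n}. w i + \<alpha> * k * s i) s z)
         \<and> r0 n s (\<lambda>i\<in>{..<n}. w i + \<alpha> * k * s i) \<le> exp (real n * (I0 + d)))) :: ennreal)
        \<le> of_bool (\<not> typical 5 n h (five Q p 1 a N) (five s w v x z))"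
        using typical_imp_success[OF n, of s w v x z] by (cases "typical 5 n h (five Q p 1 a N) (five s w v x z)") simp_all
    qed simp
    also have "\<dots> = C * (\<integral>\<^sup>+w. f s w \<partial>gaussn n p)"
      by (rule nn_integral_cmult[OF mf1[OF s]])
    finally show ?thesis .
  qed
  have "(\<integral>\<^sup>+s. \<integral>\<^sup>+u. ennreal (r0 n s u) * of_bool (\<not> good n s u) \<partial>gaussn n Du \<partial>gaussn n Q)
     \<le> (\<integral>\<^sup>+s. \<integral>\<^sup>+u. ennreal (r0 n s u) * (C * fail n s u) \<partial>gaussn n Du \<partial>gaussn n Q)"
    unfolding C_def by (intro nn_integral_mono mult_left_mono not_good_le) simp
  also have "\<dots> \<le> (\<integral>\<^sup>+s. C * (\<integral>\<^sup>+w. f s w \<partial>gaussn n p) \<partial>gaussn n Q)"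
    by (intro nn_integral_mono shift)
  also have "\<dots> = C * (\<integral>\<^sup>+s. \<integral>\<^sup>+w. f s w \<partial>gaussn n p \<partial>gaussn n Q)"
    by (rule nn_integral_cmult) measurable
  also have "\<dots> \<le> C * ennreal (K / real n)"
    using K(2) unfolding f_def by (intro mult_left_mono) simp_all
  also have "\<dots> = ennreal (sqrt (real n + 2) * (K / real n))"
    using K(1) unfolding C_def by (subst ennreal_mult) simp_all
  finally show "(\<integral>\<^sup>+s. \<integral>\<^sup>+u. ennreal (r0 n s u) * of_bool (\<not> good n s u) \<partial>gaussn n Du \<partial>gaussn n Q)
     \<le> ennreal (sqrt (real n + 2) * (K / real n))" .
  show "(\<integral>\<^sup>+u. ennreal (r0 n s u) \<partial>gaussn n Du) = 1" for s
    using gaussn_shift_density[OF pos(4) Du_pos, of "\<lambda>_. 1" n "\<lambda>i. \<alpha> * k * s i"]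
    by (simp add: r0_def prob_space.emeasure_space_1[OF prob_space_gaussn] pos)
  show "(\<lambda>(s, u). r0 n s u) \<in> borel_measurable (gaussn n Q \<Otimes>\<^sub>M gaussn n Du)"
    unfolding case_prod_unfold by (rule r0_measurable) measurable
qed (use pos Du_pos in \<open>simp_all add: prob_space_gaussn good_imp_r0_le ratio_nonneg good_measurable\<close>)

section \<open>Extraction of a valid code\<close>

lemma powers_pos: "P1 > 0" "P2 > 0"
proof -
  have "0 \<le> h * (\<bar>b1\<bar> + 1)\<^sup>2" "0 \<le> h * (\<bar>\<kappa>\<bar> + 1 + \<bar>b2\<bar>)\<^sup>2" "0 \<le> b1\<^sup>2" "0 \<le> \<kappa>\<^sup>2 * Q" "0 \<le> b2\<^sup>2"
    using pos by simp_all
  then show "P1 > 0" "P2 > 0" using power1_slack power2_slack pos by linarith+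
qed

lemma x1_power: "(\<Sum>i<n. (x1 n v x i)\<^sup>2) \<le> real n * P1"
  using powers_pos by (cases "(\<Sum>i<n. (b1 * v i + x i)\<^sup>2) \<le> real n * P1") (simp_all add: x1_def)

lemma x2_power: "(\<Sum>i<n. (x2 n v u s i)\<^sup>2) \<le> real n * P2"
  using powers_pos by (cases "(\<Sum>i<n. (\<kappa> * s i + b2 * v i + (u i - \<alpha> * k * s i))\<^sup>2) \<le> real n * P2") (simp_all add: x2_def)

lemma code_exists:
  assumes n: "n > 0" and M: "Mc > 0" "M1 > 0" "MJ > 0"
    and K: "K \<ge> 0" "(\<integral>\<^sup>+s. \<integral>\<^sup>+w. \<integral>\<^sup>+v. \<integral>\<^sup>+x. \<integral>\<^sup>+z. of_bool (\<not> typical 5 n h (five Q p 1 a N) (five s w v x z))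
      \<partial>gaussn n N \<partial>gaussn n a \<partial>gaussn n 1 \<partial>gaussn n p \<partial>gaussn n Q) \<le> ennreal (K / real n)"
  shows "\<exists>f1 f2 g. valid_code n Mc M1 P1 P2 Q N f1 f2 g \<and> err_prob n Mc M1 Q N f1 f2 g \<le>
    sqrt (real n + 2) * (K / real n) + exp (- (real MJ / exp (real n * (I0 + d)))) + 1 / sqrt (real n + 2) +
    (real M1 * (1 / exp (real n * (I1 - 2 * d))) + real (M1 * MJ) * (1 / exp (real n * (I2 - 2 * d)))
     + real (Mc * M1 * MJ) * (1 / exp (real n * (I3 - 2 * d))))" (is "\<exists>f1 f2 g. _ \<and> _ \<le> ?B")
proof -
  define W where "W = gaussn n Q \<Otimes>\<^sub>M gaussn n N"
  have W: "state_noise_measure n Q N = W"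
    by (simp add: state_noise_measure_def W_def gaussn_def gauss_def)
  interpret S: prob_space "gaussn n Q" by (rule prob_space_gaussn[OF pos(1)])
  interpret Z: prob_space "gaussn n N" by (rule prob_space_gaussn[OF pos(2)])
  interpret V: prob_space "gaussn n 1" by (rule prob_space_gaussn) simp
  interpret X: prob_space "gaussn n a" by (rule prob_space_gaussn[OF pos(3)])
  interpret U: prob_space "gaussn n Du" by (rule prob_space_gaussn[OF Du_pos])
  interpret SZ: pair_prob_space "gaussn n Q" "gaussn n N" by standard
  interpret RC: random_code "gaussn n Q" "gaussn n N" "gaussn n 1" "gaussn n a" "gaussn n Du" "BN n" "chan n" "dec n" "good n" Mc M1 MJ
  proof
    show "(\<lambda>(v, x, u, s, z). chan n v x u s z) \<in> measurable (gaussn n 1 \<Otimes>\<^sub>M gaussn n a \<Otimes>\<^sub>M gaussn n Du \<Otimes>\<^sub>M gaussn n Q \<Otimes>\<^sub>M gaussn n N) (BN n)"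
      unfolding case_prod_unfold by (rule chan_measurable) measurable
    show "(\<lambda>(v, x, u, y). dec n v x u y) \<in> measurable (gaussn n 1 \<Otimes>\<^sub>M gaussn n a \<Otimes>\<^sub>M gaussn n Du \<Otimes>\<^sub>M BN n) (count_space UNIV)"
      unfolding case_prod_unfold by (rule dec_measurable) measurable
  qed (use M good_measurable in auto)
  define e where "e a b w = {t \<in> space W. \<not> RC.decoded w a b (RC.out any_index w a b (fst t) (snd t))}" for a b w
  obtain w where w: "w \<in> space RC.CB" and le:
    "(\<Sum>a<Mc. \<Sum>b<M1. emeasure W (e a b w)) \<le> of_nat (Mc * M1) *
      (ennreal (sqrt (real n + 2) * (K / real n)) + ennreal (exp (- (real MJ / exp (real n * (I0 + d))))) + ennreal (1 / sqrt (real n + 2)) +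
       (of_nat M1 * ennreal (1 / exp (real n * (I1 - 2 * d))) + of_nat (M1 * MJ) * ennreal (1 / exp (real n * (I2 - 2 * d)))
        + of_nat (Mc * M1 * MJ) * ennreal (1 / exp (real n * (I3 - 2 * d)))))"
    unfolding W_def e_def
    by (rule RC.exists_codebook[OF good_bad_bound cover_bound[OF n K] dec_individual_bound dec_individual_index_bound dec_common_bound])
  have e_sets: "e a b w \<in> sets W" if "a < Mc" "b < M1" for a b
    unfolding e_def W_def
    by (unfold pred_def[symmetric], intro pred_intros_logic RC.decoded_measurable RC.out_measurable measurable_const w that) measurable
  have total: "(\<Sum>a<Mc. \<Sum>b<M1. measure W (e a b w)) \<le> real (Mc * M1) * ?B"
  proof -
    have "(\<Sum>a<Mc. \<Sum>b<M1. emeasure W (e a b w)) = ennreal (\<Sum>a<Mc. \<Sum>b<M1. measure W (e a b w))"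
      unfolding W_def by (simp add: SZ.P.emeasure_eq_measure sum_nonneg)
    moreover have "of_nat (Mc * M1) *
      (ennreal (sqrt (real n + 2) * (K / real n)) + ennreal (exp (- (real MJ / exp (real n * (I0 + d))))) + ennreal (1 / sqrt (real n + 2)) +
       (of_nat M1 * ennreal (1 / exp (real n * (I1 - 2 * d))) + of_nat (M1 * MJ) * ennreal (1 / exp (real n * (I2 - 2 * d)))
        + of_nat (Mc * M1 * MJ) * ennreal (1 / exp (real n * (I3 - 2 * d))))) = ennreal (real (Mc * M1) * ?B)"
      using K(1) by (simp add: ennreal_of_nat_eq_real_of_nat ennreal_mult[symmetric] ennreal_plus[symmetric] del: ennreal_plus of_nat_mult)
    moreover have "0 \<le> real (Mc * M1) * ?B" using K(1) by (intro mult_nonneg_nonneg add_nonneg_nonneg) simp_all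
    ultimately show ?thesis using le by (simp add: ennreal_le_iff)
  qed
  define f1 where "f1 a b i = x1 n (w (IV a)) (w (IX a b)) i" for a b i
  define f2 where "f2 s a i = x2 n (w (IV a)) (w (IU a (RC.sel any_index w a s))) s i" for s a i
  define ok where "ok y t \<longleftrightarrow> fst t < Mc \<and> snd t < M1 \<and> RC.decoded w (fst t) (snd t) y" for y t
  \<comment> \<open>\<open>SOME\<close> is unambiguous, since \<open>decoded\<close> demands that
    all other pairs are rejected. The fallback \<open>(Mc, M1)\<close> lies outside the message set
    and is thus an error for every message.\<close>
  define g where "g y = (if \<exists>t. ok y t then SOME t. ok y t else (Mc, M1))" for y
  have g: "g y = (a, b) \<longleftrightarrow> RC.decoded w a b y" if ab: "a < Mc" "b < M1" for a b y
  proof (cases "\<exists>t. ok y t")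
    case True
    then have okg: "ok y (g y)" unfolding g_def using someI_ex[OF True] by simp
    then have "RC.pass w (fst (g y)) (snd (g y)) y" by (simp add: ok_def RC.decoded_def)
    then have "g y = (a, b)" if "RC.decoded w a b y"
      using that okg unfolding RC.decoded_def ok_def by (metis prod.collapse)
    moreover have "RC.decoded w a b y" if "g y = (a, b)" using okg that by (simp add: ok_def)
    ultimately show ?thesis by blast
  next
    case False
    then have "g y = (Mc, M1)" by (simp add: g_def)
    moreover have "\<not> RC.decoded w a b y" using False ab by (auto simp: ok_def)
    ultimately show ?thesis using ab by simp
  qed
  have out: "chan_out n f1 f2 a b s z = RC.out any_index w a b s z" for a b s z
    by (simp add: chan_out_def RC.out_def chan_def f1_def f2_def)
  have err: "err_event n Q N f1 f2 g a b = e a b w" if "a < Mc" "b < M1" for a b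
    by (rule set_eqI) (simp add: err_event_def e_def W out g[OF that] case_prod_unfold)
  have "valid_code n Mc M1 P1 P2 Q N f1 f2 g"
    unfolding valid_code_def using e_sets err by (auto simp: W f1_def f2_def x1_power x2_power)
  moreover have "err_prob n Mc M1 Q N f1 f2 g = (\<Sum>a<Mc. \<Sum>b<M1. measure W (e a b w)) / (real Mc * real M1)"
    unfolding err_prob_def by (simp add: err W)
  moreover have "S / (real m * real l) \<le> B" if "S \<le> real (m * l) * B" "m > 0" "l > 0" for S B :: real and m l :: nat
    using that by (simp add: pos_divide_le_eq mult.commute)
  from this[OF total M(1,2)] have "(\<Sum>a<Mc. \<Sum>b<M1. measure W (e a b w)) / (real Mc * real M1) \<le> ?B" .
  ultimately have "valid_code n Mc M1 P1 P2 Q N f1 f2 g \<and> err_prob n Mc M1 Q N f1 f2 g \<le> ?B"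
    by (simp only: simp_thms)
  then show ?thesis by blast
qed

end

section \<open>Achievable rates\<close>

lemma eventually_small_multiple:
  fixes C \<delta> :: real
  assumes "\<delta> > 0"
  shows "\<forall>\<^sub>F h in at_right 0. h * C \<le> \<delta>"
proof -
  have "((\<lambda>h. h * C) \<longlongrightarrow> 0 * C) (at_right 0)" by (intro tendsto_intros)
  then have "\<forall>\<^sub>F h in at_right 0. h * C < \<delta>" using assms by (intro order_tendstoD(2)) simp_all
  then show ?thesis by (rule eventually_mono) simp
qed

lemma nat_ceiling_bounds:
  fixes t :: real
  assumes "t \<ge> 1"
  shows "t \<le> real (nat \<lceil>t\<rceil>)" "real (nat \<lceil>t\<rceil>) \<le> 2 * t" "nat \<lceil>t\<rceil> > 0"
  using assms by linarith+

lemma msg_num_bounds: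
  assumes "R \<ge> 0"
  shows "real (msg_num n R) \<le> 2 * exp (real n * (R * ln 2))" "msg_num n R > 0"
proof -
  have eq: "2 powr (real n * R) = exp (real n * (R * ln 2))" by (simp add: powr_def)
  have "1 \<le> exp (real n * (R * ln 2))" using assms by simp
  from nat_ceiling_bounds[OF this] show "real (msg_num n R) \<le> 2 * exp (real n * (R * ln 2))" "msg_num n R > 0"
    by (simp_all add: msg_num_def eq)
qed

text \<open>Codes are demanded at every block length, also at \<open>n = 0\<close>, where an
  estimate in \<open>1 / n\<close> says nothing.\<close>

lemma trivial_code_valid:
  assumes "P1 \<ge> 0" "P2 \<ge> 0"
  shows "valid_code n Mc M1 P1 P2 Q N (\<lambda>_ _ _. 0) (\<lambda>_ _ _. 0) (\<lambda>_. (0, 0))"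
proof -
  have "err_event n Q N (\<lambda>_ _ _. 0) (\<lambda>_ _ _. 0) (\<lambda>_. (0, 0)) a b \<in> sets (state_noise_measure n Q N)" for a b
    by (cases "(a, b) = (0, 0)") (auto simp: err_event_def case_prod_unfold)
  then show ?thesis using assms by (simp add: valid_code_def)
qed

theorem gaussian_rates_achievable:
  fixes P1 P2 Q N a p b1 b2 \<kappa> \<alpha> Rc R1 :: real
  defines "q \<equiv> (1 + \<kappa>)\<^sup>2 * Q"
  defines "sg \<equiv> N + p * q * (1 - \<alpha>)\<^sup>2 / (p + \<alpha>\<^sup>2 * q)"
  assumes pos: "Q > 0" "N > 0" "a > 0" "p > 0" and R: "Rc \<ge> 0" "R1 \<ge> 0"
    and power: "b1\<^sup>2 + a < P1" "\<kappa>\<^sup>2 * Q + p + b2\<^sup>2 < P2"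
    and rate1: "R1 * ln 2 < ln ((a + sg) / sg) / 2"
    and rate2: "R1 * ln 2 + ln ((p + \<alpha>\<^sup>2 * q) / p) / 2 < ln ((a + (p + q + N)) / sg) / 2"
    and rate3: "(Rc + R1) * ln 2 + ln ((p + \<alpha>\<^sup>2 * q) / p) / 2 < ln (((b1 + b2)\<^sup>2 + (a + (p + q + N))) / sg) / 2"
  shows "achievable P1 P2 Q N (Rc, R1)"
proof -
  \<comment> \<open>The variances and exponents of the scheme do not involve \<open>d\<close> or
    \<open>h\<close>; the dummy values 1 give access to them before either can be chosen.\<close>
  interpret g: gaussian_scheme P1 P2 Q N a p b1 b2 \<kappa> \<alpha> 1 1
    by standard (use pos in auto)
  have Du: "g.Du = p + \<alpha>\<^sup>2 * q" and sg: "g.sg = sg"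
    by (simp_all add: g.Du_def g.sg_def g.k_def q_def sg_def)
  have T: "g.T1 = a + sg" "g.T2 = a + (p + q + N)" "g.T3 = (b1 + b2)\<^sup>2 + (a + (p + q + N))"
    by (simp_all add: g.T1_def g.T2_def g.T3_def g.c_def sg g.k_def q_def)
  have r1: "R1 * ln 2 < g.I1" and r2: "R1 * ln 2 + g.I0 < g.I2" and r3: "(Rc + R1) * ln 2 + g.I0 < g.I3"
    using rate1 rate2 rate3 by (simp_all add: g.I0_def g.I1_def g.I2_def g.I3_def Du sg T)
  have I0: "g.I0 \<ge> 0"
    using pos by (simp add: g.I0_def Du q_def)
  \<comment> \<open>In the two bounds with a list, \<open>2 * d\<close> goes into the list size and
    \<open>2 * d\<close> into the decoding threshold, and the last \<open>d\<close> remains as decay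
    exponent; hence a fifth of the smallest margin.\<close>
  define d where "d = min (g.I1 - R1 * ln 2) (min (g.I2 - (R1 * ln 2 + g.I0)) (g.I3 - ((Rc + R1) * ln 2 + g.I0))) / 5"
  have d: "d > 0" "5 * d \<le> g.I1 - R1 * ln 2" "5 * d \<le> g.I2 - (R1 * ln 2 + g.I0)" "5 * d \<le> g.I3 - ((Rc + R1) * ln 2 + g.I0)"
    using r1 r2 r3 by (auto simp: d_def)
  have Dp: "g.Du > 0" "g.sg > 0" "g.T1 > 0" "g.T2 > 0" "g.T3 > 0"
    by (rule g.Du_pos g.sg_pos g.T_pos)+
  \<comment> \<open>The requirements are finitely many, linear in \<open>h\<close>, with positive
    right sides, so they hold together near 0.\<close>
  have "\<forall>\<^sub>F h in at_right 0. h > (0::real) \<and>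
      h * (\<bar>b1\<bar> + 1)\<^sup>2 \<le> P1 - (b1\<^sup>2 + a) \<and>
      h * (\<bar>\<kappa>\<bar> + 1 + \<bar>b2\<bar>)\<^sup>2 \<le> P2 - (\<kappa>\<^sup>2 * Q + p + b2\<^sup>2) \<and>
      h * 1 \<le> p * d \<and>
      h * (\<bar>\<alpha> * g.k\<bar> + 1)\<^sup>2 \<le> g.Du * d \<and>
      h * (\<bar>g.k * (1 - g.\<beta> * \<alpha>)\<bar> + \<bar>1 - g.\<beta>\<bar> + 1)\<^sup>2 \<le> g.sg * d \<and>
      h * (\<bar>g.k * (1 - g.\<beta> * \<alpha>)\<bar> + \<bar>1 - g.\<beta>\<bar> + 1 + 1)\<^sup>2 \<le> g.T1 * d \<and>
      h * (\<bar>g.k\<bar> + 1 + 1 + 1)\<^sup>2 \<le> g.T2 * d \<and>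
      h * (\<bar>g.k\<bar> + 1 + \<bar>g.c\<bar> + 1 + 1)\<^sup>2 \<le> g.T3 * d"
    by (intro eventually_conj eventually_at_right_less eventually_small_multiple mult_pos_pos Dp d pos)
      (use power in auto)
  then obtain h where h: "h > 0"
      "h * (\<bar>b1\<bar> + 1)\<^sup>2 \<le> P1 - (b1\<^sup>2 + a)"
      "h * (\<bar>\<kappa>\<bar> + 1 + \<bar>b2\<bar>)\<^sup>2 \<le> P2 - (\<kappa>\<^sup>2 * Q + p + b2\<^sup>2)"
      "h * 1 \<le> p * d"
      "h * (\<bar>\<alpha> * g.k\<bar> + 1)\<^sup>2 \<le> g.Du * d"
      "h * (\<bar>g.k * (1 - g.\<beta> * \<alpha>)\<bar> + \<bar>1 - g.\<beta>\<bar> + 1)\<^sup>2 \<le> g.sg * d"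
      "h * (\<bar>g.k * (1 - g.\<beta> * \<alpha>)\<bar> + \<bar>1 - g.\<beta>\<bar> + 1 + 1)\<^sup>2 \<le> g.T1 * d"
      "h * (\<bar>g.k\<bar> + 1 + 1 + 1)\<^sup>2 \<le> g.T2 * d"
      "h * (\<bar>g.k\<bar> + 1 + \<bar>g.c\<bar> + 1 + 1)\<^sup>2 \<le> g.T3 * d"
    using eventually_happens'[OF trivial_limit_at_right_real] by blast
  interpret s: gaussian_scheme_slack P1 P2 Q N a p b1 b2 \<kappa> \<alpha> d h
  proof
    show "h \<le> p * d" using h(4) by simp
  qed (use pos d(1) h in auto)
  obtain K where K: "K \<ge> 0" "\<And>n. n > 0 \<Longrightarrow>
    (\<integral>\<^sup>+s. \<integral>\<^sup>+w. \<integral>\<^sup>+v. \<integral>\<^sup>+x. \<integral>\<^sup>+z. of_bool (\<not> typical 5 n h (five Q p 1 a N) (five s w v x z))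
      \<partial>gaussn n N \<partial>gaussn n a \<partial>gaussn n 1 \<partial>gaussn n p \<partial>gaussn n Q) \<le> ennreal (K / real n)"
    using typical_five_fails_bound[of Q p 1 a N h] pos h(1) by auto
  \<comment> \<open>The constant 14 is 2 + 4 + 8: rounding up a message or list size costs a factor
    of at most 2, and the three wrong-candidate terms contain one, two and three such sizes.\<close>
  define err where "err n = sqrt (real n + 2) * (K / real n) + exp (- exp (real n * d)) + 1 / sqrt (real n + 2) + 14 * exp (- (real n * d))" for n
  have code: "\<exists>f1 f2 gd. valid_code n (msg_num n Rc) (msg_num n R1) P1 P2 Q N f1 f2 gd \<and>
      (n > 0 \<longrightarrow> err_prob n (msg_num n Rc) (msg_num n R1) Q N f1 f2 gd \<le> err n)" for n
  proof (cases "n > 0")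
    case False
    with trivial_code_valid[OF less_imp_le less_imp_le, OF s.powers_pos] show ?thesis by blast
  next
    case n: True
    define Mc M1 where "Mc = msg_num n Rc" and "M1 = msg_num n R1"
    \<comment> \<open>The exponent exceeds the covering requirement \<open>I0 + d\<close> by
      \<open>d\<close>, which makes the chance of an uncovered state doubly exponentially small
      apart from atypicality.\<close>
    define MJ where "MJ = nat \<lceil>exp (real n * (g.I0 + 2 * d))\<rceil>"
    have Mc: "real Mc \<le> 2 * exp (real n * (Rc * ln 2))" "Mc > 0"
      and M1: "real M1 \<le> 2 * exp (real n * (R1 * ln 2))" "M1 > 0"
      using msg_num_bounds R by (simp_all add: Mc_def M1_def)
    have "1 \<le> exp (real n * (g.I0 + 2 * d))" using I0 d(1) by simp
    note MJ = nat_ceiling_bounds[OF this, folded MJ_def]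
    have t0: "exp (- (real MJ / exp (real n * (g.I0 + d)))) \<le> exp (- exp (real n * d))"
    proof -
      have "exp (real n * d) = exp (real n * (g.I0 + 2 * d)) / exp (real n * (g.I0 + d))"
        by (simp add: exp_diff[symmetric] algebra_simps)
      also have "\<dots> \<le> real MJ / exp (real n * (g.I0 + d))"
        using MJ(1) by (intro divide_right_mono) auto
      finally show ?thesis by simp
    qed
    have t1: "real M1 * (1 / exp (real n * (g.I1 - 2 * d))) \<le> 2 * exp (- (real n * d))"
    proof -
      have "real M1 * (1 / exp (real n * (g.I1 - 2 * d))) \<le> 2 * exp (real n * (R1 * ln 2)) * (1 / exp (real n * (g.I1 - 2 * d)))"
        using M1 by (intro mult_right_mono) auto
      also have "\<dots> = 2 * exp (real n * (R1 * ln 2 - (g.I1 - 2 * d)))"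
        by (simp add: exp_diff right_diff_distrib)
      also have "\<dots> \<le> 2 * exp (real n * (- d))"
        using d by (intro mult_left_mono exp_mono mult_left_mono) auto
      finally show ?thesis by simp
    qed
    have t2: "real (M1 * MJ) * (1 / exp (real n * (g.I2 - 2 * d))) \<le> 4 * exp (- (real n * d))"
    proof -
      have "real (M1 * MJ) * (1 / exp (real n * (g.I2 - 2 * d)))
         \<le> (2 * exp (real n * (R1 * ln 2))) * (2 * exp (real n * (g.I0 + 2 * d))) * (1 / exp (real n * (g.I2 - 2 * d)))"
        unfolding of_nat_mult using M1 MJ by (intro mult_right_mono mult_mono) auto
      also have "\<dots> = 4 * exp (real n * (R1 * ln 2 + (g.I0 + 2 * d) - (g.I2 - 2 * d)))"
      proof -
        have "(2 * exp x) * (2 * exp y) * (1 / exp z) = 4 * exp (x + y - z)" for x y z :: real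
          by (simp add: exp_add exp_diff)
        then show ?thesis by (simp only: right_diff_distrib distrib_left)
      qed
      also have "\<dots> \<le> 4 * exp (real n * (- d))"
        using d by (intro mult_left_mono exp_mono mult_left_mono) auto
      finally show ?thesis by simp
    qed
    have t3: "real (Mc * M1 * MJ) * (1 / exp (real n * (g.I3 - 2 * d))) \<le> 8 * exp (- (real n * d))"
    proof -
      have "real (Mc * M1 * MJ) * (1 / exp (real n * (g.I3 - 2 * d)))
         \<le> (2 * exp (real n * (Rc * ln 2))) * (2 * exp (real n * (R1 * ln 2))) * (2 * exp (real n * (g.I0 + 2 * d))) * (1 / exp (real n * (g.I3 - 2 * d)))"
        unfolding of_nat_mult using Mc M1 MJ by (intro mult_right_mono mult_mono) auto
      also have "\<dots> = 8 * exp (real n * (Rc * ln 2 + R1 * ln 2 + (g.I0 + 2 * d) - (g.I3 - 2 * d)))"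
      proof -
        have "(2 * exp x) * (2 * exp y) * (2 * exp z) * (1 / exp u) = 8 * exp (x + y + z - u)" for x y z u :: real
          by (simp add: exp_add exp_diff)
        then show ?thesis by (simp only: right_diff_distrib distrib_left)
      qed
      also have "\<dots> \<le> 8 * exp (real n * (- d))"
        using d by (intro mult_left_mono exp_mono mult_left_mono) (auto simp: distrib_right)
      finally show ?thesis by simp
    qed
    from s.code_exists[OF n Mc(2) M1(2) MJ(3) K(1) K(2)[OF n]] obtain f1 f2 gd where
      v: "valid_code n Mc M1 P1 P2 Q N f1 f2 gd" and e: "err_prob n Mc M1 Q N f1 f2 gd \<le>
        sqrt (real n + 2) * (K / real n) + exp (- (real MJ / exp (real n * (g.I0 + d)))) + 1 / sqrt (real n + 2) +
        (real M1 * (1 / exp (real n * (g.I1 - 2 * d))) + real (M1 * MJ) * (1 / exp (real n * (g.I2 - 2 * d)))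
         + real (Mc * M1 * MJ) * (1 / exp (real n * (g.I3 - 2 * d))))" by blast
    have "err_prob n Mc M1 Q N f1 f2 gd \<le> err n"
      unfolding err_def using e t0 t1 t2 t3 by linarith
    with v show ?thesis unfolding Mc_def M1_def by blast
  qed
  then obtain f1 f2 gd where fg: "\<And>n. valid_code n (msg_num n Rc) (msg_num n R1) P1 P2 Q N (f1 n) (f2 n) (gd n)"
      "\<And>n. n > 0 \<Longrightarrow> err_prob n (msg_num n Rc) (msg_num n R1) Q N (f1 n) (f2 n) (gd n) \<le> err n"
    by metis
  have "(\<lambda>n. err_prob n (msg_num n Rc) (msg_num n R1) Q N (f1 n) (f2 n) (gd n)) \<longlonglongrightarrow> 0"
  proof (rule tendsto_sandwich[where f = "\<lambda>_. 0" and h = err])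
    show "err \<longlonglongrightarrow> 0"
      unfolding err_def using d(1) by real_asymp
    show "\<forall>\<^sub>F n in sequentially. err_prob n (msg_num n Rc) (msg_num n R1) Q N (f1 n) (f2 n) (gd n) \<le> err n"
      using eventually_gt_at_top[of 0] by eventually_elim (rule fg(2))
    show "\<forall>\<^sub>F n in sequentially. 0 \<le> err_prob n (msg_num n Rc) (msg_num n R1) Q N (f1 n) (f2 n) (gd n)"
      by (simp add: err_prob_def sum_nonneg)
  qed (rule tendsto_const)
  with fg(1) show ?thesis unfolding achievable_def case_prod_conv by blast
qed

text \<open>Since division and \<open>log\<close> are total, real non-negative logarithms are
  expressed by positive denominators and arguments of at least 1. Every pair listed is itself
  achievable, so the closure enters only through \<open>closure_subset\<close>.\<close>

theorem theorem3:
  fixes P1 P2 Q N :: real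
  assumes "P1 \<ge> 0" "P2 \<ge> 0" "Q > 0" "N > 0"
  shows "(\<Union>(\<theta>, \<xi>, \<rho>, \<alpha>) \<in>
      {(\<theta>, \<xi>, \<rho>, \<alpha>). 0 \<le> \<theta> \<and> \<theta> \<le> 1 \<and> 0 \<le> \<xi> \<and> \<xi> \<le> 1 \<and>
         - sqrt (1 - \<xi>) \<le> \<rho> \<and> \<rho> \<le> 0 \<and>
         P2 * \<xi> + \<alpha>\<^sup>2 * Qt Q P2 \<rho> > 0 \<and>
         N + P2 * \<xi> * Qt Q P2 \<rho> * (1 - \<alpha>)\<^sup>2 / (P2 * \<xi> + \<alpha>\<^sup>2 * Qt Q P2 \<rho>) > 0 \<and>
         P2 * \<xi> * Qt Q P2 \<rho> * (1 - \<alpha>)\<^sup>2 + N * (P2 * \<xi> + \<alpha>\<^sup>2 * Qt Q P2 \<rho>) > 0 \<and>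
         P2 * \<xi> + Qt Q P2 \<rho> + N > 0 \<and>
         1 + \<theta> * P1 / (N + P2 * \<xi> * Qt Q P2 \<rho> * (1 - \<alpha>)\<^sup>2 / (P2 * \<xi> + \<alpha>\<^sup>2 * Qt Q P2 \<rho>)) \<ge> 1 \<and>
         P2 * \<xi> * (P2 * \<xi> + Qt Q P2 \<rho> + N + \<theta> * P1)
           / (P2 * \<xi> * Qt Q P2 \<rho> * (1 - \<alpha>)\<^sup>2 + N * (P2 * \<xi> + \<alpha>\<^sup>2 * Qt Q P2 \<rho>)) \<ge> 1 \<and>
         1 + ((sqrt ((1 - \<theta>) * P1) + sqrt (1 - \<xi> - \<rho>\<^sup>2) * sqrt P2)\<^sup>2 + \<theta> * P1)
           / (P2 * \<xi> + Qt Q P2 \<rho> + N) \<ge> 1 \<and>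
         P2 * \<xi> * (P2 * \<xi> + Qt Q P2 \<rho> + N)
           / (P2 * \<xi> * Qt Q P2 \<rho> * (1 - \<alpha>)\<^sup>2 + N * (P2 * \<xi> + \<alpha>\<^sup>2 * Qt Q P2 \<rho>)) \<ge> 1}.
      {(Rc, R1). 0 \<le> Rc \<and> 0 \<le> R1 \<and>
         R1 < 1/2 * log 2 (1 + \<theta> * P1 /
               (N + P2 * \<xi> * Qt Q P2 \<rho> * (1 - \<alpha>)\<^sup>2 / (P2 * \<xi> + \<alpha>\<^sup>2 * Qt Q P2 \<rho>))) \<and>
         R1 < 1/2 * log 2 (P2 * \<xi> * (P2 * \<xi> + Qt Q P2 \<rho> + N + \<theta> * P1)
               / (P2 * \<xi> * Qt Q P2 \<rho> * (1 - \<alpha>)\<^sup>2 + N * (P2 * \<xi> + \<alpha>\<^sup>2 * Qt Q P2 \<rho>))) \<and>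
         Rc + R1 < 1/2 * log 2 (1 + ((sqrt ((1 - \<theta>) * P1) + sqrt (1 - \<xi> - \<rho>\<^sup>2) * sqrt P2)\<^sup>2 + \<theta> * P1)
                      / (P2 * \<xi> + Qt Q P2 \<rho> + N))
                 + 1/2 * log 2 (P2 * \<xi> * (P2 * \<xi> + Qt Q P2 \<rho> + N)
               / (P2 * \<xi> * Qt Q P2 \<rho> * (1 - \<alpha>)\<^sup>2 + N * (P2 * \<xi> + \<alpha>\<^sup>2 * Qt Q P2 \<rho>)))})
    \<subseteq> capacity_region_G P1 P2 Q N"
proof -
  have main: "achievable P1 P2 Q N (Rc, R1)"
    if th: "0 \<le> \<theta>" "\<theta> \<le> 1" and xi: "0 \<le> \<xi>" "\<xi> \<le> 1" and rho: "- sqrt (1 - \<xi>) \<le> \<rho>" "\<rho> \<le> 0"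
      and last: "P2 * \<xi> * (P2 * \<xi> + Qt Q P2 \<rho> + N)
           / (P2 * \<xi> * Qt Q P2 \<rho> * (1 - \<alpha>)\<^sup>2 + N * (P2 * \<xi> + \<alpha>\<^sup>2 * Qt Q P2 \<rho>)) \<ge> 1"
      and R: "0 \<le> Rc" "0 \<le> R1"
      and rate1: "R1 < 1/2 * log 2 (1 + \<theta> * P1 /
               (N + P2 * \<xi> * Qt Q P2 \<rho> * (1 - \<alpha>)\<^sup>2 / (P2 * \<xi> + \<alpha>\<^sup>2 * Qt Q P2 \<rho>)))"
      and rate2: "R1 < 1/2 * log 2 (P2 * \<xi> * (P2 * \<xi> + Qt Q P2 \<rho> + N + \<theta> * P1)
               / (P2 * \<xi> * Qt Q P2 \<rho> * (1 - \<alpha>)\<^sup>2 + N * (P2 * \<xi> + \<alpha>\<^sup>2 * Qt Q P2 \<rho>)))"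
      and rate3: "Rc + R1 < 1/2 * log 2 (1 + ((sqrt ((1 - \<theta>) * P1) + sqrt (1 - \<xi> - \<rho>\<^sup>2) * sqrt P2)\<^sup>2 + \<theta> * P1)
                      / (P2 * \<xi> + Qt Q P2 \<rho> + N))
                 + 1/2 * log 2 (P2 * \<xi> * (P2 * \<xi> + Qt Q P2 \<rho> + N)
               / (P2 * \<xi> * Qt Q P2 \<rho> * (1 - \<alpha>)\<^sup>2 + N * (P2 * \<xi> + \<alpha>\<^sup>2 * Qt Q P2 \<rho>)))"
    for \<theta> \<xi> \<rho> \<alpha> Rc R1
  proof -
    define A where "A = \<theta> * P1"
    define P where "P = P2 * \<xi>"
    define B1 where "B1 = sqrt ((1 - \<theta>) * P1)"
    define B2 where "B2 = sqrt (1 - \<xi> - \<rho>\<^sup>2) * sqrt P2"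
    \<comment> \<open>Chosen so that (1 + \<kappa>) * sqrt Q = sqrt Q + \<rho> * sqrt P2, whose
      square is \<open>Qt Q P2 \<rho>\<close>.\<close>
    define \<kappa> where "\<kappa> = \<rho> * sqrt P2 / sqrt Q"
    \<comment> \<open>The factor \<open>t\<close> shrinks every amplitude set by an encoder,
      including the cancelling one, but not the state itself; hence \<open>1 + t * \<kappa>\<close>
      and no common factor.\<close>
    define q where "q t = (1 + t * \<kappa>)\<^sup>2 * Q" for t
    define D where "D t = t\<^sup>2 * P + \<alpha>\<^sup>2 * q t" for t
    define sg where "sg t = N + t\<^sup>2 * P * q t * (1 - \<alpha>)\<^sup>2 / D t" for t
    define T where "T t = t\<^sup>2 * A + (t\<^sup>2 * P + q t + N)" for t
    have q1: "q 1 = Qt Q P2 \<rho>"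
    proof -
      have "q 1 = ((1 + \<kappa>) * sqrt Q)\<^sup>2" using assms(3) by (simp add: q_def power_mult_distrib)
      also have "(1 + \<kappa>) * sqrt Q = sqrt Q + \<rho> * sqrt P2" using assms(3) by (simp add: \<kappa>_def field_simps)
      finally show ?thesis by (simp add: Qt_def)
    qed
    have q0: "q t \<ge> 0" for t using assms(3) by (simp add: q_def)
    \<comment> \<open>For \<open>P = 0\<close> the ratio in \<open>last\<close> would be 0 and not
      at least 1.\<close>
    have P: "P > 0"
    proof -
      have "P \<ge> 0" using assms(2) xi by (simp add: P_def)
      moreover have "P \<noteq> 0" using last by (auto simp: P_def)
      ultimately show ?thesis by simp
    qed
    have P2: "P2 > 0" using P xi assms(2) by (auto simp: P_def zero_less_mult_iff)
    have D: "D t > 0" if "t > 0" for t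
      using P q0[of t] that by (simp add: D_def add_pos_nonneg)
    have sg: "sg t > 0" if "t > 0" for t
      using P q0[of t] D[OF that] assms(4) by (simp add: sg_def add_pos_nonneg)
    have T: "T t > 0" if "A \<ge> 0" for t
      using P q0[of t] assms(4) that by (simp add: T_def add_nonneg_pos)
    \<comment> \<open>For \<open>A = 0\<close> the first rate bound would read
      \<open>R1 < 0\<close>.\<close>
    have A: "A > 0"
    proof -
      have "A \<ge> 0" using assms(1) th by (simp add: A_def)
      moreover have "A \<noteq> 0" using rate1 R(2) by (auto simp: A_def)
      ultimately show ?thesis by simp
    qed
    have P1: "P1 > 0" using A th assms(1) by (auto simp: A_def zero_less_mult_iff)
    have T1: "T t > 0" for t using T A by simp
    have den: "P2 * \<xi> * Qt Q P2 \<rho> * (1 - \<alpha>)\<^sup>2 + N * (P2 * \<xi> + \<alpha>\<^sup>2 * Qt Q P2 \<rho>) = D 1 * sg 1"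
      using D[of 1] by (simp add: sg_def distrib_left) (simp add: D_def P_def q1 algebra_simps)
    have sg1: "N + P2 * \<xi> * Qt Q P2 \<rho> * (1 - \<alpha>)\<^sup>2 / (P2 * \<xi> + \<alpha>\<^sup>2 * Qt Q P2 \<rho>) = sg 1"
      by (simp add: sg_def D_def P_def q1)
    have D1: "P + \<alpha>\<^sup>2 * q 1 = D 1" by (simp add: D_def)
    \<comment> \<open>The rate margins in nats as functions of the scaling: positive at 1 by the
      rate bounds and continuous there, they stay positive for some \<open>t < 1\<close>.\<close>
    define f1 where "f1 t = ln ((t\<^sup>2 * A + sg t) / sg t) / 2 - R1 * ln 2" for t
    define f2 where "f2 t = ln (T t / sg t) / 2 - (R1 * ln 2 + ln (D t / (t\<^sup>2 * P)) / 2)" for t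
    define f3 where "f3 t = ln (((t * B1 + t * B2)\<^sup>2 + T t) / sg t) / 2 - ((Rc + R1) * ln 2 + ln (D t / (t\<^sup>2 * P)) / 2)" for t
    have logln: "1/2 * log 2 x = ln x / 2 / ln 2" for x :: real by (simp add: log_def)
    have pos1: "f1 1 > 0"
    proof -
      have "(A + sg 1) / sg 1 = 1 + A / sg 1" using sg[of 1] by (simp add: field_simps)
      then show ?thesis using rate1 unfolding sg1 A_def[symmetric] logln
        by (simp add: f1_def pos_less_divide_eq)
    qed
    \<comment> \<open>The stated ratio merges an information term with the list cost
      \<open>D 1 / P\<close>; the logarithm separates them.\<close>
    have lnD: "ln (X * P / (D 1 * sg 1)) = ln (X / sg 1) - ln (D 1 / P)" if "X > 0" for X
      using that P D[of 1] sg[of 1] by (simp add: ln_div ln_mult)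
    have pos2: "f2 1 > 0"
    proof -
      have "P2 * \<xi> * (P2 * \<xi> + Qt Q P2 \<rho> + N + \<theta> * P1) = T 1 * P"
        by (simp add: T_def P_def A_def q1)
      then have "R1 * ln 2 < ln (T 1 * P / (D 1 * sg 1)) / 2"
        using rate2 unfolding den logln by (simp add: pos_less_divide_eq)
      then show ?thesis by (simp add: f2_def lnD[OF T1])
    qed
    have pos3: "f3 1 > 0"
    proof -
      \<comment> \<open>\<open>E\<close> is the output variance without \<open>v\<close> and
        \<open>x\<close>; it cancels between the two logarithms of the sum bound.\<close>
      define E where "E = P + q 1 + N"
      have den': "P * q 1 * (1 - \<alpha>)\<^sup>2 + N * (P + \<alpha>\<^sup>2 * q 1) = D 1 * sg 1" using den by (simp add: P_def q1)
      have E: "E > 0" using P q0[of 1] assms(4) by (simp add: E_def add_pos_nonneg)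
      have c: "0 < (B1 + B2)\<^sup>2 + T 1" using T1[of 1] by (simp add: add_nonneg_pos)
      have "1 + ((B1 + B2)\<^sup>2 + A) / E = ((B1 + B2)\<^sup>2 + T 1) / E"
        using E by (simp add: T_def E_def field_simps)
      moreover have "ln (P * E / (D 1 * sg 1)) = ln (E / sg 1) - ln (D 1 / P)"
        using lnD[OF E] by (simp add: mult.commute)
      ultimately have "(Rc + R1) * ln 2 < (ln (((B1 + B2)\<^sup>2 + T 1) / E) + (ln (E / sg 1) - ln (D 1 / P))) / 2"
        using rate3 unfolding logln B1_def[symmetric] B2_def[symmetric] A_def[symmetric] P_def[symmetric] q1[symmetric] E_def[symmetric] den'
        by (simp add: pos_less_divide_eq add_divide_distrib[symmetric] mult_ac)
      also have "ln (((B1 + B2)\<^sup>2 + T 1) / E) + (ln (E / sg 1) - ln (D 1 / P)) = ln (((B1 + B2)\<^sup>2 + T 1) / sg 1) - ln (D 1 / P)"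
        using c E sg[of 1] by (simp add: ln_div)
      finally show ?thesis by (simp add: f3_def)
    qed
    have cq: "isCont q 1" unfolding q_def by (intro continuous_intros)
    have cD: "isCont D 1" unfolding D_def by (intro continuous_intros cq)
    have cs: "isCont sg 1" unfolding sg_def by (intro continuous_intros cq cD) (use D[of 1] in auto)
    have cT: "isCont T 1" unfolding T_def by (intro continuous_intros cq)
    have cf1: "isCont f1 1"
      unfolding f1_def by (intro continuous_intros cs) (use sg[of 1] A in \<open>auto simp: add_pos_pos less_imp_neq[symmetric]\<close>)
    have cf2: "isCont f2 1"
      unfolding f2_def by (intro continuous_intros cs cT cD) (use sg[of 1] T1[of 1] D[of 1] P in auto)
    have cf3: "isCont f3 1"
      unfolding f3_def by (intro continuous_intros cs cT cD)
        (use sg[of 1] T1[of 1] D[of 1] P in \<open>auto simp: add_nonneg_pos less_imp_neq[symmetric]\<close>)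
    have ev: "\<forall>\<^sub>F t in at_left 1. f t > 0" if "isCont f 1" "f 1 > 0" for f :: "real \<Rightarrow> real"
      using that by (intro order_tendstoD(1)[where y = "f 1"]) (auto simp: isCont_def intro: filterlim_mono[OF _ order_refl at_le])
    have "\<forall>\<^sub>F t in at_left (1::real). f1 t > 0 \<and> f2 t > 0 \<and> f3 t > 0 \<and> 0 < t \<and> t < 1"
      using eventually_at_left_real[of 0 1]
      by (intro eventually_conj ev cf1 cf2 cf3 pos1 pos2 pos3) (auto elim: eventually_mono)
    then obtain t where t: "f1 t > 0" "f2 t > 0" "f3 t > 0" "0 < t" "t < 1"
      using eventually_happens'[OF trivial_limit_at_left_real] by blast
    have t2: "t\<^sup>2 < 1" using t by (simp add: power_less_one_iff)
    have "B1\<^sup>2 = (1 - \<theta>) * P1" unfolding B1_def using assms(1) th by (intro real_sqrt_pow2) simp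
    then have B1: "B1\<^sup>2 + A = P1" by (simp add: A_def algebra_simps)
    have rho2: "\<rho>\<^sup>2 \<le> 1 - \<xi>"
      using rho xi by (metis abs_le_square_iff abs_of_nonpos abs_of_nonneg neg_le_iff_le minus_minus real_sqrt_pow2 real_sqrt_ge_zero diff_ge_0_iff_ge minus_le_iff)
    \<comment> \<open>The shares add up to exactly \<open>P2\<close>, so only scaling by
      \<open>t < 1\<close> leaves spare power.\<close>
    have B2: "\<kappa>\<^sup>2 * Q + P + B2\<^sup>2 = P2"
      using assms rho2 by (simp add: \<kappa>_def P_def B2_def power_mult_distrib power_divide algebra_simps)
    show "achievable P1 P2 Q N (Rc, R1)"
    proof (rule gaussian_rates_achievable[where a = "t\<^sup>2 * A" and p = "t\<^sup>2 * P" and ?b1.0 = "t * B1" and ?b2.0 = "t * B2" and \<kappa> = "t * \<kappa>" and \<alpha> = \<alpha>])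
      have "(t * B1)\<^sup>2 + t\<^sup>2 * A = t\<^sup>2 * P1" unfolding B1[symmetric] by (simp add: power_mult_distrib distrib_left)
      also have "\<dots> < 1 * P1" using t2 P1 by (intro mult_strict_right_mono)
      finally show "(t * B1)\<^sup>2 + t\<^sup>2 * A < P1" by simp
      have "(t * \<kappa>)\<^sup>2 * Q + t\<^sup>2 * P + (t * B2)\<^sup>2 = t\<^sup>2 * P2" unfolding B2[symmetric] by (simp add: power_mult_distrib distrib_left)
      also have "\<dots> < 1 * P2" using t2 P2 by (intro mult_strict_right_mono)
      finally show "(t * \<kappa>)\<^sup>2 * Q + t\<^sup>2 * P + (t * B2)\<^sup>2 < P2" by simp
    qed (use t assms R A P in \<open>simp_all add: f1_def f2_def f3_def sg_def D_def T_def q_def\<close>)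
  qed
  show ?thesis
    unfolding capacity_region_G_def
    by (intro subset_trans[OF _ closure_subset] subsetI)
      (clarsimp simp only: mem_Collect_eq case_prod_conv UN_iff split_paired_all Bex_def split_paired_Ex,
        rule main[rotated 11], assumption+)
qed

end
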